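(* Let $F_1\subseteq F_2\subseteq\cdots \subseteq F_n\subseteq\cdots$ be an ascending chain (indexed by the positive integers) of non-abelian free groups, each a subgroup of the next, and let $F_{\infty}=\bigcup_{i=1}^{\infty}F_i$. Then the group ring $KF_{\infty}$ is primitive for any field $K$. In particular, every group ring of a countable non-abelian locally free group over a field is primitive.
   Context: A group is locally free if all of its finitely generated subgroups are free. A ring is (right) primitive if it has a faithful irreducible (right) module. The free groups $F_i$ may have arbitrary (also infinite, unbounded) ranks. *)

theory Defs
  imports "HOL-Algebra.Algebra" "HOL-Library.Countable_Set"
begin

section \<open>Free and locally free groups\<close>

text \<open>A letter \<open>(s, True)\<close> stands for the generator \<open>s\<close> and \<open>(s, False)\<close> for its formal inverse.\<close>

definition letter_value :: "('g, 'm) monoid_scheme \<Rightarrow> 'g \<times> bool \<Rightarrow> 'g" where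
  "letter_value G l = (if snd l then fst l else inv\<^bsub>G\<^esub> (fst l))"

definition word_value :: "('g, 'm) monoid_scheme \<Rightarrow> ('g \<times> bool) list \<Rightarrow> 'g" where
  "word_value G w = foldr (\<lambda>l x. letter_value G l \<otimes>\<^bsub>G\<^esub> x) w \<one>\<^bsub>G\<^esub>"

definition reduced_word :: "('g \<times> bool) list \<Rightarrow> bool" where
  "reduced_word w \<longleftrightarrow> successively (\<lambda>l l'. \<not> (fst l = fst l' \<and> snd l \<noteq> snd l')) w"

text \<open>\<open>S\<close> is a free basis of \<open>G\<close> if every element of \<open>G\<close> is the value of exactly one reduced word
  over \<open>S\<close>; there is no restriction on the cardinality of \<open>S\<close>.\<close>

definition free_basis :: "('g, 'm) monoid_scheme \<Rightarrow> 'g set \<Rightarrow> bool" where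
  "free_basis G S \<longleftrightarrow> S \<subseteq> carrier G \<and>
     bij_betw (word_value G) {w. fst ` set w \<subseteq> S \<and> reduced_word w} (carrier G)"

definition free_group :: "('g, 'm) monoid_scheme \<Rightarrow> bool" where
  "free_group G \<longleftrightarrow> group G \<and> (\<exists>S. free_basis G S)"

definition locally_free_group :: "('g, 'm) monoid_scheme \<Rightarrow> bool" where
  "locally_free_group G \<longleftrightarrow> group G \<and>
     (\<forall>S. finite S \<and> S \<subseteq> carrier G \<longrightarrow> free_group (subgroup_generated G S))"


section \<open>Ascending chains of groups\<close>

text \<open>Unlike \<open>subgroup\<close>, this relates two group structures. Their operations are only compared on
  the smaller carrier, because a record's operation is arbitrary outside its carrier.\<close>

definition is_subgroup_of :: "('g, 'm) monoid_scheme \<Rightarrow> ('g, 'n) monoid_scheme \<Rightarrow> bool" where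
  "is_subgroup_of H G \<longleftrightarrow> group H \<and> group G \<and> carrier H \<subseteq> carrier G \<and>
     (\<forall>x\<in>carrier H. \<forall>y\<in>carrier H. x \<otimes>\<^bsub>H\<^esub> y = x \<otimes>\<^bsub>G\<^esub> y)"

text \<open>Two elements of the union of an ascending chain are multiplied in a member containing both;
  by the lemma \<open>is_subgroup_of_chain_union\<close> below, the choice of that member does not matter.\<close>

definition chain_union :: "(nat \<Rightarrow> ('g, 'm) monoid_scheme) \<Rightarrow> 'g monoid" where
  "chain_union F =
     \<lparr>carrier = (\<Union>i. carrier (F i)),
      monoid.mult = (\<lambda>x y. x \<otimes>\<^bsub>F (LEAST i. x \<in> carrier (F i) \<and> y \<in> carrier (F i))\<^esub> y),
      monoid.one = \<one>\<^bsub>F 0\<^esub>\<rparr>"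

lemma is_subgroup_of_chain:
  assumes "\<And>i. is_subgroup_of (F i) (F (Suc i))" "i \<le> j"
  shows "is_subgroup_of (F i) (F j)"
  using assms(2)
proof (induction j rule: dec_induct)
  case base
  then show ?case using assms(1)[of i] by (auto simp: is_subgroup_of_def)
next
  case (step n)
  then show ?case using assms(1)[of n] by (auto simp: is_subgroup_of_def)
qed

lemma is_subgroup_of_one:
  assumes "is_subgroup_of H G"
  shows "\<one>\<^bsub>H\<^esub> = \<one>\<^bsub>G\<^esub>"
proof -
  interpret H: group H using assms by (simp add: is_subgroup_of_def)
  interpret G: group G using assms by (simp add: is_subgroup_of_def)
  have "\<one>\<^bsub>H\<^esub> \<in> carrier G" "\<one>\<^bsub>H\<^esub> \<otimes>\<^bsub>G\<^esub> \<one>\<^bsub>H\<^esub> = \<one>\<^bsub>H\<^esub>"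
    using assms H.one_closed H.r_one unfolding is_subgroup_of_def by (blast, metis)
  then show ?thesis by (metis G.l_cancel_one)
qed

lemma is_subgroup_of_chain_union:
  assumes chain: "\<And>i. is_subgroup_of (F i) (F (Suc i))"
  shows "is_subgroup_of (F i) (chain_union F)"
proof -
  let ?U = "chain_union F"
  note le = is_subgroup_of_chain[where F = F, OF chain]
  have grp: "group (F i)" for i
    using chain[of i] by (simp add: is_subgroup_of_def)
  have mult: "x \<otimes>\<^bsub>?U\<^esub> y = x \<otimes>\<^bsub>F i\<^esub> y" if "x \<in> carrier (F i)" "y \<in> carrier (F i)" for x y i
  proof -
    define k where "k = (LEAST i. x \<in> carrier (F i) \<and> y \<in> carrier (F i))"
    have "k \<le> i" "x \<in> carrier (F k)" "y \<in> carrier (F k)"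
      using that LeastI[of "\<lambda>i. x \<in> carrier (F i) \<and> y \<in> carrier (F i)" i]
        Least_le[of "\<lambda>i. x \<in> carrier (F i) \<and> y \<in> carrier (F i)" i]
      by (auto simp: k_def)
    then show ?thesis
      using le[of k i] by (simp add: chain_union_def is_subgroup_of_def flip: k_def)
  qed
  have one: "\<one>\<^bsub>?U\<^esub> = \<one>\<^bsub>F i\<^esub>" for i
    using is_subgroup_of_one[OF le[of 0 i]] by (simp add: chain_union_def)
  have sub: "carrier (F i) \<subseteq> carrier ?U" for i
    by (auto simp: chain_union_def)
  have mono: "carrier (F i) \<subseteq> carrier (F j)" if "i \<le> j" for i j
    using le[OF that] by (simp add: is_subgroup_of_def)
  have ex: "\<exists>i. x \<in> carrier (F i) \<and> y \<in> carrier (F i) \<and> z \<in> carrier (F i)"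
    if xyz: "x \<in> carrier ?U" "y \<in> carrier ?U" "z \<in> carrier ?U" for x y z
  proof -
    obtain a b c where "x \<in> carrier (F a)" "y \<in> carrier (F b)" "z \<in> carrier (F c)"
      using xyz by (auto simp: chain_union_def)
    then show ?thesis
      using mono[of a "max a (max b c)"] mono[of b "max a (max b c)"] mono[of c "max a (max b c)"]
      by (intro exI[of _ "max a (max b c)"]) (auto simp: subset_iff)
  qed
  have "group ?U"
  proof (rule groupI)
    fix x y assume "x \<in> carrier ?U" "y \<in> carrier ?U"
    then obtain i where i: "x \<in> carrier (F i)" "y \<in> carrier (F i)"
      using ex by blast
    then have "x \<otimes>\<^bsub>F i\<^esub> y \<in> carrier (F i)"
      by (intro monoid.m_closed group.is_monoid grp)
    then show "x \<otimes>\<^bsub>?U\<^esub> y \<in> carrier ?U"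
      using mult[OF i] sub by auto
  next
    have "\<one>\<^bsub>F 0\<^esub> \<in> carrier (F 0)"
      by (intro monoid.one_closed group.is_monoid grp)
    then show "\<one>\<^bsub>?U\<^esub> \<in> carrier ?U"
      using one[of 0] sub[of 0] by auto
  next
    fix x y z assume "x \<in> carrier ?U" "y \<in> carrier ?U" "z \<in> carrier ?U"
    then obtain i where i: "x \<in> carrier (F i)" "y \<in> carrier (F i)" "z \<in> carrier (F i)"
      using ex by blast
    interpret Fi: group "F i" by (rule grp)
    show "x \<otimes>\<^bsub>?U\<^esub> y \<otimes>\<^bsub>?U\<^esub> z = x \<otimes>\<^bsub>?U\<^esub> (y \<otimes>\<^bsub>?U\<^esub> z)"
      using i by (simp add: mult[where i = i] Fi.m_assoc)
  next
    fix x assume "x \<in> carrier ?U"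
    then obtain i where i: "x \<in> carrier (F i)"
      using ex by blast
    interpret Fi: group "F i" by (rule grp)
    show "\<one>\<^bsub>?U\<^esub> \<otimes>\<^bsub>?U\<^esub> x = x"
      using i by (simp add: mult[where i = i] one[of i])
    show "\<exists>y\<in>carrier ?U. y \<otimes>\<^bsub>?U\<^esub> x = \<one>\<^bsub>?U\<^esub>"
      using i sub[of i] by (intro bexI[of _ "inv\<^bsub>F i\<^esub> x"]) (auto simp: mult[where i = i] one[of i])
  qed
  then show ?thesis
    using grp sub mult by (simp add: is_subgroup_of_def)
qed


section \<open>Group rings\<close>

text \<open>Elements of \<open>KG\<close> are the finitely supported functions from \<open>G\<close> to \<open>K\<close>, extended by zero outside
  \<open>carrier G\<close>; the product is convolution. For \<open>z\<close> outside \<open>carrier G\<close> the convolution sum is empty.\<close>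

definition gr_support :: "('k, 'm) ring_scheme \<Rightarrow> ('g \<Rightarrow> 'k) \<Rightarrow> 'g set" where
  "gr_support K a = {x. a x \<noteq> \<zero>\<^bsub>K\<^esub>}"

definition group_ring :: "('k, 'm) ring_scheme \<Rightarrow> ('g, 'n) monoid_scheme \<Rightarrow> ('g \<Rightarrow> 'k) ring" where
  "group_ring K G =
     \<lparr>carrier = {a. (\<forall>x. a x \<in> carrier K) \<and> gr_support K a \<subseteq> carrier G \<and> finite (gr_support K a)},
      monoid.mult = (\<lambda>a b z. finsum K (\<lambda>(x, y). a x \<otimes>\<^bsub>K\<^esub> b y)
        {(x, y) \<in> gr_support K a \<times> gr_support K b. x \<otimes>\<^bsub>G\<^esub> y = z}),
      monoid.one = (\<lambda>z. if z = \<one>\<^bsub>G\<^esub> then \<one>\<^bsub>K\<^esub> else \<zero>\<^bsub>K\<^esub>),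
      ring.zero = (\<lambda>z. \<zero>\<^bsub>K\<^esub>),
      ring.add = (\<lambda>a b z. a z \<oplus>\<^bsub>K\<^esub> b z)\<rparr>"


section \<open>Primitive rings\<close>

text \<open>The library's \<open>module\<close> locale needs a commutative ring. Here \<open>r \<odot>\<^bsub>M\<^esub> x\<close> denotes the right action
  \<open>x \<cdot> r\<close>, hence the order of the factors in \<open>rsmult_assoc\<close>. As for the library's modules, the fields
  \<open>mult\<close> and \<open>one\<close> of \<open>M\<close> are irrelevant.\<close>

locale right_module = R?: ring R + M?: abelian_group M
  for R :: "('r, 'c) ring_scheme" (structure) and M :: "('r, 'm, 'd) module_scheme" (structure) +
  assumes rsmult_closed:
      "\<lbrakk>r \<in> carrier R; x \<in> carrier M\<rbrakk> \<Longrightarrow> r \<odot>\<^bsub>M\<^esub> x \<in> carrier M"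
    and rsmult_add_ring:
      "\<lbrakk>r \<in> carrier R; s \<in> carrier R; x \<in> carrier M\<rbrakk> \<Longrightarrow>
        (r \<oplus>\<^bsub>R\<^esub> s) \<odot>\<^bsub>M\<^esub> x = r \<odot>\<^bsub>M\<^esub> x \<oplus>\<^bsub>M\<^esub> s \<odot>\<^bsub>M\<^esub> x"
    and rsmult_add_module:
      "\<lbrakk>r \<in> carrier R; x \<in> carrier M; y \<in> carrier M\<rbrakk> \<Longrightarrow>
        r \<odot>\<^bsub>M\<^esub> (x \<oplus>\<^bsub>M\<^esub> y) = r \<odot>\<^bsub>M\<^esub> x \<oplus>\<^bsub>M\<^esub> r \<odot>\<^bsub>M\<^esub> y"
    and rsmult_assoc:
      "\<lbrakk>r \<in> carrier R; s \<in> carrier R; x \<in> carrier M\<rbrakk> \<Longrightarrow>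
        (r \<otimes>\<^bsub>R\<^esub> s) \<odot>\<^bsub>M\<^esub> x = s \<odot>\<^bsub>M\<^esub> (r \<odot>\<^bsub>M\<^esub> x)"
    and rsmult_one:
      "x \<in> carrier M \<Longrightarrow> \<one>\<^bsub>R\<^esub> \<odot>\<^bsub>M\<^esub> x = x"

text \<open>The library's \<open>submodule\<close> only asks for an additive subgroup closed under \<open>\<odot>\<close>, so it is also the
  notion of a right submodule.\<close>

definition irreducible_right_module ::
    "('r, 'c) ring_scheme \<Rightarrow> ('r, 'm, 'd) module_scheme \<Rightarrow> bool" where
  "irreducible_right_module R M \<longleftrightarrow> right_module R M \<and> carrier M \<noteq> {\<zero>\<^bsub>M\<^esub>} \<and>
     (\<forall>N. submodule N R M \<longrightarrow> N = {\<zero>\<^bsub>M\<^esub>} \<or> N = carrier M)"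

definition faithful_right_module ::
    "('r, 'c) ring_scheme \<Rightarrow> ('r, 'm, 'd) module_scheme \<Rightarrow> bool" where
  "faithful_right_module R M \<longleftrightarrow> right_module R M \<and>
     (\<forall>r\<in>carrier R. (\<forall>x\<in>carrier M. r \<odot>\<^bsub>M\<^esub> x = \<zero>\<^bsub>M\<^esub>) \<longrightarrow> r = \<zero>\<^bsub>R\<^esub>)"

text \<open>The type of the module's elements has to be fixed in the definition. Sets of ring elements are
  enough, since an irreducible right module is a quotient of the ring by a right ideal; the lemma
  \<open>right_primitiveI\<close> below shows that no modules are missed.\<close>

definition right_primitive :: "('r, 'c) ring_scheme \<Rightarrow> bool" where
  "right_primitive R \<longleftrightarrow> ring R \<and>
     (\<exists>M :: ('r, 'r set) module. irreducible_right_module R M \<and> faithful_right_module R M)"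

lemma right_primitiveI:
  fixes R :: "('r, 'c) ring_scheme" and M :: "('r, 'm, 'd) module_scheme"
  assumes irr: "irreducible_right_module R M" and faith: "faithful_right_module R M"
  shows "right_primitive R"
proof -
  interpret right_module R M
    using irr by (simp add: irreducible_right_module_def)
  have simple: "N = {\<zero>\<^bsub>M\<^esub>} \<or> N = carrier M" if "submodule N R M" for N
    using irr that by (simp add: irreducible_right_module_def)
  have nz: "carrier M \<noteq> {\<zero>\<^bsub>M\<^esub>}"
    using irr by (simp add: irreducible_right_module_def)
  then obtain m where m: "m \<in> carrier M" "m \<noteq> \<zero>\<^bsub>M\<^esub>"
    using M.zero_closed by blast
  note closed = rsmult_closed
  have zero_act: "\<zero>\<^bsub>R\<^esub> \<odot>\<^bsub>M\<^esub> x = \<zero>\<^bsub>M\<^esub>" if "x \<in> carrier M" for x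
    using rsmult_add_ring[of "\<zero>\<^bsub>R\<^esub>" "\<zero>\<^bsub>R\<^esub>" x] closed[of "\<zero>\<^bsub>R\<^esub>" x] that by simp
  have neg_act: "(\<ominus>\<^bsub>R\<^esub> r) \<odot>\<^bsub>M\<^esub> x = \<ominus>\<^bsub>M\<^esub> (r \<odot>\<^bsub>M\<^esub> x)" if "r \<in> carrier R" "x \<in> carrier M" for r x
    using rsmult_add_ring[of "\<ominus>\<^bsub>R\<^esub> r" r x] that zero_act[of x]
    by (metis M.minus_equality R.a_inv_closed R.l_neg closed)
  have inv_eq: "inv\<^bsub>add_monoid M\<^esub> x = \<ominus>\<^bsub>M\<^esub> x" for x
    by (simp only: a_inv_def)
  let ?O = "(\<lambda>r. r \<odot>\<^bsub>M\<^esub> m) ` carrier R"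
  have "submodule ?O R M"
  proof (intro submodule.intro submodule_axioms.intro)
    show "subgroup ?O (add_monoid M)"
    proof (rule group.subgroupI)
      show "group (add_monoid M)" by (rule M.a_group)
      show "?O \<subseteq> carrier (add_monoid M)" using m closed by auto
      show "?O \<noteq> {}" by auto
      show "inv\<^bsub>add_monoid M\<^esub> a \<in> ?O" if a: "a \<in> ?O" for a
      proof -
        obtain r where "r \<in> carrier R" "a = r \<odot>\<^bsub>M\<^esub> m"
          using a by blast
        then show ?thesis
          unfolding inv_eq
          using m(1) neg_act[of r m] by (intro image_eqI[of _ _ "\<ominus>\<^bsub>R\<^esub> r"]) simp_all
      qed
      show "a \<otimes>\<^bsub>add_monoid M\<^esub> b \<in> ?O" if ab: "a \<in> ?O" "b \<in> ?O" for a b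
      proof -
        obtain r s where "r \<in> carrier R" "a = r \<odot>\<^bsub>M\<^esub> m" "s \<in> carrier R" "b = s \<odot>\<^bsub>M\<^esub> m"
          using ab by blast
        then show ?thesis
          using m(1) by (intro image_eqI[of _ _ "r \<oplus>\<^bsub>R\<^esub> s"]) (simp_all add: rsmult_add_ring)
      qed
    qed
    show "a \<odot>\<^bsub>M\<^esub> x \<in> ?O" if ax: "a \<in> carrier R" "x \<in> ?O" for a x
    proof -
      obtain r where "r \<in> carrier R" "x = r \<odot>\<^bsub>M\<^esub> m"
        using ax by blast
      then show ?thesis
        using m(1) ax(1) by (intro image_eqI[of _ _ "r \<otimes>\<^bsub>R\<^esub> a"]) (simp_all add: rsmult_assoc)
    qed
  qed
  moreover have "m \<in> ?O"
    using rsmult_one[OF m(1)] R.one_closed by (metis image_eqI)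
  ultimately have onto: "?O = carrier M"
    using simple[of ?O] m(2) by auto
  define f where "f = (\<lambda>x. {r \<in> carrier R. r \<odot>\<^bsub>M\<^esub> m = x})"
  define g where "g = inv_into (carrier M) f"
  have inj: "inj_on f (carrier M)"
  proof (rule inj_onI)
    fix x y assume "x \<in> carrier M" and eq: "f x = f y"
    then have "x \<in> ?O" by (simp only: onto)
    then obtain r where "r \<in> carrier R" "r \<odot>\<^bsub>M\<^esub> m = x"
      by (auto simp only: image_iff)
    then show "x = y"
      using eq by (auto simp: f_def)
  qed
  have gf: "g (f x) = x" if "x \<in> carrier M" for x
    using inj that by (simp add: g_def)
  define M' :: "('r, 'r set) module" where "M' =
    \<lparr>carrier = f ` carrier M, monoid.mult = undefined, monoid.one = undefined,
     ring.zero = f \<zero>\<^bsub>M\<^esub>, ring.add = (\<lambda>A B. f (g A \<oplus>\<^bsub>M\<^esub> g B)), module.smult = (\<lambda>r A. f (r \<odot>\<^bsub>M\<^esub> g A))\<rparr>"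
  have carr: "carrier M' = f ` carrier M" and zero': "\<zero>\<^bsub>M'\<^esub> = f \<zero>\<^bsub>M\<^esub>"
    by (auto simp: M'_def)
  have add': "f x \<oplus>\<^bsub>M'\<^esub> f y = f (x \<oplus>\<^bsub>M\<^esub> y)" if "x \<in> carrier M" "y \<in> carrier M" for x y
    using that by (simp add: M'_def gf)
  have smult': "r \<odot>\<^bsub>M'\<^esub> f x = f (r \<odot>\<^bsub>M\<^esub> x)" if "x \<in> carrier M" for r x
    using that by (simp add: M'_def gf)
  have ab: "abelian_group M'"
  proof (rule abelian_groupI)
    show "\<exists>B\<in>carrier M'. B \<oplus>\<^bsub>M'\<^esub> A = \<zero>\<^bsub>M'\<^esub>" if A: "A \<in> carrier M'" for A
    proof -
      obtain x where x: "x \<in> carrier M" "A = f x"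
        using A by (auto simp: carr)
      then show ?thesis
        by (intro bexI[of _ "f (\<ominus>\<^bsub>M\<^esub> x)"]) (auto simp: carr zero' add' M.l_neg)
    qed
  qed (auto simp: carr zero' add' M.a_assoc M.a_comm M.a_lcomm)
  have rm: "right_module R M'"
  proof (intro right_module.intro right_module_axioms.intro)
    show "ring R" by (rule R.ring_axioms)
    show "abelian_group M'" by (rule ab)
  qed (auto simp: carr add' smult' closed rsmult_add_ring rsmult_add_module rsmult_assoc rsmult_one)
  have "N' = {\<zero>\<^bsub>M'\<^esub>} \<or> N' = carrier M'" if N': "submodule N' R M'" for N'
  proof -
    define N where "N = {x \<in> carrier M. f x \<in> N'}"
    interpret S: submodule N' R M' by (rule N')
    interpret M': abelian_group M' by (rule ab)
    have N'eq: "N' = f ` N"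
      using S.subset by (auto simp: N_def carr)
    have "submodule N R M"
    proof (intro submodule.intro submodule_axioms.intro)
      show smN: "a \<odot>\<^bsub>M\<^esub> x \<in> N" if "a \<in> carrier R" "x \<in> N" for a x
        using that S.smult_closed[of a "f x"] by (auto simp: N_def smult' closed)
      show "subgroup N (add_monoid M)"
      proof (rule group.subgroupI)
        show "group (add_monoid M)" by (rule M.a_group)
        show "N \<subseteq> carrier (add_monoid M)" by (auto simp: N_def)
        have "\<zero>\<^bsub>M\<^esub> \<in> N"
          using S.one_closed by (simp add: N_def zero')
        then show "N \<noteq> {}" by auto
        show "inv\<^bsub>add_monoid M\<^esub> a \<in> N" if "a \<in> N" for a
          unfolding inv_eq
          using that smN[of "\<ominus>\<^bsub>R\<^esub> \<one>\<^bsub>R\<^esub>" a] neg_act[of "\<one>\<^bsub>R\<^esub>" a] by (simp add: N_def rsmult_one)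
        show "a \<otimes>\<^bsub>add_monoid M\<^esub> b \<in> N" if "a \<in> N" "b \<in> N" for a b
          using that S.m_closed[of "f a" "f b"] by (auto simp: N_def add')
      qed
    qed
    then have "N = {\<zero>\<^bsub>M\<^esub>} \<or> N = carrier M" by (rule simple)
    then show ?thesis
      by (auto simp: N'eq carr zero')
  qed
  moreover have "carrier M' \<noteq> {\<zero>\<^bsub>M'\<^esub>}"
  proof
    assume "carrier M' = {\<zero>\<^bsub>M'\<^esub>}"
    then have "f m = f \<zero>\<^bsub>M\<^esub>" using m by (auto simp: carr zero')
    then show False using inj m by (auto dest: inj_onD)
  qed
  ultimately have "irreducible_right_module R M'"
    using rm by (simp add: irreducible_right_module_def)
  moreover have "faithful_right_module R M'"
    unfolding faithful_right_module_def
  proof (intro conjI rm ballI impI)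
    fix r assume r: "r \<in> carrier R" "\<forall>A\<in>carrier M'. r \<odot>\<^bsub>M'\<^esub> A = \<zero>\<^bsub>M'\<^esub>"
    have "r \<odot>\<^bsub>M\<^esub> x = \<zero>\<^bsub>M\<^esub>" if x: "x \<in> carrier M" for x
    proof -
      have "f (r \<odot>\<^bsub>M\<^esub> x) = f \<zero>\<^bsub>M\<^esub>"
        using r x smult'[OF x, of r] by (auto simp: carr zero')
      then show ?thesis
        using inj closed[OF r(1) x] by (auto dest: inj_onD)
    qed
    then show "r = \<zero>\<^bsub>R\<^esub>"
      using faith r(1) by (simp add: faithful_right_module_def)
  qed
  ultimately show ?thesis
    using R.ring_axioms unfolding right_primitive_def by blast
qed

end

theory Submission
  imports Defs
begin

text \<open>By Zorn's lemma it suffices to find a proper right ideal \<open>\<rho>\<close> of \<open>KG\<close> that is comaximal with every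
  nonzero two-sided ideal \<open>J\<close>: for a maximal right ideal \<open>M\<close> above \<open>\<rho>\<close>, the annihilator of \<open>KG/M\<close>
  is a two-sided ideal inside \<open>M\<close>, hence zero.

  A nonzero \<open>J\<close> contains an element \<open>a\<close> whose support \<open>L\<close> avoids \<open>1\<close> and whose coefficient at a
  chosen \<open>g\<^sub>L \<in> L\<close> is \<open>1\<close>. With elements \<open>t\<^sub>L\<^sub>i\<close> and \<open>y\<^sub>L\<^sub>j\<close> of \<open>G\<close>, where \<open>i, j < 3\<close>, put
  \<open>e\<^sub>L(x) = \<Sum>\<^sub>i\<^sub>j t\<^sub>L\<^sub>i y\<^sub>L\<^sub>j\<inverse> x y\<^sub>L\<^sub>j\<close>, and let \<open>\<rho>\<close> be generated by \<open>1 + e\<^sub>L(g\<^sub>L)\<close> and the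
  \<open>e\<^sub>L(g)\<close>, \<open>g \<in> L - {g\<^sub>L}\<close>, for all \<open>L\<close>. Then \<open>1 + e\<^sub>L(a) \<in> \<rho>\<close> and \<open>e\<^sub>L(a) \<in> J\<close>. The generators do
  not involve the coefficients of \<open>a\<close>, so the cardinality of \<open>K\<close> plays no role.

  \<open>\<rho>\<close> is proper by counting. If the \<open>t\<^sub>L\<^sub>i\<close> are part of a free family, and for each \<open>L\<close> no product of
  conjugates of elements of \<open>L\<close> by successively different \<open>y\<^sub>L\<^sub>j\<close> collapses, then both sums over three
  indices strictly increase the size of the support of a linear combination, so that the part
  coming from the \<open>e\<^sub>L\<close> cannot be cancelled by the part coming from the summands \<open>1\<close>.
  The \<open>y\<^sub>L\<^sub>j\<close> only have to be chosen inside one free group \<open>F\<^sub>i\<close> containing \<open>L\<close>, as \<open>a\<^sup>N b\<^sup>j\<close> with two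
  letters \<open>a, b\<close>. The \<open>t\<^sub>L\<^sub>i\<close> require a free family of the cardinality of \<open>G\<close>, which is assembled
  from the letters of \<open>F\<^sub>i\<^sub>+\<^sub>1\<close> that do not occur in the elements of \<open>F\<^sub>i\<close>.\<close>

section \<open>Primitivity from a comaximal right ideal\<close>

definition right_ideal :: "'r set \<Rightarrow> ('r, 'c) ring_scheme \<Rightarrow> bool" where
  "right_ideal I R \<longleftrightarrow> additive_subgroup I R \<and> (\<forall>x\<in>I. \<forall>r\<in>carrier R. x \<otimes>\<^bsub>R\<^esub> r \<in> I)"

text \<open>Additive inverses are right multiples by \<open>\<ominus> \<one>\<close>, so closure
  under sums and right multiplication already gives an additive subgroup.\<close>

lemma (in ring) right_ideal_iff:
  "right_ideal I R \<longleftrightarrow> I \<subseteq> carrier R \<and> \<zero> \<in> I \<and> (\<forall>x\<in>I. \<forall>y\<in>I. x \<oplus> y \<in> I) \<and>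
     (\<forall>x\<in>I. \<forall>r\<in>carrier R. x \<otimes> r \<in> I)" (is "_ \<longleftrightarrow> ?rhs")
proof
  assume "right_ideal I R"
  then interpret additive_subgroup I R by (simp add: right_ideal_def)
  show ?rhs using \<open>right_ideal I R\<close> a_subset by (auto simp: right_ideal_def)
next
  assume r: ?rhs
  have neg: "\<ominus> x \<in> I" if "x \<in> I" for x
  proof -
    have "x \<otimes> (\<ominus> \<one>) \<in> I" using r that by blast
    moreover have "x \<in> carrier R" using r that by blast
    ultimately show ?thesis by (simp add: r_minus)
  qed
  have "subgroup I (add_monoid R)"
  proof (rule group.subgroupI[OF a_group])
    show "I \<subseteq> carrier (add_monoid R)" "I \<noteq> {}" using r by auto
    show "inv\<^bsub>add_monoid R\<^esub> a \<in> I" if "a \<in> I" for a using neg[OF that] by (simp add: a_inv_def)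
    show "a \<otimes>\<^bsub>add_monoid R\<^esub> b \<in> I" if "a \<in> I" "b \<in> I" for a b using r that by simp
  qed
  then show "right_ideal I R" using r by (auto simp: right_ideal_def intro: additive_subgroupI)
qed

text \<open>Zorn's lemma for the right ideals that contain \<open>I\<close> and avoid
  \<open>\<one>\<close>: two elements of the union of a chain lie in a common member, and no member
  contains \<open>\<one>\<close>.\<close>

lemma (in ring) maximal_right_ideal_exists:
  assumes "right_ideal I R" "\<one> \<notin> I"
  obtains M where "right_ideal M R" "I \<subseteq> M" "\<one> \<notin> M"
    "\<And>N. right_ideal N R \<Longrightarrow> M \<subseteq> N \<Longrightarrow> \<one> \<notin> N \<Longrightarrow> N = M"
proof -
  define A where "A = {J. right_ideal J R \<and> I \<subseteq> J \<and> \<one> \<notin> J}"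
  have "\<exists>M\<in>A. \<forall>W\<in>A. M \<subseteq> W \<longrightarrow> W = M"
  proof (rule subset_Zorn_nonempty)
    show "A \<noteq> {}" using assms by (auto simp: A_def)
    fix C assume C: "C \<noteq> {}" "subset.chain A C"
    have CA: "J \<in> A" if "J \<in> C" for J using C that by (auto simp: subset_chain_def)
    have tot: "J \<subseteq> J' \<or> J' \<subseteq> J" if "J \<in> C" "J' \<in> C" for J J'
      using C that by (auto simp: subset_chain_def)
    have "right_ideal (\<Union>C) R"
      unfolding right_ideal_iff
    proof (intro conjI ballI)
      show "\<Union>C \<subseteq> carrier R" using CA by (fastforce simp: A_def right_ideal_iff)
      show "\<zero> \<in> \<Union>C" using CA C(1) by (fastforce simp: A_def right_ideal_iff)
      show "x \<oplus> y \<in> \<Union>C" if "x \<in> \<Union>C" "y \<in> \<Union>C" for x y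
      proof -
        obtain J J' where J: "x \<in> J" "y \<in> J'" "J \<in> C" "J' \<in> C" using \<open>x \<in> \<Union>C\<close> \<open>y \<in> \<Union>C\<close> by blast
        then obtain L where "L \<in> C" "x \<in> L" "y \<in> L" using tot[of J J'] by blast
        then show ?thesis using CA[of L] by (auto simp: A_def right_ideal_iff)
      qed
      show "x \<otimes> r \<in> \<Union>C" if "x \<in> \<Union>C" "r \<in> carrier R" for x r
        using that CA by (fastforce simp: A_def right_ideal_iff)
    qed
    moreover have "I \<subseteq> \<Union>C" "\<one> \<notin> \<Union>C" using CA C(1) by (fastforce simp: A_def)+
    ultimately show "\<Union>C \<in> A" by (simp add: A_def)
  qed
  then obtain M where "M \<in> A" "\<And>W. W \<in> A \<Longrightarrow> M \<subseteq> W \<Longrightarrow> W = M" by blast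
  then show thesis by (intro that[of M]) (auto simp: A_def)
qed

text \<open>Elements are cosets, which fits the type of sets of ring elements in
  \<open>right_primitive\<close>. The action takes a union over all representatives instead of
  choosing one; \<open>smult_Q\<close> shows that the united cosets are all equal.\<close>

definition quotient_right_module :: "('r, 'c) ring_scheme \<Rightarrow> 'r set \<Rightarrow> ('r, 'r set) module" where
  "quotient_right_module R M =
    \<lparr>carrier = a_rcosets\<^bsub>R\<^esub> M, monoid.mult = undefined, monoid.one = undefined,
     ring.zero = M, ring.add = set_add R, module.smult = (\<lambda>r W. \<Union>x\<in>W. a_r_coset R M (x \<otimes>\<^bsub>R\<^esub> r))\<rparr>"

section \<open>The quotient of a ring by a right ideal\<close>

locale ring_with_right_ideal = ring R for R (structure) +
  fixes M
  assumes rid: "right_ideal M R"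
begin

lemma abelian_sub: "abelian_subgroup M R"
  using rid by (intro abelian_subgroupI3) (auto simp: right_ideal_def is_abelian_group)

interpretation abelian_subgroup M R by (rule abelian_sub)

abbreviation Q where "Q \<equiv> quotient_right_module R M"

lemma rmult_closed: "x \<in> M \<Longrightarrow> r \<in> carrier R \<Longrightarrow> x \<otimes> r \<in> M"
  using rid by (auto simp: right_ideal_def)

lemma coset_eq_iff:
  "x \<in> carrier R \<Longrightarrow> y \<in> carrier R \<Longrightarrow> M +> x = M +> y \<longleftrightarrow> x \<ominus> y \<in> M"
  using a_rcos_module_minus[OF ring_axioms, of y x] a_repr_independence'[of x y]
    a_repr_independenceD[of x y] by metis

lemma coset_zero_iff: "x \<in> carrier R \<Longrightarrow> M +> x = M \<longleftrightarrow> x \<in> M"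
  using a_coset_join1[of M x] a_coset_join2[of x M] a_subgroup by blast

lemma carrier_Q: "carrier Q = (\<lambda>x. M +> x) ` carrier R"
  by (auto simp: quotient_right_module_def A_RCOSETS_def')

lemma zero_Q: "\<zero>\<^bsub>Q\<^esub> = M +> \<zero>" by (simp add: quotient_right_module_def a_subset)

lemma add_Q: "x \<in> carrier R \<Longrightarrow> y \<in> carrier R \<Longrightarrow> (M +> x) \<oplus>\<^bsub>Q\<^esub> (M +> y) = M +> (x \<oplus> y)"
  by (simp add: quotient_right_module_def a_rcos_sum)

lemma smult_Q:
  assumes "x \<in> carrier R" "r \<in> carrier R"
  shows "r \<odot>\<^bsub>Q\<^esub> (M +> x) = M +> (x \<otimes> r)"
proof -
  \<comment> \<open>Independence of the representative: passing from \<open>x\<close> to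
    \<open>m \<oplus> x\<close> changes \<open>x \<otimes> r\<close> by
    \<open>m \<otimes> r\<close>, which stays in the right ideal \<open>M\<close>.\<close>
  have "M +> (y \<otimes> r) = M +> (x \<otimes> r)" if y: "y \<in> M +> x" for y
  proof -
    obtain m where m: "m \<in> M" "y = m \<oplus> x" using y by (auto simp: a_r_coset_def')
    then have mc: "m \<in> carrier R" using a_subset by auto
    have "y \<otimes> r \<ominus> x \<otimes> r = m \<otimes> r"
      using m mc assms by (simp add: l_distr minus_eq a_assoc r_neg)
    then show ?thesis using assms m mc by (subst coset_eq_iff) (auto simp: rmult_closed)
  qed
  moreover have "x \<in> M +> x" using a_rcos_self assms by blast
  ultimately have "(\<Union>y\<in>M +> x. M +> (y \<otimes> r)) = M +> (x \<otimes> r)" by blast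
  then show ?thesis by (simp add: quotient_right_module_def)
qed

lemma right_module_Q: "right_module R Q"
proof (intro right_module.intro right_module_axioms.intro)
  show "ring R" by (rule ring_axioms)
  show "abelian_group Q"
  proof (rule abelian_groupI)
    show "\<exists>Y\<in>carrier Q. Y \<oplus>\<^bsub>Q\<^esub> W = \<zero>\<^bsub>Q\<^esub>" if W: "W \<in> carrier Q" for W
    proof -
      obtain x where "x \<in> carrier R" "W = M +> x" using W by (auto simp: carrier_Q)
      then show ?thesis
        by (intro bexI[of _ "M +> (\<ominus> x)"]) (auto simp: carrier_Q add_Q zero_Q l_neg)
    qed
  qed (auto simp: carrier_Q zero_Q add_Q a_ac)
  show "r \<odot>\<^bsub>Q\<^esub> x \<in> carrier Q" if "r \<in> carrier R" "x \<in> carrier Q" for r x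
    using that by (auto simp: carrier_Q smult_Q)
  show "(r \<oplus> s) \<odot>\<^bsub>Q\<^esub> x = r \<odot>\<^bsub>Q\<^esub> x \<oplus>\<^bsub>Q\<^esub> s \<odot>\<^bsub>Q\<^esub> x"
    if "r \<in> carrier R" "s \<in> carrier R" "x \<in> carrier Q" for r s x
    using that by (auto simp: carrier_Q smult_Q add_Q r_distr)
  show "r \<odot>\<^bsub>Q\<^esub> (x \<oplus>\<^bsub>Q\<^esub> y) = r \<odot>\<^bsub>Q\<^esub> x \<oplus>\<^bsub>Q\<^esub> r \<odot>\<^bsub>Q\<^esub> y"
    if "r \<in> carrier R" "x \<in> carrier Q" "y \<in> carrier Q" for r x y
    using that by (auto simp: carrier_Q smult_Q add_Q l_distr)
  show "(r \<otimes> s) \<odot>\<^bsub>Q\<^esub> x = s \<odot>\<^bsub>Q\<^esub> (r \<odot>\<^bsub>Q\<^esub> x)"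
    if "r \<in> carrier R" "s \<in> carrier R" "x \<in> carrier Q" for r s x
    using that by (auto simp: carrier_Q smult_Q m_assoc)
  show "\<one> \<odot>\<^bsub>Q\<^esub> x = x" if "x \<in> carrier Q" for x
    using that by (auto simp: carrier_Q smult_Q)
qed

text \<open>The preimage of a submodule in the ring is a right ideal above \<open>M\<close>. By
  maximality it is \<open>M\<close> itself or contains \<open>\<one>\<close>, and in the latter case
  it is the whole ring.\<close>

lemma irreducible_Q:
  assumes "\<one> \<notin> M" and max: "\<And>N. right_ideal N R \<Longrightarrow> M \<subseteq> N \<Longrightarrow> \<one> \<notin> N \<Longrightarrow> N = M"
  shows "irreducible_right_module R Q"
  unfolding irreducible_right_module_def
proof (intro conjI allI impI right_module_Q)
  have "M +> \<one> \<in> carrier Q" unfolding carrier_Q by (intro imageI one_closed)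
  moreover have "M +> \<one> \<noteq> \<zero>\<^bsub>Q\<^esub>"
    using assms(1) coset_zero_iff[of \<one>] by (simp add: quotient_right_module_def)
  ultimately show "carrier Q \<noteq> {\<zero>\<^bsub>Q\<^esub>}" by blast
  fix N assume "submodule N R Q"
  then interpret N: submodule N R Q .
  define P where "P = {x \<in> carrier R. M +> x \<in> N}"
  have zN: "M +> \<zero> \<in> N" using N.one_closed by (simp add: zero_Q)
  have NP: "N = (\<lambda>x. M +> x) ` P"
    using N.subset by (auto simp: P_def carrier_Q)
  have "right_ideal P R"
    unfolding right_ideal_iff
  proof (intro conjI ballI)
    show "x \<oplus> y \<in> P" if "x \<in> P" "y \<in> P" for x y
      using that N.m_closed[of "M +> x" "M +> y"] by (auto simp: P_def add_Q)
    show "x \<otimes> r \<in> P" if "x \<in> P" "r \<in> carrier R" for x r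
      using that N.smult_closed[of r "M +> x"] by (auto simp: P_def smult_Q)
  qed (use zN in \<open>auto simp: P_def\<close>)
  have M_coset: "M +> x = M" if "x \<in> M" for x
    using that a_subset coset_zero_iff[of x] by blast
  then have "M \<subseteq> P"
    using zN a_subset by (auto simp: P_def)
  show "N = {\<zero>\<^bsub>Q\<^esub>} \<or> N = carrier Q"
  proof (cases "\<one> \<in> P")
    case True
    have "r \<in> P" if "r \<in> carrier R" for r
    proof -
      have "\<one> \<otimes> r \<in> P" using \<open>right_ideal P R\<close> True that unfolding right_ideal_iff by blast
      then show ?thesis using that by simp
    qed
    then have "P = carrier R" by (auto simp: P_def)
    then have "N = carrier Q" by (simp only: NP carrier_Q)
    then show ?thesis ..
  next
    case False
    then have "P = M" using max \<open>right_ideal P R\<close> \<open>M \<subseteq> P\<close> by blast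
    moreover have "M +> x = \<zero>\<^bsub>Q\<^esub>" if "x \<in> M" for x
      using M_coset that by (simp add: quotient_right_module_def)
    moreover have "M \<noteq> {}" using zero_closed by blast
    ultimately have "N = {\<zero>\<^bsub>Q\<^esub>}" unfolding NP by (subst image_cong[OF refl, of _ _ "\<lambda>_. \<zero>\<^bsub>Q\<^esub>"]) auto
    then show ?thesis ..
  qed
qed

end

lemma (in ring) right_primitive_if_comaximal:
  assumes "right_ideal I R" "\<one> \<notin> I"
    and com: "\<And>J. ideal J R \<Longrightarrow> J \<noteq> {\<zero>} \<Longrightarrow> \<exists>e\<in>J. \<one> \<oplus> e \<in> I"
  shows "right_primitive R"
proof -
  obtain M where M: "right_ideal M R" "I \<subseteq> M" "\<one> \<notin> M"
    "\<And>N. right_ideal N R \<Longrightarrow> M \<subseteq> N \<Longrightarrow> \<one> \<notin> N \<Longrightarrow> N = M"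
    by (rule maximal_right_ideal_exists[OF assms(1,2)]) blast
  interpret ring_with_right_ideal R M by unfold_locales (rule M(1))
  interpret M: abelian_subgroup M R by (rule abelian_sub)
  \<comment> \<open>The annihilator of \<open>Q\<close>: a ring element kills every coset iff all
    its left multiples lie in \<open>M\<close>.\<close>
  define J where "J = {r \<in> carrier R. \<forall>x\<in>carrier R. x \<otimes> r \<in> M}"
  have J: "ideal J R"
  proof (rule idealI)
    show "ring R" by (rule ring_axioms)
    show "subgroup J (add_monoid R)"
    proof (rule group.subgroupI[OF a_group])
      show "J \<noteq> {}" using M.zero_closed by (auto simp: J_def intro!: exI[of _ \<zero>])
      show "inv\<^bsub>add_monoid R\<^esub> a \<in> J" if "a \<in> J" for a
        using that by (auto simp: J_def r_minus simp flip: a_inv_def)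
    qed (auto simp: J_def r_distr)
  qed (auto simp: J_def simp flip: m_assoc intro: rmult_closed)
  have "J = {\<zero>}"
  proof (rule ccontr)
    assume "J \<noteq> {\<zero>}"
    then obtain e where e: "e \<in> J" "\<one> \<oplus> e \<in> M" using com[OF J] M(2) by blast
    \<comment> \<open>Since \<open>e = \<one> \<otimes> e\<close> lies in \<open>M\<close>, the
      element \<open>\<one> \<oplus> e\<close> of \<open>M\<close> would put \<open>\<one>\<close>
      into \<open>M\<close>.\<close>
    have "e \<in> carrier R" "e \<in> M" using e(1) by (auto simp: J_def) (metis l_one one_closed)
    then have "(\<one> \<oplus> e) \<oplus> (\<ominus> e) \<in> M" using e by auto
    then show False using \<open>e \<in> carrier R\<close> M(3) by (simp add: a_assoc r_neg)
  qed
  have "r = \<zero>" if "r \<in> carrier R" "\<forall>W\<in>carrier Q. r \<odot>\<^bsub>Q\<^esub> W = \<zero>\<^bsub>Q\<^esub>" for r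
  proof -
    have "x \<otimes> r \<in> M" if "x \<in> carrier R" for x
    proof -
      have "M +> (x \<otimes> r) = M +> \<zero>"
        using \<open>r \<in> carrier R\<close> \<open>x \<in> carrier R\<close> \<open>\<forall>W\<in>_. _\<close> by (auto simp: carrier_Q smult_Q zero_Q)
      then show ?thesis using \<open>r \<in> carrier R\<close> \<open>x \<in> carrier R\<close> by (simp add: coset_zero_iff M.a_subset)
    qed
    then show ?thesis using \<open>J = {\<zero>}\<close> \<open>r \<in> carrier R\<close> by (auto simp: J_def)
  qed
  then have "faithful_right_module R Q"
    using right_module_Q by (auto simp: faithful_right_module_def)
  then show ?thesis
    using irreducible_Q M(3,4) ring_axioms by (auto simp: right_primitive_def)
qed

section \<open>Finitely supported functions and group rings\<close>

text \<open>The free module on \<open>A\<close>. The index set is arbitrary, so that the same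
  calculus serves elements of the group ring and formal combinations indexed by
  \<open>vertices\<close>.\<close>

definition fin_fun :: "('k, 'm) ring_scheme \<Rightarrow> 'v set \<Rightarrow> ('v \<Rightarrow> 'k) set" where
  "fin_fun K A = {f. (\<forall>x. f x \<in> carrier K) \<and> gr_support K f \<subseteq> A \<and> finite (gr_support K f)}"

definition single :: "('k, 'm) ring_scheme \<Rightarrow> 'v \<Rightarrow> 'k \<Rightarrow> 'v \<Rightarrow> 'k" where
  "single K v k = (\<lambda>x. if x = v then k else \<zero>\<^bsub>K\<^esub>)"

definition fun_add :: "('k, 'm) ring_scheme \<Rightarrow> ('v \<Rightarrow> 'k) \<Rightarrow> ('v \<Rightarrow> 'k) \<Rightarrow> 'v \<Rightarrow> 'k" where
  "fun_add K f g = (\<lambda>x. f x \<oplus>\<^bsub>K\<^esub> g x)"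

text \<open>The linear extension of \<open>n\<close> to free modules. Translations in the group ring
  and relabellings of formal combinations are instances.\<close>

definition pushforward :: "('k, 'm) ring_scheme \<Rightarrow> ('v \<Rightarrow> 'u) \<Rightarrow> ('v \<Rightarrow> 'k) \<Rightarrow> 'u \<Rightarrow> 'k" where
  "pushforward K n f = (\<lambda>u. finsum K f {v \<in> gr_support K f. n v = u})"

section \<open>Additivity of pushforwards\<close>

context ring
begin

lemma fin_funD:
  assumes "f \<in> fin_fun R A"
  shows "f x \<in> carrier R" "gr_support R f \<subseteq> A" "finite (gr_support R f)"
  using assms by (auto simp: fin_fun_def)

lemma fin_fun_UNIV: "f \<in> fin_fun R A \<Longrightarrow> f \<in> fin_fun R UNIV"
  by (auto simp: fin_fun_def)

lemma support_add: "gr_support R (fun_add R f g) \<subseteq> gr_support R f \<union> gr_support R g"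
  by (auto simp: gr_support_def fun_add_def)

lemma support_single: "gr_support R (single R v k) \<subseteq> {v}"
  by (auto simp: gr_support_def single_def)

lemma fin_fun_zero: "(\<lambda>_. \<zero>) \<in> fin_fun R A"
  by (auto simp: fin_fun_def gr_support_def)

lemma fin_fun_single: "v \<in> A \<Longrightarrow> k \<in> carrier R \<Longrightarrow> single R v k \<in> fin_fun R A"
  by (auto simp: fin_fun_def gr_support_def single_def)

lemma fin_fun_add:
  assumes "f \<in> fin_fun R A" "g \<in> fin_fun R A"
  shows "fun_add R f g \<in> fin_fun R A"
  using assms support_add[of f g] finite_subset[OF support_add[of f g]]
  by (auto simp: fin_fun_def fun_add_def)

lemma fun_add_assoc:
  "f \<in> fin_fun R A \<Longrightarrow> g \<in> fin_fun R A \<Longrightarrow> h \<in> fin_fun R A \<Longrightarrow>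
    fun_add R (fun_add R f g) h = fun_add R f (fun_add R g h)"
  by (auto simp: fun_add_def fin_fun_def a_assoc)

lemma fun_add_comm:
  "f \<in> fin_fun R A \<Longrightarrow> g \<in> fin_fun R A \<Longrightarrow> fun_add R f g = fun_add R g f"
  by (auto simp: fun_add_def fin_fun_def a_comm)

lemma fun_add_zero:
  "f \<in> fin_fun R A \<Longrightarrow> fun_add R f (\<lambda>_. \<zero>) = f" "f \<in> fin_fun R A \<Longrightarrow> fun_add R (\<lambda>_. \<zero>) f = f"
  by (auto simp: fun_add_def fin_fun_def)

lemma fun_add_swap:
  assumes "a \<in> fin_fun R A" "b \<in> fin_fun R A" "c \<in> fin_fun R A" "d \<in> fin_fun R A"
  shows "fun_add R (fun_add R a b) (fun_add R c d) = fun_add R (fun_add R a c) (fun_add R b d)"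
  using assms by (auto simp: fun_add_def fin_fun_def a_ac)

lemma fin_fun_remove:
  assumes f: "f \<in> fin_fun R A" and v: "v \<in> gr_support R f"
  shows "f(v := \<zero>) \<in> fin_fun R A" "gr_support R (f(v := \<zero>)) = gr_support R f - {v}"
    "f = fun_add R (single R v (f v)) (f(v := \<zero>))"
proof -
  show *: "gr_support R (f(v := \<zero>)) = gr_support R f - {v}" by (auto simp: gr_support_def)
  show "f(v := \<zero>) \<in> fin_fun R A" using f unfolding fin_fun_def * by (auto simp: *)
  show "f = fun_add R (single R v (f v)) (f(v := \<zero>))"
    using f by (auto simp: fun_add_def single_def fin_fun_def)
qed

text \<open>Splitting one point off the support lowers its size; additive identities thus only have
  to be checked on \<open>single\<close>.\<close>

lemma fin_fun_induct [consumes 1, case_names zero add]: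
  assumes "f \<in> fin_fun R A"
    and zero: "P (\<lambda>_. \<zero>)"
    and add: "\<And>v k f. \<lbrakk>v \<in> A; k \<in> carrier R; f \<in> fin_fun R A; P f\<rbrakk> \<Longrightarrow> P (fun_add R (single R v k) f)"
  shows "P f"
  using assms(1)
proof (induction "card (gr_support R f)" arbitrary: f)
  case 0
  then have "f = (\<lambda>_. \<zero>)" by (auto simp: fin_fun_def gr_support_def)
  then show ?case using zero by simp
next
  case (Suc n)
  then obtain v where v: "v \<in> gr_support R f" by fastforce
  note r = fin_fun_remove[OF Suc.prems v]
  have "P (f(v := \<zero>))"
    using Suc.hyps(2) v fin_funD(3)[OF Suc.prems] by (intro Suc.hyps(1) r(1)) (simp add: r(2))
  then show ?case
    using add[of v "f v" "f(v := \<zero>)"] r v Suc.prems by (auto simp: fin_fun_def)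
qed

text \<open>Zero terms may be added to the sum, so that functions with different supports can be
  compared over one finite set.\<close>

lemma pushforward_eq:
  assumes "f \<in> fin_fun R UNIV" "finite A" "gr_support R f \<subseteq> A"
  shows "pushforward R n f u = finsum R f {v \<in> A. n v = u}"
  unfolding pushforward_def using assms
  by (intro add.finprod_mono_neutral_cong_left) (auto simp: fin_fun_def gr_support_def)

lemma pushforward_zero: "pushforward R n (\<lambda>_. \<zero>) = (\<lambda>_. \<zero>)"
  by (auto simp: pushforward_def gr_support_def)

lemma pushforward_single:
  assumes "k \<in> carrier R"
  shows "pushforward R n (single R v k) = single R (n v) k"
proof
  fix u
  have "pushforward R n (single R v k) u = finsum R (single R v k) {w \<in> {v}. n w = u}"
    using assms support_single[of v k] by (intro pushforward_eq fin_fun_single) auto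
  also have "\<dots> = single R (n v) k u"
  proof (cases "n v = u")
    case True
    then have e: "{w \<in> {v}. n w = u} = {v}" by auto
    show ?thesis unfolding e using True assms by (simp add: single_def)
  next
    case False
    then have e: "{w \<in> {v}. n w = u} = {}" by auto
    show ?thesis unfolding e using False by (simp add: single_def)
  qed
  finally show "pushforward R n (single R v k) u = single R (n v) k u" .
qed

lemma pushforward_add:
  assumes f: "f \<in> fin_fun R UNIV" and g: "g \<in> fin_fun R UNIV"
  shows "pushforward R n (fun_add R f g) = fun_add R (pushforward R n f) (pushforward R n g)"
proof
  fix u
  let ?A = "gr_support R f \<union> gr_support R g"
  have fin: "finite ?A" using f g by (auto simp: fin_fun_def)
  have *: "pushforward R n h u = finsum R h {v \<in> ?A. n v = u}"
    if "h \<in> fin_fun R UNIV" "gr_support R h \<subseteq> ?A" for h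
    using that fin by (intro pushforward_eq) auto
  have "finsum R (fun_add R f g) {v \<in> ?A. n v = u} =
      finsum R f {v \<in> ?A. n v = u} \<oplus> finsum R g {v \<in> ?A. n v = u}"
    unfolding fun_add_def using f g by (intro finsum_addf) (auto simp: fin_fun_def)
  then show "pushforward R n (fun_add R f g) u = fun_add R (pushforward R n f) (pushforward R n g) u"
    using *[OF fin_fun_add[OF f g] support_add] *[OF f] *[OF g] by (simp add: fun_add_def)
qed

lemma support_pushforward:
  shows "gr_support R (pushforward R n f) \<subseteq> n ` gr_support R f"
proof
  fix u assume u: "u \<in> gr_support R (pushforward R n f)"
  have "{v \<in> gr_support R f. n v = u} \<noteq> {}"
  proof
    assume e: "{v \<in> gr_support R f. n v = u} = {}"
    have "pushforward R n f u = \<zero>" unfolding pushforward_def e by simp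
    then show False using u by (simp add: gr_support_def)
  qed
  then show "u \<in> n ` gr_support R f" by auto
qed

lemma fin_fun_pushforward:
  assumes f: "f \<in> fin_fun R A" and n: "n ` A \<subseteq> B"
  shows "pushforward R n f \<in> fin_fun R B"
proof -
  have "pushforward R n f u \<in> carrier R" for u
    unfolding pushforward_def using f by (intro finsum_closed) (auto simp: fin_fun_def)
  moreover have "finite (gr_support R (pushforward R n f))"
    using f by (intro finite_subset[OF support_pushforward] finite_imageI) (auto simp: fin_fun_def)
  ultimately show ?thesis
    using support_pushforward[of n f] n f by (fastforce simp: fin_fun_def)
qed

lemma pushforward_comp:
  assumes "f \<in> fin_fun R A"
  shows "pushforward R m (pushforward R n f) = pushforward R (\<lambda>x. m (n x)) f"
  using assms
proof (induction rule: fin_fun_induct)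
  case zero
  then show ?case by (simp add: pushforward_zero)
next
  case (add v k f)
  then show ?case
    by (simp add: pushforward_add pushforward_single fin_fun_pushforward[where B = UNIV]
        fin_fun_single fin_fun_UNIV)
qed

lemma pushforward_cong:
  assumes "\<And>x. x \<in> gr_support R f \<Longrightarrow> n x = m x"
  shows "pushforward R n f = pushforward R m f"
proof
  fix u
  have "{v \<in> gr_support R f. n v = u} = {v \<in> gr_support R f. m v = u}" using assms by auto
  then show "pushforward R n f u = pushforward R m f u" by (simp add: pushforward_def)
qed

lemma pushforward_id: "f \<in> fin_fun R A \<Longrightarrow> pushforward R (\<lambda>x. x) f = f"
proof (induction rule: fin_fun_induct)
  case zero
  then show ?case by (simp add: pushforward_zero)
next
  case (add v k f)
  then show ?case
    by (simp add: pushforward_add pushforward_single fin_fun_single fin_fun_UNIV)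
qed

end

text \<open>The external product on pairs. Convolution is its \<open>pushforward\<close> along the
  group multiplication, so the bilinearity of the product follows from that of this
  function.\<close>

definition tensor :: "('k, 'm) ring_scheme \<Rightarrow> ('v \<Rightarrow> 'k) \<Rightarrow> ('u \<Rightarrow> 'k) \<Rightarrow> 'v \<times> 'u \<Rightarrow> 'k" where
  "tensor K a b = (\<lambda>(x, y). a x \<otimes>\<^bsub>K\<^esub> b y)"

context ring
begin

lemma support_tensor:
  assumes "a \<in> fin_fun R A" "b \<in> fin_fun R B"
  shows "gr_support R (tensor R a b) \<subseteq> gr_support R a \<times> gr_support R b"
proof
  fix p assume p: "p \<in> gr_support R (tensor R a b)"
  obtain x y where [simp]: "p = (x, y)" by fastforce
  have "a x \<in> carrier R" "b y \<in> carrier R" using assms by (auto simp: fin_fun_def)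
  then have "a x \<noteq> \<zero>" "b y \<noteq> \<zero>" using p by (auto simp: gr_support_def tensor_def)
  then show "p \<in> gr_support R a \<times> gr_support R b" by (auto simp: gr_support_def)
qed

lemma fin_fun_tensor:
  assumes "a \<in> fin_fun R A" "b \<in> fin_fun R B"
  shows "tensor R a b \<in> fin_fun R (A \<times> B)"
  using assms support_tensor[OF assms] finite_subset[OF support_tensor[OF assms]]
  by (fastforce simp: fin_fun_def tensor_def)

lemma tensor_add_left:
  assumes "a \<in> fin_fun R A" "a' \<in> fin_fun R A" "b \<in> fin_fun R B"
  shows "tensor R (fun_add R a a') b = fun_add R (tensor R a b) (tensor R a' b)"
  using assms by (auto simp: tensor_def fun_add_def fin_fun_def l_distr)

lemma tensor_add_right:
  assumes "a \<in> fin_fun R A" "b' \<in> fin_fun R B" "b \<in> fin_fun R B"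
  shows "tensor R a (fun_add R b b') = fun_add R (tensor R a b) (tensor R a b')"
  using assms by (auto simp: tensor_def fun_add_def fin_fun_def r_distr)

lemma tensor_zero:
  "b \<in> fin_fun R B \<Longrightarrow> tensor R (\<lambda>_. \<zero>) b = (\<lambda>_. \<zero>)"
  "b \<in> fin_fun R B \<Longrightarrow> tensor R b (\<lambda>_. \<zero>) = (\<lambda>_. \<zero>)"
  by (auto simp: tensor_def fin_fun_def)

lemma tensor_single:
  "k \<in> carrier R \<Longrightarrow> l \<in> carrier R \<Longrightarrow> tensor R (single R x k) (single R y l) = single R (x, y) (k \<otimes> l)"
  by (auto simp: tensor_def single_def)

end

section \<open>The group ring as a ring\<close>

locale group_ring_setup = G?: group G + K?: ring K
  for G :: "('g, 'n) monoid_scheme" (structure) and K :: "('k, 'm) ring_scheme" (structure)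
begin

abbreviation KG where "KG \<equiv> group_ring K G"

lemma carrier_KG: "carrier KG = fin_fun K (carrier G)"
  by (simp add: group_ring_def fin_fun_def)

lemma add_KG: "a \<oplus>\<^bsub>KG\<^esub> b = fun_add K a b"
  by (simp add: group_ring_def fun_add_def)

lemma zero_KG: "\<zero>\<^bsub>KG\<^esub> = (\<lambda>_. \<zero>\<^bsub>K\<^esub>)"
  by (simp add: group_ring_def)

lemma one_KG: "\<one>\<^bsub>KG\<^esub> = single K \<one>\<^bsub>G\<^esub> \<one>\<^bsub>K\<^esub>"
  by (simp add: group_ring_def single_def)

text \<open>A product of nonzero coefficients may vanish in a general ring, so \<open>tensor\<close>
  can have a smaller support than the product of the supports; the extra terms of the convolution
  sum are zero.\<close>

lemma mult_KG:
  assumes "a \<in> fin_fun K A" "b \<in> fin_fun K B"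
  shows "a \<otimes>\<^bsub>KG\<^esub> b = pushforward K (\<lambda>(x, y). x \<otimes>\<^bsub>G\<^esub> y) (tensor K a b)"
proof
  fix z
  have fin: "finite (gr_support K a \<times> gr_support K b)" using assms by (auto simp: fin_fun_def)
  have "(a \<otimes>\<^bsub>KG\<^esub> b) z = finsum K (tensor K a b)
      {p \<in> gr_support K a \<times> gr_support K b. (\<lambda>(x, y). x \<otimes>\<^bsub>G\<^esub> y) p = z}"
    by (simp add: group_ring_def tensor_def) (rule arg_cong[where f = "finsum K _"], auto)
  also have "\<dots> = pushforward K (\<lambda>(x, y). x \<otimes>\<^bsub>G\<^esub> y) (tensor K a b) z"
    using fin_fun_UNIV[OF fin_fun_tensor[OF assms]] fin support_tensor[OF assms]
    by (intro pushforward_eq[symmetric])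
  finally show "(a \<otimes>\<^bsub>KG\<^esub> b) z = pushforward K (\<lambda>(x, y). x \<otimes>\<^bsub>G\<^esub> y) (tensor K a b) z" .
qed

lemma mult_KG_closed: "a \<in> carrier KG \<Longrightarrow> b \<in> carrier KG \<Longrightarrow> a \<otimes>\<^bsub>KG\<^esub> b \<in> carrier KG"
  unfolding carrier_KG
  by (simp add: mult_KG) (rule fin_fun_pushforward[OF fin_fun_tensor], auto)

lemma mult_KG_add_left:
  "a \<in> carrier KG \<Longrightarrow> a' \<in> carrier KG \<Longrightarrow> b \<in> carrier KG \<Longrightarrow>
    fun_add K a a' \<otimes>\<^bsub>KG\<^esub> b = fun_add K (a \<otimes>\<^bsub>KG\<^esub> b) (a' \<otimes>\<^bsub>KG\<^esub> b)"
  unfolding carrier_KG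
  by (simp add: mult_KG[OF fin_fun_add] mult_KG tensor_add_left pushforward_add
      fin_fun_UNIV[OF fin_fun_tensor])

lemma mult_KG_add_right:
  "a \<in> carrier KG \<Longrightarrow> b' \<in> carrier KG \<Longrightarrow> b \<in> carrier KG \<Longrightarrow>
    a \<otimes>\<^bsub>KG\<^esub> fun_add K b b' = fun_add K (a \<otimes>\<^bsub>KG\<^esub> b) (a \<otimes>\<^bsub>KG\<^esub> b')"
  unfolding carrier_KG
  by (simp add: mult_KG[OF _ fin_fun_add] mult_KG tensor_add_right pushforward_add
      fin_fun_UNIV[OF fin_fun_tensor])

lemma mult_KG_single:
  "k \<in> carrier K \<Longrightarrow> l \<in> carrier K \<Longrightarrow>
    single K x k \<otimes>\<^bsub>KG\<^esub> single K y l = single K (x \<otimes>\<^bsub>G\<^esub> y) (k \<otimes>\<^bsub>K\<^esub> l)"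
  by (subst mult_KG[where A = UNIV and B = UNIV])
    (auto simp: fin_fun_single tensor_single pushforward_single)

lemma mult_KG_zero:
  "b \<in> carrier KG \<Longrightarrow> (\<lambda>_. \<zero>\<^bsub>K\<^esub>) \<otimes>\<^bsub>KG\<^esub> b = (\<lambda>_. \<zero>\<^bsub>K\<^esub>)"
  "b \<in> carrier KG \<Longrightarrow> b \<otimes>\<^bsub>KG\<^esub> (\<lambda>_. \<zero>\<^bsub>K\<^esub>) = (\<lambda>_. \<zero>\<^bsub>K\<^esub>)"
  using fin_fun_zero[of "carrier G"]
  by (simp_all add: mult_KG[where A = "carrier G" and B = "carrier G"] carrier_KG tensor_zero
      pushforward_zero)

lemma single_KG: "x \<in> carrier G \<Longrightarrow> k \<in> carrier K \<Longrightarrow> single K x k \<in> carrier KG"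
  by (simp add: carrier_KG fin_fun_single)

lemma add_KG_closed: "a \<in> carrier KG \<Longrightarrow> b \<in> carrier KG \<Longrightarrow> fun_add K a b \<in> carrier KG"
  by (simp add: carrier_KG fin_fun_add)

lemma KG_induct [consumes 1, case_names zero add]:
  assumes "a \<in> carrier KG" and "P (\<lambda>_. \<zero>\<^bsub>K\<^esub>)"
    and "\<And>x k a. \<lbrakk>x \<in> carrier G; k \<in> carrier K; a \<in> carrier KG; P a\<rbrakk> \<Longrightarrow> P (fun_add K (single K x k) a)"
  shows "P a"
  using assms unfolding carrier_KG by (rule fin_fun_induct)

lemmas KG_simps = mult_KG_closed mult_KG_add_left mult_KG_add_right mult_KG_single mult_KG_zero
  single_KG add_KG_closed

text \<open>Both sides are additive in each factor, so the claim reduces to functions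
  \<open>single\<close>, where it is associativity in \<open>G\<close> and in \<open>K\<close>. The
  three inductions free first \<open>c\<close>, then \<open>b\<close>, then
  \<open>a\<close>.\<close>

lemma mult_KG_assoc:
  assumes "a \<in> carrier KG" "b \<in> carrier KG" "c \<in> carrier KG"
  shows "(a \<otimes>\<^bsub>KG\<^esub> b) \<otimes>\<^bsub>KG\<^esub> c = a \<otimes>\<^bsub>KG\<^esub> (b \<otimes>\<^bsub>KG\<^esub> c)"
proof -
  have 1: "(single K x k \<otimes>\<^bsub>KG\<^esub> single K y l) \<otimes>\<^bsub>KG\<^esub> c = single K x k \<otimes>\<^bsub>KG\<^esub> (single K y l \<otimes>\<^bsub>KG\<^esub> c)"
    if "x \<in> carrier G" "k \<in> carrier K" "y \<in> carrier G" "l \<in> carrier K" for x k y l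
    using assms(3)
  proof (induction rule: KG_induct)
    case zero
    then show ?case using that by (simp add: KG_simps)
  next
    case (add z m c)
    have "(single K x k \<otimes>\<^bsub>KG\<^esub> single K y l) \<otimes>\<^bsub>KG\<^esub> single K z m =
        single K x k \<otimes>\<^bsub>KG\<^esub> (single K y l \<otimes>\<^bsub>KG\<^esub> single K z m)"
      using that add by (simp add: mult_KG_single G.m_assoc K.m_assoc)
    then show ?case
      using that add by (simp add: mult_KG_add_left mult_KG_add_right single_KG mult_KG_closed)
  qed
  have 2: "(single K x k \<otimes>\<^bsub>KG\<^esub> b) \<otimes>\<^bsub>KG\<^esub> c = single K x k \<otimes>\<^bsub>KG\<^esub> (b \<otimes>\<^bsub>KG\<^esub> c)"
    if "x \<in> carrier G" "k \<in> carrier K" for x k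
    using assms(2)
  proof (induction rule: KG_induct)
    case zero
    then show ?case using that assms by (simp add: KG_simps)
  next
    case (add z m b)
    then show ?case using that assms 1[of x k z m]
      by (simp add: mult_KG_add_left mult_KG_add_right single_KG mult_KG_closed)
  qed
  show ?thesis
    using assms(1)
  proof (induction rule: KG_induct)
    case zero
    then show ?case using assms by (simp add: KG_simps)
  next
    case (add z m a)
    then show ?case using assms 2[of z m]
      by (simp add: mult_KG_add_left mult_KG_add_right single_KG mult_KG_closed)
  qed
qed

lemma mult_KG_single_right:
  assumes "a \<in> carrier KG" "y \<in> carrier G"
  shows "a \<otimes>\<^bsub>KG\<^esub> single K y \<one>\<^bsub>K\<^esub> = pushforward K (\<lambda>x. x \<otimes>\<^bsub>G\<^esub> y) a"
  using assms(1)
proof (induction rule: KG_induct)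
  case zero
  then show ?case using assms by (simp add: KG_simps pushforward_zero)
next
  case (add z m a)
  then show ?case using assms
    by (simp add: KG_simps pushforward_add pushforward_single carrier_KG fin_fun_UNIV
        fin_fun_single)
qed

lemma mult_KG_single_left:
  assumes "a \<in> carrier KG" "y \<in> carrier G"
  shows "single K y \<one>\<^bsub>K\<^esub> \<otimes>\<^bsub>KG\<^esub> a = pushforward K (\<lambda>x. y \<otimes>\<^bsub>G\<^esub> x) a"
  using assms(1)
proof (induction rule: KG_induct)
  case zero
  then show ?case using assms by (simp add: KG_simps pushforward_zero)
next
  case (add z m a)
  then show ?case using assms
    by (simp add: KG_simps pushforward_add pushforward_single carrier_KG fin_fun_UNIV
        fin_fun_single)
qed

lemma mult_KG_single_one:
  assumes "a \<in> carrier KG" "k \<in> carrier K"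
  shows "a \<otimes>\<^bsub>KG\<^esub> single K \<one>\<^bsub>G\<^esub> k = (\<lambda>x. a x \<otimes>\<^bsub>K\<^esub> k)"
  using assms(1)
proof (induction rule: KG_induct)
  case zero
  then show ?case using assms by (simp add: KG_simps)
next
  case (add z m a)
  then have "a x \<in> carrier K" for x by (simp add: carrier_KG fin_fun_def)
  moreover have "fun_add K (single K z m) a \<otimes>\<^bsub>KG\<^esub> single K \<one>\<^bsub>G\<^esub> k =
      fun_add K (single K z (m \<otimes>\<^bsub>K\<^esub> k)) (\<lambda>x. a x \<otimes>\<^bsub>K\<^esub> k)"
    using add assms by (simp add: mult_KG_add_left single_KG mult_KG_single)
  ultimately show ?case
    using add assms by (auto simp: fun_add_def single_def K.l_distr)
qed

lemma ring_KG: "ring KG"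
proof (rule ringI)
  show "abelian_group KG"
  proof (rule abelian_groupI)
    fix a assume a: "a \<in> carrier KG"
    have s: "gr_support K (\<lambda>x. \<ominus>\<^bsub>K\<^esub> a x) = gr_support K a"
      using a by (auto simp: gr_support_def carrier_KG fin_fun_def)
    show "\<exists>b\<in>carrier KG. b \<oplus>\<^bsub>KG\<^esub> a = \<zero>\<^bsub>KG\<^esub>"
      using a s by (intro bexI[of _ "\<lambda>x. \<ominus>\<^bsub>K\<^esub> a x"])
        (auto simp: add_KG zero_KG carrier_KG fin_fun_def fun_add_def K.l_neg)
  qed (auto simp: add_KG zero_KG carrier_KG fin_fun_add fin_fun_zero fun_add_zero
      intro: fun_add_assoc fun_add_comm)
  show "monoid KG"
  proof (rule monoidI)
    show "\<one>\<^bsub>KG\<^esub> \<in> carrier KG" by (simp add: one_KG single_KG)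
    show "\<one>\<^bsub>KG\<^esub> \<otimes>\<^bsub>KG\<^esub> a = a" if a: "a \<in> carrier KG" for a
    proof -
      have "\<one>\<^bsub>KG\<^esub> \<otimes>\<^bsub>KG\<^esub> a = pushforward K (\<lambda>x. x) a"
        using a by (auto simp: one_KG mult_KG_single_left carrier_KG fin_fun_def intro!: pushforward_cong)
      then show ?thesis using a pushforward_id by (simp add: carrier_KG)
    qed
    show "a \<otimes>\<^bsub>KG\<^esub> \<one>\<^bsub>KG\<^esub> = a" if a: "a \<in> carrier KG" for a
    proof -
      have "a \<otimes>\<^bsub>KG\<^esub> \<one>\<^bsub>KG\<^esub> = pushforward K (\<lambda>x. x) a"
        using a by (auto simp: one_KG mult_KG_single_right carrier_KG fin_fun_def intro!: pushforward_cong)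
      then show ?thesis using a pushforward_id by (simp add: carrier_KG)
    qed
  qed (auto simp: mult_KG_closed mult_KG_assoc)
qed (auto simp: add_KG mult_KG_add_left mult_KG_add_right)

end

section \<open>Supports of threefold sums\<close>

text \<open>Vertices \<open>v\<close> are joined to their three neighbours \<open>n 0 v\<close>, \<open>n 1 v\<close>, \<open>n 2 v\<close>. Read \<open>Q v w i\<close> as: some
  walk without backtracking leads from \<open>v\<close> to \<open>w\<close> and enters \<open>w\<close> through colour \<open>i\<close>. Without closed
  walks, a finite set of vertices has a member that shares at most one of its neighbours.\<close>

lemma leaf_exists:
  fixes n :: "nat \<Rightarrow> 'v \<Rightarrow> 'u" and Q :: "'v \<Rightarrow> 'v \<Rightarrow> nat \<Rightarrow> bool"
  assumes fin: "finite V" and ne: "V \<noteq> {}"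
    and base: "\<And>v w k i. \<lbrakk>v \<in> V; w \<in> V; v \<noteq> w; k < 3; i < 3; n k v = n i w\<rbrakk> \<Longrightarrow> Q v w i"
    and step: "\<And>v w w' i k i'. \<lbrakk>v \<in> V; w \<in> V; w' \<in> V; Q v w i; w \<noteq> w'; k < 3; i < 3; i' < 3; k \<noteq> i;
      n k w = n i' w'\<rbrakk> \<Longrightarrow> Q v w' i'"
    and irrefl: "\<And>v i. v \<in> V \<Longrightarrow> i < 3 \<Longrightarrow> \<not> Q v v i"
  shows "\<exists>v\<in>V. \<exists>j<3. \<forall>k<3. k \<noteq> j \<longrightarrow> (\<forall>w\<in>V - {v}. \<forall>i<3. n k v \<noteq> n i w)"
proof (rule ccontr)
  assume "\<not> ?thesis"
  \<comment> \<open>A state is a vertex with the colour through which it was entered. Without a leaf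
    every state has a successor: leave through another colour \<open>k\<close> and enter a different
    vertex that shares this neighbour.\<close>
  then have "\<forall>s\<in>V \<times> {..<3}. \<exists>s'. s' \<in> V \<times> {..<3} \<and> fst s' \<noteq> fst s \<and>
      (\<exists>k<3. k \<noteq> snd s \<and> n k (fst s) = n (snd s') (fst s'))"
    by fastforce
  then obtain nx where nx: "\<And>s. s \<in> V \<times> {..<3} \<Longrightarrow> nx s \<in> V \<times> {..<3} \<and> fst (nx s) \<noteq> fst s \<and>
      (\<exists>k<3. k \<noteq> snd s \<and> n k (fst s) = n (snd (nx s)) (fst (nx s)))"
    by metis
  obtain v0 where v0: "v0 \<in> V" using ne by blast
  \<comment> \<open>The initial colour \<open>0\<close> is arbitrary, since \<open>base\<close>
    applies to every colour of the first step.\<close>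
  define s where "s m = (nx ^^ m) (v0, 0)" for m
  have s: "s m \<in> V \<times> {..<3}" for m
    by (induction m) (use v0 nx in \<open>auto simp: s_def\<close>)
  have sS: "s (Suc m) = nx (s m)" for m by (simp add: s_def)
  have Q: "Q (fst (s p)) (fst (s q)) (snd (s q))" if "p < q" for p q
    using that
  proof (induction q)
    case 0
    then show ?case by simp
  next
    case (Suc q)
    obtain k where k: "k < 3" "k \<noteq> snd (s q)" "n k (fst (s q)) = n (snd (s (Suc q))) (fst (s (Suc q)))"
      and neq: "fst (s (Suc q)) \<noteq> fst (s q)"
      using nx[OF s[of q]] by (auto simp: sS)
    have m: "fst (s p) \<in> V" "fst (s q) \<in> V" "fst (s (Suc q)) \<in> V" "snd (s q) < 3" "snd (s (Suc q)) < 3"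
      using s[of p] s[of q] s[of "Suc q"] by auto
    show ?case
    proof (cases "p = q")
      case True
      then show ?thesis using base[of "fst (s q)" "fst (s (Suc q))" k] k neq m by auto
    next
      case False
      then have "Q (fst (s p)) (fst (s q)) (snd (s q))" using Suc by simp
      then show ?thesis using step[of "fst (s p)" "fst (s q)" "fst (s (Suc q))" _ k] k neq m by auto
    qed
  qed
  \<comment> \<open>The infinite walk in the finite set \<open>V\<close> returns to a vertex, which
    \<open>irrefl\<close> forbids.\<close>
  have "\<not> inj (\<lambda>m. fst (s m))"
  proof
    assume "inj (\<lambda>m. fst (s m))"
    then have "infinite (range (\<lambda>m. fst (s m)))" by (rule range_inj_infinite)
    moreover have "range (\<lambda>m. fst (s m)) \<subseteq> V" using s by (auto simp: mem_Times_iff)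
    ultimately show False using fin finite_subset by blast
  qed
  then obtain p q where "p < q" "fst (s p) = fst (s q)"
    by (metis injI linorder_neqE_nat)
  then show False using Q[of p q] irrefl[of "fst (s q)" "snd (s q)"] s[of q] by (auto simp: mem_Times_iff)
qed

text \<open>The sum over three indices in \<open>e\<^sub>L\<close>: every vertex is replaced by its
  three neighbours. It is applied twice, once for the conjugations and once for the factors
  \<open>t\<close>.\<close>

definition spread :: "('k, 'm) ring_scheme \<Rightarrow> (nat \<Rightarrow> 'v \<Rightarrow> 'u) \<Rightarrow> ('v \<Rightarrow> 'k) \<Rightarrow> 'u \<Rightarrow> 'k" where
  "spread K n f =
     fun_add K (pushforward K (n 0) f) (fun_add K (pushforward K (n 1) f) (pushforward K (n 2) f))"

lemma less_3_iff: "(k::nat) < 3 \<longleftrightarrow> k = 0 \<or> k = 1 \<or> k = 2" by auto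

section \<open>Growth of the support under a threefold sum\<close>

context ring
begin

lemma fin_fun_spread:
  assumes "f \<in> fin_fun R A" "\<And>k. k < 3 \<Longrightarrow> n k ` A \<subseteq> B"
  shows "spread R n f \<in> fin_fun R B"
proof -
  have "n 0 ` A \<subseteq> B" "n 1 ` A \<subseteq> B" "n 2 ` A \<subseteq> B" using assms(2) by simp_all
  then show ?thesis unfolding spread_def by (intro fin_fun_add fin_fun_pushforward[OF assms(1)])
qed

lemma spread_add:
  fixes n :: "nat \<Rightarrow> 'v \<Rightarrow> 'u"
  assumes "f \<in> fin_fun R UNIV" "g \<in> fin_fun R UNIV"
  shows "spread R n (fun_add R f g) = fun_add R (spread R n f) (spread R n g)"
proof -
  have c: "pushforward R m f x \<in> carrier R" "pushforward R m g x \<in> carrier R" for m :: "'v \<Rightarrow> 'u" and x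
    using assms by (blast intro: fin_funD(1) fin_fun_pushforward[where B = UNIV])+
  show ?thesis
    unfolding spread_def pushforward_add[OF assms] by (simp add: fun_add_def c a_ac)
qed

lemma support_spread: "gr_support R (spread R n f) \<subseteq> (\<Union>k<3. n k ` gr_support R f)"
proof -
  have "gr_support R (spread R n f) \<subseteq> gr_support R (pushforward R (n 0) f) \<union>
      (gr_support R (pushforward R (n 1) f) \<union> gr_support R (pushforward R (n 2) f))"
    unfolding spread_def by (intro order_trans[OF support_add] Un_mono subset_refl support_add)
  also have "\<dots> \<subseteq> n 0 ` gr_support R f \<union> (n 1 ` gr_support R f \<union> n 2 ` gr_support R f)"
    by (intro Un_mono support_pushforward)
  also have "\<dots> \<subseteq> (\<Union>k<3. n k ` gr_support R f)" by (force simp: less_3_iff)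
  finally show ?thesis .
qed

lemma spread_single:
  assumes "c \<in> carrier R" "n 0 v \<noteq> n 1 v" "n 0 v \<noteq> n 2 v" "n 1 v \<noteq> n 2 v"
  shows "spread R n (single R v c) u = (if u \<in> (\<lambda>k. n k v) ` {..<3} then c else \<zero>)"
  unfolding spread_def pushforward_single[OF assms(1)]
  using assms by (auto simp: fun_add_def single_def less_3_iff image_iff)

text \<open>Removing a leaf from the support removes two private neighbours and restores at most one.\<close>

lemma card_support_spread:
  fixes n :: "nat \<Rightarrow> 'v \<Rightarrow> 'u"
  assumes f: "f \<in> fin_fun R A" "gr_support R f \<noteq> {}"
    and dist: "\<And>v i j. v \<in> A \<Longrightarrow> i < 3 \<Longrightarrow> j < 3 \<Longrightarrow> i \<noteq> j \<Longrightarrow> n i v \<noteq> n j v"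
    and leaf: "\<And>V. finite V \<Longrightarrow> V \<noteq> {} \<Longrightarrow> V \<subseteq> A \<Longrightarrow>
      \<exists>v\<in>V. \<exists>j<3. \<forall>k<3. k \<noteq> j \<longrightarrow> (\<forall>w\<in>V - {v}. \<forall>i<3. n k v \<noteq> n i w)"
  shows "card (gr_support R f) < card (gr_support R (spread R n f))"
  using f
proof (induction "card (gr_support R f)" arbitrary: f rule: less_induct)
  case less
  let ?V = "gr_support R f"
  have V: "finite ?V" "?V \<subseteq> A" using less.prems by (auto simp: fin_fun_def)
  \<comment> \<open>Here \<open>priv\<close> says that the neighbours of the leaf \<open>v\<close>
    other than \<open>n j v\<close> belong to no other vertex of the support.\<close>
  obtain v j where v: "v \<in> ?V" "j < 3" and
    priv: "\<And>k w i. k < 3 \<Longrightarrow> k \<noteq> j \<Longrightarrow> w \<in> ?V \<Longrightarrow> w \<noteq> v \<Longrightarrow> i < 3 \<Longrightarrow> n k v \<noteq> n i w"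
    using leaf[OF V(1) less.prems(2) V(2)] by blast
  define f' where "f' = f(v := \<zero>)"
  define g where "g = spread R n f'"
  define c where "c = f v"
  note f' = fin_fun_remove[OF less.prems(1) v(1), folded f'_def c_def]
  have c: "c \<in> carrier R" "c \<noteq> \<zero>" using less.prems v by (auto simp: fin_fun_def c_def gr_support_def)
  have vA: "v \<in> A" using V v by blast
  have d: "n 0 v \<noteq> n 1 v" "n 0 v \<noteq> n 2 v" "n 1 v \<noteq> n 2 v" using dist[OF vA] by auto
  have g: "g \<in> fin_fun R UNIV" unfolding g_def using f'(1) by (rule fin_fun_spread) auto
  have D: "spread R n f = fun_add R (spread R n (single R v c)) g"
    unfolding g_def by (subst f'(3), rule spread_add) (use f'(1) c in \<open>auto intro: fin_fun_single fin_fun_UNIV\<close>)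
  have Du: "spread R n f u = (if u \<in> (\<lambda>k. n k v) ` {..<3} then c else \<zero>) \<oplus> g u" for u
    unfolding D using spread_single[of c n v, OF c(1) d] by (simp add: fun_add_def)
  have gc: "g u \<in> carrier R" for u using g by (simp add: fin_fun_def)
  have nk: "n k v \<notin> gr_support R g" if "k < 3" "k \<noteq> j" for k
  proof
    assume "n k v \<in> gr_support R g"
    then obtain i w where "i < 3" "w \<in> gr_support R f'" "n k v = n i w"
      using support_spread[of n f'] by (auto simp: g_def)
    then show False using priv[OF that, of w i] f'(2) by auto
  qed
  obtain k l where kl: "k < 3" "l < 3" "k \<noteq> j" "l \<noteq> j" "k \<noteq> l"
  proof -
    consider "j = 0" | "j = 1" | "j = 2" using v by (auto simp: less_3_iff)
    then show thesis by cases (rule that[of 1 2] that[of 0 2] that[of 0 1]; simp)+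
  qed
  let ?B = "gr_support R g - {n j v}"
  have finD: "finite (gr_support R (spread R n f))"
    using fin_fun_spread[OF less.prems(1), of n UNIV] by (auto simp: fin_fun_def)
  \<comment> \<open>At the two private neighbours the coefficient is \<open>c\<close>; off the
    neighbours of \<open>v\<close> the function agrees with \<open>g\<close>. Only at
    \<open>n j v\<close> can there be a cancellation.\<close>
  have "insert (n k v) (insert (n l v) ?B) \<subseteq> gr_support R (spread R n f)"
  proof -
    have "n m v \<in> gr_support R (spread R n f)" if "m < 3" "m \<noteq> j" for m
    proof -
      have "g (n m v) = \<zero>" using nk[OF that] by (auto simp: gr_support_def)
      then show ?thesis using c that unfolding gr_support_def by (simp add: Du)
    qed
    moreover have "u \<in> gr_support R (spread R n f)" if "u \<in> ?B" for u
    proof -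
      have "u \<notin> (\<lambda>k. n k v) ` {..<3}" using that nk by auto
      then show ?thesis using that gc unfolding gr_support_def by (simp add: Du)
    qed
    ultimately show ?thesis using kl by blast
  qed
  then have "card (insert (n k v) (insert (n l v) ?B)) \<le> card (gr_support R (spread R n f))"
    by (rule card_mono[OF finD])
  moreover have "card (insert (n k v) (insert (n l v) ?B)) = Suc (Suc (card ?B))"
    using nk kl dist[OF vA, of k l] fin_funD(3)[OF g] by simp
  moreover have "card (gr_support R g) - 1 \<le> card ?B"
    by (metis card_Diff_singleton_if diff_le_self le_refl)
  moreover have "card ?V = Suc (card (gr_support R f'))"
    using v V(1) f'(2) by (metis card.remove)
  moreover have "card (gr_support R f') < card (gr_support R g)" if "gr_support R f' \<noteq> {}"
    unfolding g_def using less.hyps[OF _ f'(1) that] \<open>card ?V = _\<close> by simp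
  \<comment> \<open>Against the single point \<open>v\<close>, two points are gained and at most one
    is lost, so the strict inequality passes from \<open>f'\<close> to \<open>f\<close>. If
    \<open>f'\<close> vanishes, the two private neighbours alone exceed the one point of the
    support.\<close>
  ultimately show ?case by (cases "gr_support R f' = {}") auto
qed

end

section \<open>Reduced words\<close>

definition words :: "'g set \<Rightarrow> ('g \<times> bool) list set" where
  "words S = {w. fst ` set w \<subseteq> S \<and> reduced_word w}"

text \<open>\<open>T\<close> is a basis of the subgroup it generates, expressed by the absence of
  nontrivial relations; in this form it excludes closed walks.\<close>

definition free_family :: "('g, 'm) monoid_scheme \<Rightarrow> 'g set \<Rightarrow> bool" where
  "free_family G T \<longleftrightarrow> T \<subseteq> carrier G \<and> (\<forall>w\<in>words T. w \<noteq> [] \<longrightarrow> word_value G w \<noteq> \<one>\<^bsub>G\<^esub>)"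

lemma words_Nil [simp]: "[] \<in> words S"
  by (simp add: words_def reduced_word_def)

lemma words_append_iff:
  "u @ v \<in> words S \<longleftrightarrow> u \<in> words S \<and> v \<in> words S \<and>
    (u = [] \<or> v = [] \<or> \<not> (fst (last u) = fst (hd v) \<and> snd (last u) \<noteq> snd (hd v)))"
  by (auto simp: words_def reduced_word_def successively_append_iff)

lemma words_Cons_iff:
  "l # v \<in> words S \<longleftrightarrow> fst l \<in> S \<and> v \<in> words S \<and>
    (v = [] \<or> \<not> (fst l = fst (hd v) \<and> snd l \<noteq> snd (hd v)))"
  by (cases v) (auto simp: words_def reduced_word_def)

lemma words_mono: "w \<in> words S \<Longrightarrow> fst ` set w \<subseteq> T \<Longrightarrow> w \<in> words T"
  by (simp add: words_def)

lemma words_letters: "w \<in> words S \<Longrightarrow> l \<in> set w \<Longrightarrow> fst l \<in> S"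
  by (auto simp: words_def)

definition pow_word :: "'g \<Rightarrow> int \<Rightarrow> ('g \<times> bool) list" where
  "pow_word a d = replicate (nat \<bar>d\<bar>) (a, 0 < d)"

lemma pow_word_words: "a \<in> S \<Longrightarrow> pow_word a d \<in> words S"
proof -
  assume "a \<in> S"
  then have "replicate n (a, s) \<in> words S" for n s
    by (induction n) (auto simp: words_Cons_iff)
  then show ?thesis by (simp add: pow_word_def)
qed

lemma pow_word_Nil_iff: "pow_word a d = [] \<longleftrightarrow> d = 0"
  by (simp add: pow_word_def)

lemma fst_pow_word: "l \<in> set (pow_word a d) \<Longrightarrow> fst l = a"
  by (auto simp: pow_word_def)

lemma fst_hd_pow_word: "d \<noteq> 0 \<Longrightarrow> fst (hd (pow_word a d)) = a"
  "d \<noteq> 0 \<Longrightarrow> fst (last (pow_word a d)) = a"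
  by (simp_all add: pow_word_def)

section \<open>Evaluating words in a group\<close>

context group
begin

lemma word_value_Nil [simp]: "word_value G [] = \<one>"
  by (simp add: word_value_def)

lemma word_value_Cons [simp]: "word_value G (l # w) = letter_value G l \<otimes> word_value G w"
  by (simp add: word_value_def)

lemma letter_value_closed: "fst l \<in> carrier G \<Longrightarrow> letter_value G l \<in> carrier G"
  by (simp add: letter_value_def)

lemma word_value_closed: "fst ` set w \<subseteq> carrier G \<Longrightarrow> word_value G w \<in> carrier G"
  by (induction w) (auto simp: letter_value_closed)

lemma word_value_append:
  "fst ` set u \<subseteq> carrier G \<Longrightarrow> fst ` set v \<subseteq> carrier G \<Longrightarrow>
    word_value G (u @ v) = word_value G u \<otimes> word_value G v"
  by (induction u) (auto simp: letter_value_closed word_value_closed m_assoc)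

lemma word_value_subgroup:
  assumes "subgroup H G" "fst ` set w \<subseteq> H"
  shows "word_value G w \<in> H"
  using assms(2) by (induction w)
    (auto simp: letter_value_def subgroup.one_closed[OF assms(1)] subgroup.m_closed[OF assms(1)]
      subgroup.m_inv_closed[OF assms(1)])

lemma word_value_pow_word:
  assumes a: "a \<in> carrier G"
  shows "word_value G (pow_word a d) = a [^] d"
proof -
  have t: "word_value G (replicate n (a, True)) = a [^] n" for n
  proof (induction n)
    case (Suc n)
    then have "word_value G (replicate (Suc n) (a, True)) = a \<otimes> a [^] n"
      by (simp add: letter_value_def)
    also have "\<dots> = a [^] Suc n" by (rule nat_pow_Suc2[OF a, symmetric])
    finally show ?case .
  qed simp
  have f: "word_value G (replicate n (a, False)) = inv (a [^] n)" for n
  proof (induction n)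
    case (Suc n)
    have "word_value G (replicate (Suc n) (a, False)) = inv a \<otimes> inv (a [^] n)"
      using Suc by (simp add: letter_value_def)
    also have "\<dots> = inv (a [^] n \<otimes> a)" using a by (simp add: inv_mult_group)
    finally show ?case by simp
  qed simp
  show ?thesis
    by (cases d rule: int_cases3) (use t f a in \<open>auto simp: pow_word_def int_pow_int int_pow_neg_int\<close>)
qed

lemma word_value_one_letter:
  assumes a: "a \<in> carrier G" and "\<forall>l\<in>set w. fst l = a"
  shows "\<exists>d::int. word_value G w = a [^] d"
  using assms(2)
proof (induction w)
  case Nil
  then show ?case by (auto intro: exI[of _ 0])
next
  case (Cons l w)
  then obtain d :: int where d: "word_value G w = a [^] d" by auto
  have l: "letter_value G l = a [^] (if snd l then 1 else - 1 :: int)"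
    using Cons.prems a by (auto simp: letter_value_def int_pow_neg)
  show ?case
    by (rule exI[of _ "(if snd l then 1 else - 1) + d"]) (use a in \<open>simp add: l d int_pow_mult\<close>)
qed

end

text \<open>\<open>C\<close> stands for the underlying set of a free subgroup with basis
  \<open>S\<close>. Words are evaluated in the ambient group, so that all members of a chain share
  one operation.\<close>

locale free_basis_of = group G for G (structure) +
  fixes S C
  assumes S_sub: "S \<subseteq> carrier G"
    and bij: "bij_betw (word_value G) (words S) C"
begin

lemma word_value_inj: "u \<in> words S \<Longrightarrow> v \<in> words S \<Longrightarrow> word_value G u = word_value G v \<Longrightarrow> u = v"
  using bij by (auto simp: bij_betw_def inj_on_def)

lemma word_value_C: "w \<in> words S \<Longrightarrow> word_value G w \<in> C"
  using bij by (auto simp: bij_betw_def)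

lemma letters_carrier: "w \<in> words S \<Longrightarrow> fst ` set w \<subseteq> carrier G"
  using S_sub by (auto simp: words_def)

lemma C_carrier: "C \<subseteq> carrier G"
  using bij letters_carrier word_value_closed by (auto simp: bij_betw_def)

lemma word_value_ne_one: "w \<in> words S \<Longrightarrow> w \<noteq> [] \<Longrightarrow> word_value G w \<noteq> \<one>"
  using word_value_inj[of w "[]"] by auto

text \<open>The normal form of an element of \<open>C\<close>, that is, its reduced word over
  \<open>S\<close>.\<close>

definition nf :: "'a \<Rightarrow> ('a \<times> bool) list" where
  "nf = inv_into (words S) (word_value G)"

lemma nf: "g \<in> C \<Longrightarrow> nf g \<in> words S" "g \<in> C \<Longrightarrow> word_value G (nf g) = g"
  using bij unfolding nf_def bij_betw_def by (auto intro: inv_into_into f_inv_into_f)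

lemma nf_word_value: "w \<in> words S \<Longrightarrow> nf (word_value G w) = w"
  by (intro word_value_inj nf word_value_C)

lemma nf_Nil_iff: "g \<in> C \<Longrightarrow> nf g = [] \<longleftrightarrow> g = \<one>"
  using nf[of g] nf_word_value[of "[]"] by auto

lemma S_C: "x \<in> S \<Longrightarrow> x \<in> C" "x \<in> S \<Longrightarrow> nf x = [(x, True)]"
proof -
  assume x: "x \<in> S"
  have w: "[(x, True)] \<in> words S" using x by (simp add: words_Cons_iff)
  have v: "word_value G [(x, True)] = x" using x S_sub by (auto simp: letter_value_def)
  show "x \<in> C" "nf x = [(x, True)]" using word_value_C[OF w] nf_word_value[OF w] unfolding v by auto
qed

text \<open>Conjugating by a high power of \<open>a\<close> makes the reduced word of a nontrivial element begin and
  end with a power of \<open>a\<close>; elements with this property do not interact with the powers of another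
  letter \<open>b\<close>.\<close>

definition ends_with :: "'a \<Rightarrow> 'a set" where
  "ends_with a = word_value G ` {w \<in> words S. w \<noteq> [] \<and> fst (hd w) = a \<and> fst (last w) = a}"

lemma ends_with_carrier: "ends_with a \<subseteq> carrier G"
  using letters_carrier word_value_closed by (auto simp: ends_with_def)

text \<open>The concatenation of the three words is already reduced, because the letters
  \<open>a\<close> and \<open>b\<close> meet at both junctions.\<close>

lemma ends_with_mult:
  assumes "a \<noteq> b" "b \<in> S" "m \<in> ends_with a" "m' \<in> ends_with a" "d \<noteq> (0 :: int)"
  shows "m \<otimes> b [^] d \<otimes> m' \<in> ends_with a"
proof -
  obtain w w' where w: "w \<in> words S" "w \<noteq> []" "fst (hd w) = a" "fst (last w) = a" "m = word_value G w"
    "w' \<in> words S" "w' \<noteq> []" "fst (hd w') = a" "fst (last w') = a" "m' = word_value G w'"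
    using assms by (auto simp: ends_with_def)
  have p: "pow_word b d \<in> words S" "pow_word b d \<noteq> []"
    using assms by (simp_all add: pow_word_words pow_word_Nil_iff)
  have r: "w @ pow_word b d @ w' \<in> words S"
    using w p assms fst_hd_pow_word[of d b] by (auto simp: words_append_iff)
  have "word_value G (w @ pow_word b d @ w') = m \<otimes> (b [^] d \<otimes> m')"
    using w p assms S_sub letters_carrier[of w] letters_carrier[OF p(1)] letters_carrier[of w']
    by (subst word_value_append) (auto simp: word_value_append word_value_pow_word subset_iff)
  also have "\<dots> = m \<otimes> b [^] d \<otimes> m'"
    using assms ends_with_carrier S_sub by (intro m_assoc[symmetric]) auto
  finally show ?thesis using r w unfolding ends_with_def
    by (intro image_eqI[of _ _ "w @ pow_word b d @ w'"]) auto
qed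

text \<open>By uniqueness of reduced words, the word of a power of \<open>b\<close> contains no
  \<open>a\<close>; for \<open>d = 0\<close> it is empty.\<close>

lemma pow_notin_ends_with:
  assumes "a \<noteq> b" "b \<in> S"
  shows "b [^] (d :: int) \<notin> ends_with a"
proof
  assume "b [^] d \<in> ends_with a"
  then obtain w where w: "w \<in> words S" "w \<noteq> []" "fst (hd w) = a" "b [^] d = word_value G w"
    by (auto simp: ends_with_def)
  then have "w = pow_word b d"
    using assms S_sub by (intro word_value_inj) (auto simp: pow_word_words word_value_pow_word)
  then show False using w assms by (metis fst_pow_word hd_in_set)
qed

text \<open>Unless \<open>g\<close> is a power of \<open>a\<close>, its reduced word is
  \<open>a^i m a^j\<close> with \<open>m\<close> beginning and ending in letters other than
  \<open>a\<close>. For large \<open>N\<close> the conjugate has the reduced word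
  \<open>a^(i-N) m a^(j+N)\<close> with two nonzero exponents. Stating this for all large
  \<open>N\<close> lets finitely many \<open>g\<close> be treated at once.\<close>

lemma conj_ends_with:
  assumes a: "a \<in> S" and g: "g \<in> C" "g \<noteq> \<one>"
  shows "\<forall>\<^sub>F N in sequentially. inv (a [^] int N) \<otimes> g \<otimes> a [^] int N \<in> ends_with a"
proof -
  define w where "w = nf g"
  have w: "w \<in> words S" "word_value G w = g" "w \<noteq> []"
    using nf[OF g(1)] nf_Nil_iff[OF g(1)] g(2) by (auto simp: w_def)
  have ac: "a \<in> carrier G" using a S_sub by auto
  show ?thesis
  proof (cases "\<forall>l\<in>set w. fst l = a")
    case True
    then obtain d :: int where d: "g = a [^] d" using word_value_one_letter[OF ac] w(2) by auto
    have "inv (a [^] int N) \<otimes> g \<otimes> a [^] int N = a [^] (- int N + d + int N)" for N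
      unfolding d using ac by (simp only: int_pow_mult int_pow_neg)
    then have "inv (a [^] int N) \<otimes> g \<otimes> a [^] int N = g" for N by (simp add: d)
    moreover have "g \<in> ends_with a" using True w by (auto simp: ends_with_def)
    ultimately show ?thesis by simp
  next
    case False
    then obtain p x zs where p: "w = p @ x # zs" "fst x \<noteq> a" "\<forall>l\<in>set p. fst l = a"
      using split_list_first_prop[of w "\<lambda>l. fst l \<noteq> a"] by auto
    have "\<exists>l\<in>set (x # zs). fst l \<noteq> a" using p by auto
    then obtain ys y q where q: "x # zs = ys @ y # q" "fst y \<noteq> a" "\<forall>l\<in>set q. fst l = a"
      using split_list_last_prop[of "x # zs" "\<lambda>l. fst l \<noteq> a"] by auto
    \<comment> \<open>The segment of \<open>w\<close> from the first to the last letter other than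
      \<open>a\<close>.\<close>
    define m where "m = ys @ [y]"
    have m: "w = p @ m @ q" "m \<noteq> []" "fst (hd m) \<noteq> a" "fst (last m) \<noteq> a"
      using p q by (auto simp: m_def hd_append neq_Nil_conv split: if_splits)
    obtain i j :: int where ij: "word_value G p = a [^] i" "word_value G q = a [^] j"
      using word_value_one_letter[OF ac] p q by metis
    have mw: "m \<in> words S" using w(1) unfolding m(1) by (simp add: words_append_iff)
    have mc: "word_value G m \<in> carrier G" using letters_carrier[OF mw] word_value_closed by simp
    have g_eq: "g = a [^] i \<otimes> word_value G m \<otimes> a [^] j"
      using w(2) letters_carrier[OF w(1)] mc ac unfolding m(1)
      by (subst (asm) word_value_append; simp add: image_Un word_value_append ij m_assoc)
    have "inv (a [^] int N) \<otimes> g \<otimes> a [^] int N \<in> ends_with a" if N: "nat (\<bar>i\<bar> + \<bar>j\<bar>) < N" for N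
    proof -
      let ?v = "pow_word a (i - int N) @ m @ pow_word a (j + int N)"
      have n: "i - int N \<noteq> 0" "j + int N \<noteq> 0" using N by auto
      have pw: "pow_word a (i - int N) \<in> words S" "pow_word a (j + int N) \<in> words S"
        using a by (auto intro: pow_word_words)
      have ne: "pow_word a (i - int N) \<noteq> []" "pow_word a (j + int N) \<noteq> []"
        using n by (auto simp: pow_word_Nil_iff)
      note ends = fst_hd_pow_word[OF n(1), of a] fst_hd_pow_word[OF n(2), of a]
      have v: "?v \<in> words S"
        using pw mw m(2-) ends by (auto simp: words_append_iff)
      have "inv (a [^] int N) \<otimes> g \<otimes> a [^] int N = a [^] (- int N) \<otimes> (a [^] i \<otimes> word_value G m \<otimes> a [^] j) \<otimes> a [^] int N"
        unfolding g_eq using ac by (simp add: int_pow_neg)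
      also have "\<dots> = (a [^] (- int N) \<otimes> a [^] i) \<otimes> word_value G m \<otimes> (a [^] j \<otimes> a [^] int N)"
        using ac mc by (simp add: m_assoc)
      also have "\<dots> = a [^] (i - int N) \<otimes> word_value G m \<otimes> a [^] (j + int N)"
        using ac by (simp flip: int_pow_mult)
      also have "\<dots> = word_value G ?v"
        using letters_carrier[OF pw(1)] letters_carrier[OF pw(2)] letters_carrier[OF mw] ac mc
        by (simp add: word_value_append image_Un word_value_pow_word m_assoc)
      finally show ?thesis
        using v ne ends unfolding ends_with_def
        by (intro image_eqI[of _ _ ?v]) auto
    qed
    then show ?thesis unfolding eventually_sequentially
      by (intro exI[of _ "Suc (nat (\<bar>i\<bar> + \<bar>j\<bar>))"]) auto
  qed
qed

text \<open>Finitely many statements that hold for all large \<open>N\<close> hold for a common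
  \<open>N\<close>; the power \<open>a [^] int N\<close> serves as \<open>u\<close>.\<close>

lemma ping_pong:
  assumes a: "a \<in> S" and M: "finite M" "M \<subseteq> C - {\<one>}"
  obtains u where "u \<in> carrier G" "\<And>g. g \<in> M \<Longrightarrow> inv u \<otimes> g \<otimes> u \<in> ends_with a"
proof -
  have "\<forall>\<^sub>F N in sequentially. \<forall>g\<in>M. inv (a [^] int N) \<otimes> g \<otimes> a [^] int N \<in> ends_with a"
    using M conj_ends_with[OF a] by (intro eventually_ball_finite) auto
  then obtain N where "\<forall>g\<in>M. inv (a [^] int N) \<otimes> g \<otimes> a [^] int N \<in> ends_with a"
    by (auto simp: eventually_sequentially)
  then show thesis using a S_sub by (intro that[of "a [^] int N"]) auto
qed

text \<open>In a product of these conjugates and their inverses, adjacent powers of \<open>a\<close>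
  merge to \<open>a^(m-n)\<close>. The letters \<open>b\<close> survive: powers of \<open>a\<close>
  separate them when \<open>n \<noteq> m\<close>, and they have equal signs in a reduced word when
  \<open>n = m\<close>.\<close>

lemma free_family_conjugates:
  assumes ab: "a \<in> S" "b \<in> S" "a \<noteq> b"
  defines "t \<equiv> \<lambda>n::nat. a [^] int n \<otimes> b \<otimes> a [^] (- int n)"
  shows "inj t" "free_family G (range t)"
proof -
  have abc: "a \<in> carrier G" "b \<in> carrier G" using ab S_sub by auto
  have w: "pow_word a (int n) @ [(b, True)] @ pow_word a (- int n) \<in> words S" for n
    using ab fst_hd_pow_word[of "int n" a] fst_hd_pow_word[of "- int n" a]
    by (cases "n = 0") (auto simp: words_append_iff words_Cons_iff pow_word_words pow_word_Nil_iff)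
  have tw: "t n = word_value G (pow_word a (int n) @ [(b, True)] @ pow_word a (- int n))" for n
    using abc letters_carrier[OF w[of n]]
    by (simp add: t_def word_value_append image_Un word_value_pow_word m_assoc letter_value_def)
  show "inj t"
  proof
    fix n m assume "t n = t m"
    then have "pow_word a (int n) @ [(b, True)] @ pow_word a (- int n) =
        pow_word a (int m) @ [(b, True)] @ pow_word a (- int m)"
      using word_value_inj[OF w w] by (simp add: tw)
    \<comment> \<open>The two words have lengths \<open>2n + 1\<close> and
      \<open>2m + 1\<close>.\<close>
    then have "length (pow_word a (int n) @ [(b, True)] @ pow_word a (- int n)) =
        length (pow_word a (int m) @ [(b, True)] @ pow_word a (- int m))" by (rule arg_cong)
    then show "n = m" by (simp add: pow_word_def)
  qed
  have tc: "t n \<in> carrier G" for n using abc by (simp add: t_def)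
  have lt: "letter_value G (t n, s) = a [^] int n \<otimes> (letter_value G (b, s) \<otimes> a [^] (- int n))" for n s
    using abc by (auto simp: letter_value_def t_def inv_mult_group m_assoc int_pow_neg)
  \<comment> \<open>The leading power of \<open>a\<close> is kept outside the word \<open>v\<close>,
    where the next letter on the left can still merge with it.\<close>
  have key: "\<exists>v\<in>words S. v \<noteq> [] \<and> hd v = (b, s) \<and> word_value G w = a [^] int n \<otimes> word_value G v"
    if "w \<in> words (range t)" "w \<noteq> []" "hd w = (t n, s)" for w n s
    using that
  proof (induction w arbitrary: n s)
    case Nil
    then show ?case by simp
  next
    case (Cons l w)
    have l: "l = (t n, s)" using Cons.prems by simp
    have bc: "letter_value G (b, s) \<in> carrier G" using abc by (simp add: letter_value_closed)
    show ?case
    proof (cases "w = []")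
      case True
      have "(b, s) # pow_word a (- int n) \<in> words S"
        using ab fst_hd_pow_word[of "- int n" a] by (cases "n = 0") (auto simp: words_Cons_iff pow_word_words pow_word_Nil_iff)
      moreover have "word_value G (l # w) = a [^] int n \<otimes> word_value G ((b, s) # pow_word a (- int n))"
        using True abc bc by (simp add: l lt word_value_pow_word)
      ultimately show ?thesis by (intro bexI[of _ "(b, s) # pow_word a (- int n)"]) auto
    next
      case False
      have "fst (hd w) \<in> range t"
        using words_letters[of w "range t" "hd w"] Cons.prems(1) False by (simp add: words_Cons_iff)
      then obtain m s' where h: "hd w = (t m, s')" by (metis imageE prod.collapse)
      then obtain v where v: "v \<in> words S" "v \<noteq> []" "hd v = (b, s')" "word_value G w = a [^] int m \<otimes> word_value G v"
        using Cons.IH[OF _ False h] Cons.prems(1) by (auto simp: words_Cons_iff)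
      let ?p = "pow_word a (int m - int n)"
      have ns: "n = m \<longrightarrow> s = s'" using Cons.prems(1) False h by (auto simp: words_Cons_iff l)
      have r: "(b, s) # ?p @ v \<in> words S"
        using ab v ns fst_hd_pow_word[of "int m - int n" a]
        by (cases "n = m") (auto simp: words_Cons_iff words_append_iff pow_word_words pow_word_Nil_iff hd_append)
      have vc: "word_value G v \<in> carrier G" using letters_carrier[OF v(1)] word_value_closed by blast
      have "word_value G (l # w) = a [^] int n \<otimes> (letter_value G (b, s) \<otimes> ((a [^] (- int n) \<otimes> a [^] int m) \<otimes> word_value G v))"
        using abc bc vc by (simp add: l lt v m_assoc)
      also have "a [^] (- int n) \<otimes> a [^] int m = word_value G ?p"
        using abc by (simp add: word_value_pow_word flip: int_pow_mult)
      also have "letter_value G (b, s) \<otimes> (word_value G ?p \<otimes> word_value G v) = word_value G ((b, s) # ?p @ v)"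
        using letters_carrier[OF v(1)] letters_carrier[OF pow_word_words[OF ab(1)]] by (simp add: word_value_append)
      finally show ?thesis using r by (intro bexI[of _ "(b, s) # ?p @ v"]) auto
    qed
  qed
  show "free_family G (range t)"
    unfolding free_family_def
  proof (intro conjI ballI impI)
    show "range t \<subseteq> carrier G" using tc by auto
    fix w assume w: "w \<in> words (range t)" "w \<noteq> []"
    have "fst (hd w) \<in> range t" using words_letters[of w "range t" "hd w"] w by simp
    then obtain n s where "hd w = (t n, s)" by (metis imageE prod.collapse)
    then obtain v where v: "v \<in> words S" "v \<noteq> []" "hd v = (b, s)" "word_value G w = a [^] int n \<otimes> word_value G v"
      using key[OF w] by blast
    show "word_value G w \<noteq> \<one>"
    proof
      \<comment> \<open>Then \<open>v\<close>, which starts with \<open>b\<close>, would be the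
        reduced word of a power of \<open>a\<close>.\<close>
      assume "word_value G w = \<one>"
      then have "word_value G v = word_value G (pow_word a (- int n))"
        using v abc word_value_closed[OF letters_carrier[OF v(1)]]
        by (simp add: word_value_pow_word int_pow_neg inv_equality inv_comm m_assoc)
          (metis inv_equality inv_comm int_pow_closed inv_unique')
      then have "v = pow_word a (- int n)"
        using word_value_inj[OF v(1) pow_word_words[OF ab(1)]] by simp
      then show False using v ab by (metis fst_conv fst_pow_word hd_in_set)
    qed
  qed
qed

text \<open>Replacing each maximal subword over \<open>T\<close> by its reduced word, which is nonempty and avoids \<open>Z\<close>,
  leaves the letters from \<open>Z\<close> uncancelled.\<close>

lemma free_family_extend:
  assumes T: "free_family G T"
    and D: "\<And>w. fst ` set w \<subseteq> T \<Longrightarrow> word_value G w \<in> D" "D \<subseteq> C"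
    and Y: "\<And>d. d \<in> D \<Longrightarrow> fst ` set (nf d) \<subseteq> Y"
    and Z: "Z \<subseteq> S - Y"
  shows "free_family G (T \<union> Z)"
proof -
  \<comment> \<open>The condition on the first letter controls the junction when more is prepended:
    a letter from \<open>Z\<close> is kept unchanged, a rewritten block begins in \<open>Y\<close>,
    and \<open>Y\<close> and \<open>Z\<close> are disjoint.\<close>
  have "\<exists>w'\<in>words S. word_value G w' = word_value G w \<and>
      (w \<noteq> [] \<longrightarrow> w' \<noteq> [] \<and> (if fst (hd w) \<in> Z then hd w' = hd w else fst (hd w') \<in> Y))"
    if "w \<in> words (T \<union> Z)" for w
    using that
  proof (induction "length w" arbitrary: w rule: less_induct)
    case less
    show ?case
    proof (cases w)
      case Nil
      then show ?thesis by (auto intro!: bexI[of _ "[]"])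
    next
      case (Cons l v)
      have v: "v \<in> words (T \<union> Z)" using less.prems Cons by (simp add: words_Cons_iff)
      show ?thesis
      proof (cases "fst l \<in> Z")
        case True
        obtain v' where v': "v' \<in> words S" "word_value G v' = word_value G v"
          "v \<noteq> [] \<longrightarrow> v' \<noteq> [] \<and> (if fst (hd v) \<in> Z then hd v' = hd v else fst (hd v') \<in> Y)"
          using less.hyps[OF _ v] Cons by auto
        have "v = [] \<Longrightarrow> v' = []" using v' word_value_ne_one[OF v'(1)] by auto
        then have "l # v' \<in> words S"
          using v' less.prems True Z Cons by (cases "v = []") (auto simp: words_Cons_iff split: if_splits)
        then show ?thesis using v' True Cons by (intro bexI[of _ "l # v'"]) auto
      next
        case False
        \<comment> \<open>The maximal initial block without letters from \<open>Z\<close>; the rest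
          \<open>r\<close> is empty or starts with such a letter.\<close>
        define u where "u = takeWhile (\<lambda>l. fst l \<notin> Z) w"
        define r where "r = dropWhile (\<lambda>l. fst l \<notin> Z) w"
        have w: "w = u @ r" "u \<noteq> []" using False Cons by (auto simp: u_def r_def)
        have ur: "u \<in> words (T \<union> Z)" "r \<in> words (T \<union> Z)" using less.prems w by (auto simp: words_append_iff)
        have uT: "u \<in> words T"
          using ur(1) words_letters[OF ur(1)] by (intro words_mono[OF ur(1)]) (auto simp: u_def dest: set_takeWhileD)
        have u1: "word_value G u \<noteq> \<one>" using T uT w by (auto simp: free_family_def)
        have uD: "word_value G u \<in> D" using uT by (intro D(1)) (auto simp: words_def)
        define u' where "u' = nf (word_value G u)"
        have u': "u' \<in> words S" "word_value G u' = word_value G u" "u' \<noteq> []" "fst ` set u' \<subseteq> Y"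
          using nf nf_Nil_iff u1 uD D(2) Y by (auto simp: u'_def)
        obtain r' where r': "r' \<in> words S" "word_value G r' = word_value G r"
          "r \<noteq> [] \<longrightarrow> r' \<noteq> [] \<and> (if fst (hd r) \<in> Z then hd r' = hd r else fst (hd r') \<in> Y)"
          using less.hyps[OF _ ur(2)] w by auto
        have hr: "r \<noteq> [] \<Longrightarrow> fst (hd r) \<in> Z" using hd_dropWhile[of "\<lambda>l. fst l \<notin> Z" w] by (simp add: r_def)
        have rn: "r = [] \<Longrightarrow> r' = []" using r' word_value_ne_one[OF r'(1)] by auto
        have lu: "fst (last u') \<in> Y" using u'(3,4) by auto
        have "u' @ r' \<in> words S"
        proof (cases "r = []")
          case True
          then show ?thesis using u'(1) rn by simp
        next
          case False
          then have "fst (hd r') \<in> Z" using r'(3) hr by simp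
          then have "fst (last u') \<noteq> fst (hd r')" using lu Z by auto
          then show ?thesis using u'(1) r'(1) by (simp add: words_append_iff)
        qed
        moreover have "word_value G (u' @ r') = word_value G w"
        proof -
          have TZ: "T \<union> Z \<subseteq> carrier G" using T Z S_sub by (auto simp: free_family_def)
          have "word_value G w = word_value G u \<otimes> word_value G r"
            unfolding w(1) using ur TZ by (intro word_value_append) (auto simp: words_def)
          also have "\<dots> = word_value G (u' @ r')"
            using letters_carrier[OF u'(1)] letters_carrier[OF r'(1)] u'(2) r'(2)
            by (simp add: word_value_append)
          finally show ?thesis ..
        qed
        moreover have "fst (hd (u' @ r')) \<in> Y" using u'(3,4) by auto
        moreover have "fst (hd w) \<notin> Z" using False Cons by simp
        ultimately show ?thesis using u'(3) by (intro bexI[of _ "u' @ r'"]) auto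
      qed
    qed
  qed
  then have "word_value G w \<noteq> \<one>" if "w \<in> words (T \<union> Z)" "w \<noteq> []" for w
    using that word_value_ne_one by metis
  moreover have "T \<union> Z \<subseteq> carrier G" using T Z S_sub by (auto simp: free_family_def)
  ultimately show ?thesis unfolding free_family_def by blast
qed

end

section \<open>Ascending chains of free groups\<close>

lemma card_of_lists_le:
  assumes "infinite B" "|A| \<le>o |B|"
  shows "|lists A| \<le>o |B|"
proof -
  \<comment> \<open>Lists are counted length by length: each length contributes at most
    \<open>|B|\<close> lists, and so does the countable union.\<close>
  have le: "|{w \<in> lists A. length w = n}| \<le>o |B|" for n
  proof (induction n)
    case 0
    have "{w \<in> lists A. length w = 0} = {[]}" by auto
    then show ?case using assms(1) card_of_singl_ordLeq by (metis finite.emptyI)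
  next
    case (Suc n)
    have "|A \<times> {w \<in> lists A. length w = n}| \<le>o |B|"
      using card_of_Times_ordLeq_infinite_Field[of "|B|" A "{w \<in> lists A. length w = n}"] assms Suc
      by (simp add: Field_card_of card_of_Card_order)
    moreover have "{w \<in> lists A. length w = Suc n} \<subseteq> (\<lambda>(x, w). x # w) ` (A \<times> {w \<in> lists A. length w = n})"
      by (force simp: length_Suc_conv)
    ultimately show ?case by (meson surj_imp_ordLeq ordLeq_transitive)
  qed
  have "lists A = (\<Union>n. {w \<in> lists A. length w = n})" by auto
  moreover have "|\<Union>n. {w \<in> lists A. length w = n}| \<le>o |B|"
    using assms(1) le infinite_iff_card_of_nat by (intro card_of_UNION_ordLeq_infinite) auto
  ultimately show ?thesis by simp
qed

lemma card_of_finite_subsets_le: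
  assumes "infinite B" "|A| \<le>o |B|"
  shows "|{L. finite L \<and> L \<subseteq> A}| \<le>o |B|"
proof -
  have "|set ` lists A| \<le>o |B|"
    using card_of_image card_of_lists_le[OF assms] ordLeq_transitive by blast
  then show ?thesis by (simp add: Collect_finite_subset_eq_lists)
qed

lemma card_of_words_le:
  assumes "infinite B" "|A| \<le>o |B|"
  shows "|words A| \<le>o |B|"
proof -
  have "|A \<times> (UNIV :: bool set)| \<le>o |B|"
    using card_of_Times_ordLeq_infinite_Field[of "|B|" A "UNIV :: bool set"] assms
      ordLess_imp_ordLeq[OF finite_ordLess_infinite2[of "UNIV :: bool set" B]]
    by (simp add: Field_card_of card_of_Card_order)
  then have "|lists (A \<times> (UNIV :: bool set))| \<le>o |B|" using assms(1) card_of_lists_le by blast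
  moreover have "words A \<subseteq> lists (A \<times> UNIV)" by (auto simp: words_def)
  ultimately show ?thesis using card_of_mono1 ordLeq_transitive by blast
qed

text \<open>All members of the chain are subsets \<open>C i\<close> of one group, each with its own
  basis \<open>S i\<close>; no relation between these bases is assumed. The noncommuting elements of
  \<open>C 0\<close> lie in every \<open>C i\<close>.\<close>

locale free_chain = group G for G (structure) +
  fixes S C :: "nat \<Rightarrow> 'a set"
  assumes S_carrier: "S i \<subseteq> carrier G"
    and basis: "bij_betw (word_value G) (words (S i)) (C i)"
    and C_subgroup: "subgroup (C i) G"
    and C_Suc: "C i \<subseteq> C (Suc i)"
    and C_union: "(\<Union>i. C i) = carrier G"
    and noncommuting: "\<exists>x\<in>C 0. \<exists>y\<in>C 0. x \<otimes> y \<noteq> y \<otimes> x"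
begin

lemma free_basis_of: "free_basis_of G (S i) (C i)"
  by unfold_locales (rule S_carrier basis)+

lemma C_mono: "i \<le> j \<Longrightarrow> C i \<subseteq> C j"
  using lift_Suc_mono_le[of C i j] C_Suc by blast

lemma finite_subset_C:
  assumes "finite L" "L \<subseteq> carrier G"
  obtains i where "L \<subseteq> C i"
proof -
  have "\<exists>i. L \<subseteq> C i" using assms
  proof (induction L rule: finite_induct)
    case (insert x L)
    then have "x \<in> (\<Union>i. C i)" by (simp add: C_union)
    then obtain i j where "L \<subseteq> C i" "x \<in> C j" using insert by auto
    then have "insert x L \<subseteq> C (max i j)" using C_mono[of i "max i j"] C_mono[of j "max i j"] by auto
    then show ?case ..
  qed simp
  then show thesis using that by blast
qed

text \<open>With at most one letter, all elements of \<open>C i\<close> would be powers of it and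
  would commute.\<close>

lemma two_letters: "\<exists>a\<in>S i. \<exists>b\<in>S i. a \<noteq> b"
proof (rule ccontr)
  assume n: "\<not> ?thesis"
  interpret free_basis_of G "S i" "C i" by (rule free_basis_of)
  obtain x y where xy: "x \<in> C i" "y \<in> C i" "x \<otimes> y \<noteq> y \<otimes> x"
    using noncommuting C_mono[of 0 i] by auto
  have "x \<noteq> \<one>" using xy C_carrier by auto
  then obtain a where a: "a \<in> S i"
    using nf[OF xy(1)] nf_Nil_iff[OF xy(1)] words_letters[of "nf x" "S i" "hd (nf x)"] by auto
  have "\<exists>d::int. z = a [^] d" if "z \<in> C i" for z
  proof -
    have "\<forall>l\<in>set (nf z). fst l = a" using n a words_letters[OF nf(1)[OF that]] by blast
    then show ?thesis using word_value_one_letter[of a "nf z"] nf(2)[OF that] a S_carrier by auto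
  qed
  then obtain d e :: int where "x = a [^] d" "y = a [^] e" using xy by blast
  then show False using xy(3) a S_carrier by (auto simp: add.commute subset_iff simp flip: int_pow_mult)
qed

section \<open>Letters added along the chain\<close>

definition old_letters :: "nat \<Rightarrow> 'a set" where
  "old_letters i = (\<Union>g\<in>C i. fst ` set (free_basis_of.nf G (S (Suc i)) g))"

text \<open>As the bases need not be nested, a letter counts as new if it occurs in no reduced word
  of an element of the preceding subgroup. At the start the whole basis is new.\<close>

definition fresh :: "nat \<Rightarrow> 'a set" where
  "fresh i = (case i of 0 \<Rightarrow> S 0 | Suc j \<Rightarrow> S (Suc j) - old_letters j)"

lemma fresh_C: "fresh i \<subseteq> C i"
proof -
  interpret free_basis_of G "S i" "C i" by (rule free_basis_of)
  have "fresh i \<subseteq> S i" by (auto simp: fresh_def split: nat.splits)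
  then show ?thesis using S_C(1) by auto
qed

text \<open>The earlier fresh letters lie in \<open>C i\<close>, so the reduced words of their
  products over \<open>S (Suc i)\<close> use only \<open>old_letters i\<close>, from which the next
  fresh letters are disjoint.\<close>

lemma free_family_fresh_atMost: "free_family G (\<Union>j\<le>i. fresh j)"
proof (induction i)
  case 0
  interpret free_basis_of G "S 0" "C 0" by (rule free_basis_of)
  show ?case using S_sub word_value_ne_one by (auto simp: free_family_def fresh_def)
next
  case (Suc i)
  interpret free_basis_of G "S (Suc i)" "C (Suc i)" by (rule free_basis_of)
  have "fresh j \<subseteq> C i" if "j \<le> i" for j using fresh_C[of j] C_mono[OF that] by (rule order_trans)
  then have "(\<Union>j\<le>i. fresh j) \<subseteq> C i" by auto
  then have "word_value G w \<in> C i" if "fst ` set w \<subseteq> (\<Union>j\<le>i. fresh j)" for w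
    using that by (intro word_value_subgroup[OF C_subgroup]) blast
  moreover have "fst ` set (nf d) \<subseteq> old_letters i" if "d \<in> C i" for d
    using that by (auto simp: old_letters_def)
  moreover have "fresh (Suc i) \<subseteq> S (Suc i) - old_letters i" by (simp add: fresh_def)
  ultimately have "free_family G ((\<Union>j\<le>i. fresh j) \<union> fresh (Suc i))"
    by (intro free_family_extend[OF Suc.IH, of "C i" "old_letters i"] C_Suc)
  then show ?case by (simp add: atMost_Suc Un_commute)
qed

text \<open>A word has finitely many letters and so only involves finitely many stages.\<close>

lemma free_family_fresh: "free_family G (\<Union>i. fresh i)"
proof -
  have "\<exists>i. fst ` set w \<subseteq> (\<Union>j\<le>i. fresh j)" if "fst ` set w \<subseteq> (\<Union>i. fresh i)" for w :: "('a \<times> bool) list"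
    using that
  proof (induction w)
    case (Cons l w)
    then obtain i j where "fst ` set w \<subseteq> (\<Union>j\<le>i. fresh j)" "fst l \<in> fresh j" by auto
    then have "fst ` set (l # w) \<subseteq> (\<Union>k\<le>max i j. fresh k)"
      by (auto 0 4 simp: max_def le_trans)
    then show ?case by blast
  qed simp
  then have "\<exists>i. w \<in> words (\<Union>j\<le>i. fresh j)" if "w \<in> words (\<Union>i. fresh i)" for w
    using that by (simp add: words_def)
  then have "word_value G w \<noteq> \<one>" if "w \<in> words (\<Union>i. fresh i)" "w \<noteq> []" for w
    using that free_family_fresh_atMost unfolding free_family_def by meson
  moreover have "(\<Union>i. fresh i) \<subseteq> carrier G" using fresh_C C_union by blast
  ultimately show ?thesis unfolding free_family_def by blast
qed

text \<open>Induction along the chain: \<open>S (Suc i)\<close> consists of fresh letters and old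
  ones, and the old ones form a union of finite sets over \<open>C i\<close>. In turn
  \<open>C (Suc i)\<close> has no more elements than there are words over this basis.\<close>

lemma card_C_le:
  assumes B: "infinite B" "|\<Union>i. fresh i| \<le>o |B|"
  shows "|C i| \<le>o |B|"
proof -
  have basis_le: "|C i| \<le>o |B|" if "|S i| \<le>o |B|" for i
  proof -
    have e: "C i = word_value G ` words (S i)" using basis[of i] by (simp add: bij_betw_def)
    have w: "|words (S i)| \<le>o |B|" using B(1) that by (rule card_of_words_le)
    have "|word_value G ` words (S i)| \<le>o |words (S i)|" by (rule card_of_image)
    then have "|word_value G ` words (S i)| \<le>o |B|" using w by (rule ordLeq_transitive)
    then show ?thesis by (simp only: e)
  qed
  have fresh_le: "|fresh i| \<le>o |B|" for i
    by (rule ordLeq_transitive[OF card_of_mono1 B(2)]) blast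
  show ?thesis
  proof (induction i)
    case 0
    show ?case using fresh_le[of 0] by (intro basis_le) (simp add: fresh_def)
  next
    case (Suc i)
    have "|fst ` set w| \<le>o |B|" for w :: "('a \<times> bool) list"
      by (intro ordLess_imp_ordLeq finite_ordLess_infinite2 B(1)) simp
    then have "|old_letters i| \<le>o |B|"
      unfolding old_letters_def by (intro card_of_UNION_ordLeq_infinite[OF B(1) Suc]) blast
    then have "|old_letters i \<union> fresh (Suc i)| \<le>o |B|"
      using card_of_Un_ordLeq_infinite_Field[of "|B|" "old_letters i" "fresh (Suc i)"] B(1) fresh_le
      by (simp add: Field_card_of card_of_Card_order)
    moreover have "S (Suc i) \<subseteq> old_letters i \<union> fresh (Suc i)" by (auto simp: fresh_def)
    ultimately show ?case
      by (intro basis_le) (rule ordLeq_transitive[OF card_of_mono1])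
  qed
qed

text \<open>If there are infinitely many fresh letters, they are as numerous as the elements of
  \<open>G\<close>. Otherwise \<open>G\<close> is countable, and the conjugates of one letter by the
  powers of another form an infinite free family.\<close>

lemma large_free_family:
  obtains B where "free_family G B" "infinite B" "|carrier G| \<le>o |B|"
proof -
  have C: "|carrier G| \<le>o |B|" if B: "infinite B" "|\<Union>i. fresh i| \<le>o |B|" for B :: "'a set"
  proof -
    have "|UNIV :: nat set| \<le>o |B|" using B(1) infinite_iff_card_of_nat by blast
    moreover have "\<forall>i\<in>UNIV. |C i| \<le>o |B|" using card_C_le[OF B] by simp
    ultimately have "|\<Union>i. C i| \<le>o |B|" by (rule card_of_UNION_ordLeq_infinite[OF B(1)])
    then show ?thesis by (simp only: C_union)
  qed
  show thesis
  proof (cases "finite (\<Union>i. fresh i)")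
    case False
    then show thesis using C free_family_fresh card_of_refl ordIso_imp_ordLeq that by blast
  next
    case True
    interpret free_basis_of G "S 0" "C 0" by (rule free_basis_of)
    obtain a b where ab: "a \<in> S 0" "b \<in> S 0" "a \<noteq> b" using two_letters by blast
    let ?T = "range (\<lambda>n::nat. a [^] int n \<otimes> b \<otimes> a [^] (- int n))"
    have T: "free_family G ?T" "infinite ?T"
      using free_family_conjugates[OF ab] range_inj_infinite by blast+
    have "|\<Union>i. fresh i| \<le>o |?T|"
      by (intro ordLess_imp_ordLeq finite_ordLess_infinite2 True T(2))
    then show thesis using C T that by blast
  qed
qed

text \<open>There are at most \<open>|B|\<close> finite subsets of \<open>G\<close>, so the indexed
  labels inject into a large free family \<open>B\<close>, and subfamilies of free families are
  free.\<close>

lemma free_family_labels: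
  assumes "A \<subseteq> {L. finite L \<and> L \<subseteq> carrier G}"
  obtains t :: "'a set \<Rightarrow> nat \<Rightarrow> 'a" where
    "inj_on (\<lambda>(L, i). t L i) (A \<times> {..<3})" "free_family G ((\<lambda>(L, i). t L i) ` (A \<times> {..<3}))"
proof -
  obtain B where B: "free_family G B" "infinite B" "|carrier G| \<le>o |B|" by (rule large_free_family)
  have "|A| \<le>o |B|"
    using card_of_finite_subsets_le[OF B(2,3)] card_of_mono1[OF assms] ordLeq_transitive by blast
  then have "|A \<times> {..<3::nat}| \<le>o |B|"
    using card_of_Times_ordLeq_infinite_Field[of "|B|" A "{..<3::nat}"] B(2)
      ordLess_imp_ordLeq[OF finite_ordLess_infinite2[of "{..<3::nat}" B]]
    by (simp add: Field_card_of card_of_Card_order)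
  then obtain f where f: "inj_on f (A \<times> {..<3::nat})" "f ` (A \<times> {..<3::nat}) \<subseteq> B"
    using card_of_ordLeq[of "A \<times> {..<3::nat}" B] by blast
  have fB: "w \<in> words B" if "w \<in> words (f ` (A \<times> {..<3}))" for w
    using that order_trans[OF _ f(2), of "fst ` set w"] by (simp add: words_def)
  have "free_family G (f ` (A \<times> {..<3}))"
    using B(1) f(2) fB unfolding free_family_def by (meson order_trans)
  then show thesis using f(1) by (intro that[of "\<lambda>L i. f (L, i)"]) (simp_all add: case_prod_unfold)
qed

text \<open>All data come from one member \<open>C i\<close> containing \<open>L\<close>: for two
  letters \<open>a\<close> and \<open>b\<close> of its basis, \<open>u\<close> is the element from
  \<open>ping_pong\<close> and \<open>E\<close> is \<open>ends_with a\<close>.\<close>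

lemma separating_elements:
  assumes L: "finite L" "L \<subseteq> carrier G - {\<one>}"
  obtains u b E where "u \<in> carrier G" "b \<in> carrier G" "E \<subseteq> carrier G"
    "\<And>g. g \<in> L \<Longrightarrow> inv u \<otimes> g \<otimes> u \<in> E" "\<And>g. g \<in> L \<Longrightarrow> inv u \<otimes> inv g \<otimes> u \<in> E"
    "\<And>g h. g \<in> L \<Longrightarrow> h \<in> L \<Longrightarrow> g \<noteq> h \<Longrightarrow> inv u \<otimes> (inv h \<otimes> g) \<otimes> u \<in> E"
    "\<And>m m' d. m \<in> E \<Longrightarrow> m' \<in> E \<Longrightarrow> d \<noteq> (0::int) \<Longrightarrow> m \<otimes> b [^] d \<otimes> m' \<in> E"
    "\<And>d::int. b [^] d \<notin> E"
proof -
  obtain i where i: "L \<subseteq> C i" using finite_subset_C[of L] L by auto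
  interpret free_basis_of G "S i" "C i" by (rule free_basis_of)
  obtain a b where ab: "a \<in> S i" "b \<in> S i" "a \<noteq> b" using two_letters by blast
  \<comment> \<open>All elements whose conjugates must lie in \<open>E\<close>. They are nontrivial
    because \<open>L\<close> avoids \<open>\<one>\<close> and only quotients of different elements
    are taken.\<close>
  define M where "M = L \<union> (\<lambda>g. inv g) ` L \<union> (\<lambda>(g, h). inv h \<otimes> g) ` {(g, h) \<in> L \<times> L. g \<noteq> h}"
  have "M \<subseteq> L \<union> (\<lambda>g. inv g) ` L \<union> (\<lambda>(g, h). inv h \<otimes> g) ` (L \<times> L)" unfolding M_def by blast
  then have "finite M" by (rule finite_subset) (use L in simp)
  moreover have "M \<subseteq> C i - {\<one>}"
  proof -
    have gL: "g \<in> C i" "g \<in> carrier G" "g \<noteq> \<one>" if "g \<in> L" for g using that i L by auto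
    have 1: "inv g \<in> C i - {\<one>}" if "g \<in> L" for g
      using gL[OF that] subgroup.m_inv_closed[OF C_subgroup, of g i] by simp
    have 2: "inv h \<otimes> g \<in> C i - {\<one>}" if "g \<in> L" "h \<in> L" "g \<noteq> h" for g h
    proof -
      have "inv h \<otimes> g \<noteq> \<one>"
      proof
        assume "inv h \<otimes> g = \<one>"
        then have "inv g = inv h" using gL[OF that(1)] gL[OF that(2)] by (intro inv_equality) auto
        then show False using gL[OF that(1)] gL[OF that(2)] that(3) by (metis inv_inv)
      qed
      moreover have "inv h \<otimes> g \<in> C i"
        using gL[OF that(1)] gL[OF that(2)]
        by (intro subgroup.m_closed[OF C_subgroup] subgroup.m_inv_closed[OF C_subgroup])
      ultimately show ?thesis by simp
    qed
    show ?thesis unfolding M_def using gL 1 2 by auto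
  qed
  ultimately obtain u where u: "u \<in> carrier G" "\<And>g. g \<in> M \<Longrightarrow> inv u \<otimes> g \<otimes> u \<in> ends_with a"
    using ping_pong[OF ab(1), of M] by blast
  have bc: "b \<in> carrier G" using ab S_sub by blast
  show thesis
  proof (rule that[OF u(1) bc ends_with_carrier])
    show "m \<otimes> b [^] d \<otimes> m' \<in> ends_with a"
      if "m \<in> ends_with a" "m' \<in> ends_with a" "d \<noteq> 0" for m m' and d :: int
      using ends_with_mult[OF ab(3,2) that] .
    show "b [^] d \<notin> ends_with a" for d :: int using pow_notin_ends_with[OF ab(3,2)] .
  qed (rule u(2), force simp: M_def)+
qed

end

section \<open>The right ideal\<close>

definition restrict_fun :: "('k, 'm) ring_scheme \<Rightarrow> ('v \<Rightarrow> bool) \<Rightarrow> ('v \<Rightarrow> 'k) \<Rightarrow> 'v \<Rightarrow> 'k" where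
  "restrict_fun K P f = (\<lambda>v. if P v then f v else \<zero>\<^bsub>K\<^esub>)"

section \<open>Scaling, restricting and relabelling threefold sums\<close>

context ring
begin

lemma pushforward_scale:
  assumes "f \<in> fin_fun R A" "k \<in> carrier R"
  shows "pushforward R n (\<lambda>v. f v \<otimes> k) = (\<lambda>u. pushforward R n f u \<otimes> k)"
proof
  fix u
  have f: "f v \<in> carrier R" for v using assms(1) by (simp add: fin_fun_def)
  have fin: "finite (gr_support R f)" using assms(1) by (simp add: fin_fun_def)
  have s: "gr_support R (\<lambda>v. f v \<otimes> k) \<subseteq> gr_support R f" using assms(2) by (auto simp: gr_support_def)
  then have "(\<lambda>v. f v \<otimes> k) \<in> fin_fun R UNIV"
    using f assms(2) finite_subset[OF s fin] by (simp add: fin_fun_def)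
  then have "pushforward R n (\<lambda>v. f v \<otimes> k) u = (\<Oplus>v\<in>{v \<in> gr_support R f. n v = u}. f v \<otimes> k)"
    using fin s by (rule pushforward_eq)
  also have "\<dots> = pushforward R n f u \<otimes> k"
    unfolding pushforward_def using f fin assms(2) by (intro finsum_ldistr[symmetric]) auto
  finally show "pushforward R n (\<lambda>v. f v \<otimes> k) u = pushforward R n f u \<otimes> k" .
qed

lemma fin_fun_scale:
  assumes "f \<in> fin_fun R A" "k \<in> carrier R"
  shows "(\<lambda>v. f v \<otimes> k) \<in> fin_fun R A"
proof -
  have "gr_support R (\<lambda>v. f v \<otimes> k) \<subseteq> gr_support R f" using assms(2) by (auto simp: gr_support_def)
  then show ?thesis using assms finite_subset by (fastforce simp: fin_fun_def)
qed

lemma spread_scale: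
  fixes n :: "nat \<Rightarrow> 'v \<Rightarrow> 'u"
  assumes "f \<in> fin_fun R A" "k \<in> carrier R"
  shows "spread R n (\<lambda>v. f v \<otimes> k) = (\<lambda>u. spread R n f u \<otimes> k)"
proof -
  have "pushforward R m f u \<in> carrier R" for m :: "'v \<Rightarrow> 'u" and u
    using fin_fun_pushforward[OF assms(1), of m UNIV] by (simp add: fin_fun_def)
  then show ?thesis
    using assms(2) by (simp add: spread_def pushforward_scale[OF assms] fun_add_def l_distr)
qed

lemma spread_zero: "spread R n (\<lambda>_. \<zero>) = (\<lambda>_. \<zero>)"
  by (simp add: spread_def pushforward_zero fun_add_def)

lemma pushforward_spread:
  assumes "f \<in> fin_fun R A"
  shows "pushforward R m (spread R n f) = spread R (\<lambda>k v. m (n k v)) f"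
proof -
  have p: "pushforward R (n k) f \<in> fin_fun R UNIV" for k
    by (rule fin_fun_pushforward[OF assms subset_UNIV])
  show ?thesis
    by (simp add: spread_def pushforward_add p fin_fun_add pushforward_comp[OF assms])
qed

lemma spread_pushforward:
  assumes "f \<in> fin_fun R A"
  shows "spread R n (pushforward R m f) = spread R (\<lambda>k v. n k (m v)) f"
  by (simp add: spread_def pushforward_comp[OF assms])

lemma spread_cong:
  assumes "\<And>k v. k < 3 \<Longrightarrow> v \<in> gr_support R f \<Longrightarrow> n k v = m k v"
  shows "spread R n f = spread R m f"
  unfolding spread_def using assms by (simp cong: pushforward_cong)

lemma support_restrict_fun: "gr_support R (restrict_fun R P f) \<subseteq> gr_support R f"
  by (auto simp: gr_support_def restrict_fun_def)

lemma fin_fun_restrict: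
  assumes "f \<in> fin_fun R A"
  shows "restrict_fun R P f \<in> fin_fun R A"
  using assms support_restrict_fun[of P f] finite_subset[OF support_restrict_fun[of P f]]
  by (auto simp: fin_fun_def restrict_fun_def)

lemma restrict_fun_zero: "restrict_fun R P (\<lambda>_. \<zero>) = (\<lambda>_. \<zero>)"
  by (simp add: restrict_fun_def)

lemma restrict_fun_add:
  "restrict_fun R P (fun_add R f g) = fun_add R (restrict_fun R P f) (restrict_fun R P g)"
  by (auto simp: restrict_fun_def fun_add_def)

lemma restrict_fun_scale:
  "k \<in> carrier R \<Longrightarrow> restrict_fun R P (\<lambda>v. f v \<otimes> k) = (\<lambda>v. restrict_fun R P f v \<otimes> k)"
  by (auto simp: restrict_fun_def)

lemma restrict_fun_single:
  "restrict_fun R P (single R v k) = (if P v then single R v k else (\<lambda>_. \<zero>))"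
  by (auto simp: restrict_fun_def single_def)

lemma restrict_fun_pushforward:
  assumes "f \<in> fin_fun R A" "\<And>v. v \<in> A \<Longrightarrow> Q (m v) \<longleftrightarrow> P v"
  shows "restrict_fun R Q (pushforward R m f) = pushforward R m (restrict_fun R P f)"
  using assms(1)
proof (induction rule: fin_fun_induct)
  case zero
  then show ?case by (simp add: pushforward_zero restrict_fun_zero)
next
  case (add v k f)
  have "restrict_fun R Q (pushforward R m (single R v k)) = pushforward R m (restrict_fun R P (single R v k))"
    using add assms(2)[of v] by (simp add: pushforward_single restrict_fun_single pushforward_zero)
  then show ?case
    using add by (simp add: pushforward_add restrict_fun_add fin_fun_UNIV fin_fun_single fin_fun_restrict)
qed

lemma support_pushforward_inj:
  assumes "f \<in> fin_fun R A" "inj_on m A"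
  shows "gr_support R (pushforward R m f) = m ` gr_support R f"
proof -
  have val: "pushforward R m f (m v) = f v" if "v \<in> A" for v
  proof (cases "v \<in> gr_support R f")
    case True
    then have "{w \<in> gr_support R f. m w = m v} = {v}"
      using assms that by (auto simp: fin_fun_def inj_on_def)
    then show ?thesis using assms(1) by (simp add: pushforward_def fin_fun_def)
  next
    case False
    then have e: "{w \<in> gr_support R f. m w = m v} = {}"
      using assms that by (auto simp: fin_fun_def inj_on_def)
    show ?thesis unfolding pushforward_def e using False by (simp add: gr_support_def)
  qed
  show "gr_support R (pushforward R m f) = m ` gr_support R f"
  proof
    show "gr_support R (pushforward R m f) \<subseteq> m ` gr_support R f" by (rule support_pushforward)
    show "m ` gr_support R f \<subseteq> gr_support R (pushforward R m f)"
      using val fin_funD(2)[OF assms(1)] by (auto simp: gr_support_def)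
  qed
qed

end

section \<open>Labels and the neighbours in the two threefold sums\<close>

lemma (in group) mult_inv_cancel:
  assumes "x \<in> carrier G" "y \<in> carrier G"
  shows "x \<otimes> (inv x \<otimes> y) = y" "inv x \<otimes> (x \<otimes> y) = y"
  using assms by (simp_all flip: m_assoc)

text \<open>The elements of \<open>Lab\<close> are the possible supports \<open>L\<close>. The set \<open>E L\<close> models the elements of a free
  group whose reduced words begin and end with a fixed letter \<open>a \<noteq> b L\<close>.\<close>

locale labelled_group = group G for G (structure) +
  fixes Lab :: "'a set set" and t :: "'a set \<Rightarrow> nat \<Rightarrow> 'a" and u b :: "'a set \<Rightarrow> 'a" and E :: "'a set \<Rightarrow> 'a set"
  assumes Lab: "L \<in> Lab \<Longrightarrow> L \<subseteq> carrier G"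
    and t_inj: "inj_on (\<lambda>(L, i). t L i) (Lab \<times> {..<3})"
    and t_free: "free_family G ((\<lambda>(L, i). t L i) ` (Lab \<times> {..<3}))"
    and u_closed: "L \<in> Lab \<Longrightarrow> u L \<in> carrier G"
    and b_closed: "L \<in> Lab \<Longrightarrow> b L \<in> carrier G"
    and E_carrier: "L \<in> Lab \<Longrightarrow> E L \<subseteq> carrier G"
    and E_conj: "L \<in> Lab \<Longrightarrow> g \<in> L \<Longrightarrow> inv (u L) \<otimes> g \<otimes> u L \<in> E L"
    and E_conj_inv: "L \<in> Lab \<Longrightarrow> g \<in> L \<Longrightarrow> inv (u L) \<otimes> inv g \<otimes> u L \<in> E L"
    and E_conj_diff: "L \<in> Lab \<Longrightarrow> g \<in> L \<Longrightarrow> h \<in> L \<Longrightarrow> g \<noteq> h \<Longrightarrow> inv (u L) \<otimes> (inv h \<otimes> g) \<otimes> u L \<in> E L"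
    and E_mult: "L \<in> Lab \<Longrightarrow> m \<in> E L \<Longrightarrow> m' \<in> E L \<Longrightarrow> d \<noteq> (0::int) \<Longrightarrow> m \<otimes> b L [^] d \<otimes> m' \<in> E L"
    and E_pow: "L \<in> Lab \<Longrightarrow> b L [^] (d::int) \<notin> E L"
begin

text \<open>The vertex \<open>(L, g, h)\<close> stands for the multiple by \<open>h\<close> of the generator of \<open>\<rho>\<close> indexed by \<open>L\<close> and \<open>g\<close>.\<close>

definition vertices :: "('a set \<times> 'a \<times> 'a) set" where
  "vertices = {(L, g, h). L \<in> Lab \<and> g \<in> L \<and> h \<in> carrier G}"

text \<open>The element \<open>y\<^sub>L\<^sub>j\<close>. Conjugation by \<open>u L\<close> moves
  the elements of \<open>L\<close> into \<open>E L\<close>, and the powers of \<open>b L\<close>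
  keep the conjugates for different \<open>j\<close> apart.\<close>

definition conjugator :: "'a set \<Rightarrow> nat \<Rightarrow> 'a" where
  "conjugator L j = u L \<otimes> b L [^] int j"

text \<open>The inner sum, over \<open>j\<close>. The label is kept, since the factor applied by
  \<open>nbr2\<close> depends on it.\<close>

definition nbr1 :: "nat \<Rightarrow> 'a set \<times> 'a \<times> 'a \<Rightarrow> 'a set \<times> 'a" where
  "nbr1 j = (\<lambda>(L, g, h). (L, inv (conjugator L j) \<otimes> g \<otimes> conjugator L j \<otimes> h))"

definition nbr2 :: "nat \<Rightarrow> 'a set \<times> 'a \<Rightarrow> 'a" where
  "nbr2 i = (\<lambda>(L, x). t L i \<otimes> x)"

lemma conjugator_closed: "L \<in> Lab \<Longrightarrow> conjugator L j \<in> carrier G"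
  by (simp add: conjugator_def u_closed b_closed)

lemma vertices_nbr1: "nbr1 j ` vertices \<subseteq> Lab \<times> carrier G"
proof -
  have "g \<in> carrier G" if "L \<in> Lab" "g \<in> L" for L g using Lab that by blast
  then show ?thesis using conjugator_closed by (auto simp: nbr1_def vertices_def)
qed

lemma t_closed: "L \<in> Lab \<Longrightarrow> i < 3 \<Longrightarrow> t L i \<in> carrier G"
  using t_free by (force simp: free_family_def)

lemma t_eq_iff: "L \<in> Lab \<Longrightarrow> L' \<in> Lab \<Longrightarrow> i < 3 \<Longrightarrow> j < 3 \<Longrightarrow> t L i = t L' j \<longleftrightarrow> L = L' \<and> i = j"
  using inj_on_eq_iff[OF t_inj, of "(L, i)" "(L', j)"] by auto

section \<open>The graph of the inner sum\<close>

lemma conj_by_conjugator: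
  assumes "L \<in> Lab" "g \<in> carrier G"
  shows "inv (conjugator L j) \<otimes> g \<otimes> conjugator L j =
    b L [^] (- int j) \<otimes> (inv (u L) \<otimes> g \<otimes> u L) \<otimes> b L [^] int j"
  using assms u_closed[of L] b_closed[of L]
  by (simp add: conjugator_def inv_mult_group m_assoc int_pow_neg)

text \<open>Solving for \<open>h'\<close> leaves, between the outer powers of \<open>b L\<close>, a
  power of \<open>b L\<close> with exponent \<open>i - k\<close> enclosed by the conjugates
  \<open>y\<close> of \<open>inv g'\<close> and \<open>x\<close> of \<open>g\<close>. For
  \<open>i \<noteq> k\<close> this is in \<open>E L\<close> by \<open>E_mult\<close>. For
  \<open>i = k\<close> it is the conjugate of \<open>inv g' \<otimes> g\<close>, and
  \<open>g \<noteq> g'\<close> since otherwise the vertices would agree.\<close>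

lemma nbr1_eq:
  assumes L: "L \<in> Lab" and g: "g \<in> L" "g' \<in> L" and h: "h \<in> carrier G" "h' \<in> carrier G"
    and neq: "(g, h) \<noteq> (g', h')"
    and eq: "nbr1 k (L, g, h) = nbr1 i (L, g', h')"
  shows "\<exists>m\<in>E L. h' = b L [^] (- int i) \<otimes> m \<otimes> b L [^] int k \<otimes> h"
proof -
  have c: "g \<in> carrier G" "g' \<in> carrier G" "u L \<in> carrier G" "b L \<in> carrier G"
    using L g Lab u_closed b_closed by auto
  define x where "x = inv (u L) \<otimes> g \<otimes> u L"
  define x' where "x' = inv (u L) \<otimes> g' \<otimes> u L"
  define y where "y = inv (u L) \<otimes> inv g' \<otimes> u L"
  have xc: "x \<in> carrier G" "x' \<in> carrier G" "y \<in> carrier G" using c by (simp_all add: x_def x'_def y_def)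
  have yx': "y \<otimes> x' = \<one>" using c by (simp add: x'_def y_def m_assoc mult_inv_cancel)
  have "b L [^] (- int k) \<otimes> x \<otimes> b L [^] int k \<otimes> h = b L [^] (- int i) \<otimes> x' \<otimes> b L [^] int i \<otimes> h'"
    using eq L c unfolding nbr1_def x_def x'_def by (simp add: conj_by_conjugator)
  then have "b L [^] (- int i) \<otimes> y \<otimes> b L [^] int i \<otimes> (b L [^] (- int k) \<otimes> x \<otimes> b L [^] int k \<otimes> h)
      = b L [^] (- int i) \<otimes> y \<otimes> b L [^] int i \<otimes> (b L [^] (- int i) \<otimes> x' \<otimes> b L [^] int i \<otimes> h')"
    by simp
  also have "\<dots> = b L [^] (- int i) \<otimes> (y \<otimes> ((b L [^] int i \<otimes> b L [^] (- int i)) \<otimes> x')) \<otimes> b L [^] int i \<otimes> h'"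
    using c xc h by (simp add: m_assoc del: int_pow_mult)
  also have "\<dots> = (b L [^] (- int i) \<otimes> b L [^] int i) \<otimes> h'"
    using c xc h yx' by (simp flip: int_pow_mult)
  also have "\<dots> = h'" using c h by (simp flip: int_pow_mult)
  finally have h': "h' = b L [^] (- int i) \<otimes> (y \<otimes> (b L [^] int i \<otimes> b L [^] (- int k)) \<otimes> x) \<otimes> b L [^] int k \<otimes> h"
    using c xc h by (simp add: m_assoc)
  have bb: "b L [^] int i \<otimes> b L [^] (- int k) = b L [^] (int i - int k)"
    using c by (simp flip: int_pow_mult)
  have "y \<otimes> (b L [^] int i \<otimes> b L [^] (- int k)) \<otimes> x \<in> E L"
  proof (cases "i = k")
    case True
    have "g \<noteq> g'"
    proof
      assume "g = g'"
      then have "x = x'" by (simp add: x_def x'_def)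
      then have "y \<otimes> (b L [^] int i \<otimes> b L [^] (- int k)) \<otimes> x = \<one>"
        using True c xc yx' unfolding bb by simp
      then have "h' = b L [^] (- int i) \<otimes> b L [^] int k \<otimes> h" using h' c by simp
      then have "h' = h" using True c h by (simp flip: int_pow_mult)
      then show False using neq \<open>g = g'\<close> by simp
    qed
    moreover have "y \<otimes> x = inv (u L) \<otimes> (inv g' \<otimes> g) \<otimes> u L"
      using c by (simp add: x_def y_def m_assoc mult_inv_cancel)
    ultimately show ?thesis using True E_conj_diff[OF L g] xc unfolding bb by simp
  next
    case False
    then show ?thesis unfolding bb using E_mult[OF L E_conj_inv[OF L g(2)] E_conj[OF L g(1)], of "int i - int k"]
      by (simp add: x_def y_def)
  qed
  then show ?thesis using h' by blast
qed

text \<open>Equal neighbours would make the conjugate \<open>x\<close> of \<open>g\<close> commute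
  with the power of \<open>b L\<close> of exponent \<open>k - i \<noteq> 0\<close>. Conjugating this
  power by \<open>x\<close> gives an element of \<open>E L\<close>, which would then be a power of
  \<open>b L\<close>.\<close>

lemma nbr1_distinct:
  assumes v: "v \<in> vertices" and "i \<noteq> k"
  shows "nbr1 i v \<noteq> nbr1 k v"
proof
  assume eq: "nbr1 i v = nbr1 k v"
  obtain L g h where [simp]: "v = (L, g, h)" and L: "L \<in> Lab" "g \<in> L" "h \<in> carrier G"
    using v by (auto simp: vertices_def)
  have c: "g \<in> carrier G" "u L \<in> carrier G" "b L \<in> carrier G" using L Lab u_closed b_closed by auto
  define x where "x = inv (u L) \<otimes> g \<otimes> u L"
  have xc: "x \<in> carrier G" using c by (simp add: x_def)
  have ix: "inv x = inv (u L) \<otimes> inv g \<otimes> u L" using c by (simp add: x_def inv_mult_group m_assoc)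
  have "b L [^] (- int i) \<otimes> x \<otimes> b L [^] int i = b L [^] (- int k) \<otimes> x \<otimes> b L [^] int k"
    using eq L c by (simp add: nbr1_def conj_by_conjugator x_def)
  then have "b L [^] int k \<otimes> (b L [^] (- int i) \<otimes> x \<otimes> b L [^] int i) \<otimes> b L [^] (- int i) =
      b L [^] int k \<otimes> (b L [^] (- int k) \<otimes> x \<otimes> b L [^] int k) \<otimes> b L [^] (- int i)" by simp
  then have "(b L [^] int k \<otimes> b L [^] (- int i)) \<otimes> x \<otimes> (b L [^] int i \<otimes> b L [^] (- int i)) =
      (b L [^] int k \<otimes> b L [^] (- int k)) \<otimes> x \<otimes> (b L [^] int k \<otimes> b L [^] (- int i))"
    using c xc by (simp add: m_assoc)
  then have "b L [^] (int k - int i) \<otimes> x = x \<otimes> b L [^] (int k - int i)"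
    using c xc by (simp flip: int_pow_mult)
  then have "x \<otimes> b L [^] (int k - int i) \<otimes> inv x = b L [^] (int k - int i)"
    using c xc by (simp add: m_assoc flip: \<open>b L [^] (int k - int i) \<otimes> x = x \<otimes> b L [^] (int k - int i)\<close>)
  moreover have "x \<otimes> b L [^] (int k - int i) \<otimes> inv x \<in> E L"
  proof -
    have "x \<in> E L" "inv x \<in> E L"
      using E_conj[OF L(1,2)] E_conj_inv[OF L(1,2)] unfolding ix by (simp_all add: x_def)
    then show ?thesis using E_mult[OF L(1)] \<open>i \<noteq> k\<close> by simp
  qed
  ultimately show False using E_pow[OF L(1)] by metis
qed

lemma nbr1_leaf:
  assumes V: "finite V" "V \<noteq> {}" "V \<subseteq> vertices"
  shows "\<exists>v\<in>V. \<exists>j<3. \<forall>k<3. k \<noteq> j \<longrightarrow> (\<forall>w\<in>V - {v}. \<forall>i<3. nbr1 k v \<noteq> nbr1 i w)"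
proof -
  \<comment> \<open>A walk multiplies the last component by an element of \<open>E L\<close> between
    powers of \<open>b L\<close>. The left exponent records the colour of entry; the right one is
    fixed by the first step.\<close>
  define Q where "Q = (\<lambda>(L, g :: 'a, h) (L', g' :: 'a, h') i. L' = L \<and>
    (\<exists>m\<in>E L. \<exists>d::int. h' = b L [^] (- int i) \<otimes> m \<otimes> b L [^] d \<otimes> h))"
  show ?thesis
  proof (rule leaf_exists[OF V(1,2), where Q = Q])
    fix v w k i
    assume a: "v \<in> V" "w \<in> V" "v \<noteq> w" "nbr1 k v = nbr1 i w"
    obtain L g h where v: "v = (L, g, h)" "L \<in> Lab" "g \<in> L" "h \<in> carrier G"
      using a V(3) by (auto simp: vertices_def)
    obtain L' g' h' where w: "w = (L', g', h')" "g' \<in> L'" "h' \<in> carrier G"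
      using a V(3) by (auto simp: vertices_def)
    have "L' = L" using a(4) by (simp add: v w nbr1_def)
    then show "Q v w i"
      using nbr1_eq[of L g g' h h' k i] a v w unfolding Q_def by auto
  next
    fix v w w' i k i'
    assume a: "v \<in> V" "w \<in> V" "w' \<in> V" "Q v w i" "w \<noteq> w'" "k \<noteq> i" "nbr1 k w = nbr1 i' w'"
    obtain L g h where v: "v = (L, g, h)" "L \<in> Lab" "g \<in> L" "h \<in> carrier G"
      using a V(3) by (auto simp: vertices_def)
    obtain g' h' where w: "w = (L, g', h')" "g' \<in> L" "h' \<in> carrier G"
      using a V(3) by (auto simp: vertices_def Q_def v)
    obtain g'' h'' where w': "w' = (L, g'', h'')" "g'' \<in> L" "h'' \<in> carrier G"
      using a V(3) by (auto simp: vertices_def nbr1_def w)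
    obtain m d where m: "m \<in> E L" "h' = b L [^] (- int i) \<otimes> m \<otimes> b L [^] (d::int) \<otimes> h"
      using a(4) by (auto simp: Q_def v w)
    obtain m' where m': "m' \<in> E L" "h'' = b L [^] (- int i') \<otimes> m' \<otimes> b L [^] int k \<otimes> h'"
      using nbr1_eq[OF v(2) w(2) w'(2) w(3) w'(3), of k i'] a by (auto simp: w w')
    have c: "m \<in> carrier G" "m' \<in> carrier G" "b L \<in> carrier G" using m m' E_carrier[OF v(2)] b_closed v by auto
    have "h'' = b L [^] (- int i') \<otimes> (m' \<otimes> (b L [^] int k \<otimes> b L [^] (- int i)) \<otimes> m) \<otimes> b L [^] d \<otimes> h"
      unfolding m' m using c v by (simp add: m_assoc)
    also have "b L [^] int k \<otimes> b L [^] (- int i) = b L [^] (int k - int i)"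
      using c by (simp flip: int_pow_mult)
    finally have "h'' = b L [^] (- int i') \<otimes> (m' \<otimes> b L [^] (int k - int i) \<otimes> m) \<otimes> b L [^] d \<otimes> h" .
    \<comment> \<open>Leaving through another colour, \<open>k \<noteq> i\<close>, makes the
      exponent between \<open>m'\<close> and \<open>m\<close> nonzero.\<close>
    moreover have "m' \<otimes> b L [^] (int k - int i) \<otimes> m \<in> E L"
      using E_mult[OF v(2) m'(1) m(1)] a by simp
    ultimately show "Q v w' i'" unfolding Q_def v w' by auto
  next
    fix v i assume a: "v \<in> V"
    obtain L g h where v: "v = (L, g, h)" "L \<in> Lab" "g \<in> L" "h \<in> carrier G"
      using a V(3) by (auto simp: vertices_def)
    show "\<not> Q v v i"
    proof
      assume "Q v v i"
      then obtain m d where m: "m \<in> E L" "h = b L [^] (- int i) \<otimes> m \<otimes> b L [^] (d::int) \<otimes> h"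
        by (auto simp: Q_def v)
      have c: "m \<in> carrier G" "b L \<in> carrier G" using m E_carrier[OF v(2)] b_closed v by auto
      have "b L [^] (- int i) \<otimes> m \<otimes> b L [^] d = \<one>"
        using m(2) c v(4) by (metis int_pow_closed m_closed r_cancel_one)
      then have "b L [^] int i \<otimes> (b L [^] (- int i) \<otimes> m \<otimes> b L [^] d) \<otimes> b L [^] (- d) = b L [^] int i \<otimes> b L [^] (- d)"
        using c by simp
      then have "(b L [^] int i \<otimes> b L [^] (- int i)) \<otimes> m \<otimes> (b L [^] d \<otimes> b L [^] (- d)) = b L [^] int i \<otimes> b L [^] (- d)"
        using c by (simp add: m_assoc)
      \<comment> \<open>A closed walk would turn an element of \<open>E L\<close> into a power of
        \<open>b L\<close>.\<close>
      then have "m = b L [^] (int i - d)" using c by (simp flip: int_pow_mult)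
      then show False using m(1) E_pow[OF v(2)] by simp
    qed
  qed
qed

section \<open>The graph of the outer sum\<close>

lemma nbr2_distinct:
  assumes "v \<in> Lab \<times> carrier G" "i < 3" "k < 3" "i \<noteq> k"
  shows "nbr2 i v \<noteq> nbr2 k v"
  using assms t_eq_iff t_closed by (auto simp: nbr2_def)

text \<open>Walks multiply the group component on the left by nonempty reduced words in the free
  family of the \<open>t L i\<close>, so a closed walk would be a nontrivial relation.\<close>

lemma nbr2_leaf:
  assumes V: "finite V" "V \<noteq> {}" "V \<subseteq> Lab \<times> carrier G"
  shows "\<exists>v\<in>V. \<exists>j<3. \<forall>k<3. k \<noteq> j \<longrightarrow> (\<forall>w\<in>V - {v}. \<forall>i<3. nbr2 k v \<noteq> nbr2 i w)"
proof -
  let ?T = "(\<lambda>(L, i). t L i) ` (Lab \<times> {..<3})"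
  have tT: "t L i \<in> ?T" if "L \<in> Lab" "i < 3" for L i using that by force
  have Tc: "?T \<subseteq> carrier G" using t_free by (simp add: free_family_def)
  have wc: "word_value G w \<in> carrier G" if "w \<in> words ?T" for w
    using that order_trans[OF _ Tc, of "fst ` set w"] by (intro word_value_closed) (simp add: words_def)
  \<comment> \<open>The first letter of the word records the label and colour of entry, which decide
    whether the next step cancels.\<close>
  define Q where "Q = (\<lambda>(L :: 'a set, x) (L', x') i. \<exists>w\<in>words ?T. w \<noteq> [] \<and> hd w = (t L' i, False) \<and>
    x' = word_value G w \<otimes> x)"
  have nb: "x' = word_value G [(t L' i, False), (t L k, True)] \<otimes> x \<and> t L' i \<noteq> t L k"
    if "L \<in> Lab" "L' \<in> Lab" "x \<in> carrier G" "x' \<in> carrier G" "i < 3" "k < 3"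
      "(L, x) \<noteq> (L', x')" "nbr2 k (L, x) = nbr2 i (L', x')" for L L' x x' i k
  proof -
    have e: "t L k \<otimes> x = t L' i \<otimes> x'" using that by (simp add: nbr2_def)
    have tc: "t L k \<in> carrier G" "t L' i \<in> carrier G" using that t_closed by auto
    have "x' = inv (t L' i) \<otimes> (t L k \<otimes> x)" unfolding e using tc that by (simp add: m_assoc[symmetric])
    \<comment> \<open>Equal factors force equal labels by injectivity and then equal group
      components, so the two vertices would coincide.\<close>
    moreover have "t L' i \<noteq> t L k"
    proof
      assume "t L' i = t L k"
      then have "L' = L" "x = x'" using e that tc t_eq_iff by auto
      then show False using that by simp
    qed
    ultimately show ?thesis using tc that by (simp add: letter_value_def m_assoc)
  qed
  show ?thesis
  proof (rule leaf_exists[OF V(1,2), where Q = Q])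
    fix v w k i
    assume a: "v \<in> V" "w \<in> V" "v \<noteq> w" "k < 3" "i < 3" "nbr2 k v = nbr2 i w"
    have "v \<in> Lab \<times> carrier G" "w \<in> Lab \<times> carrier G" using a(1,2) V(3) by blast+
    then obtain L x L' x' where v: "v = (L, x)" "w = (L', x')" "L \<in> Lab" "x \<in> carrier G" "L' \<in> Lab" "x' \<in> carrier G"
      by (elim SigmaE) blast
    have "x' = word_value G [(t L' i, False), (t L k, True)] \<otimes> x" "t L' i \<noteq> t L k"
      using nb[of L L' x x' i k] a v by auto
    then show "Q v w i" unfolding Q_def v using tT v a
      by (auto intro!: bexI[of _ "[(t L' i, False), (t L k, True)]"] simp: words_Cons_iff)
  next
    fix v w w' i k i'
    assume a: "v \<in> V" "w \<in> V" "w' \<in> V" "Q v w i" "w \<noteq> w'" "k < 3" "i < 3" "i' < 3" "k \<noteq> i" "nbr2 k w = nbr2 i' w'"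
    have "v \<in> Lab \<times> carrier G" "w \<in> Lab \<times> carrier G" "w' \<in> Lab \<times> carrier G"
      using a(1-3) V(3) by blast+
    then obtain L x L' x' L'' x'' where v: "v = (L, x)" "w = (L', x')" "w' = (L'', x'')"
      "L \<in> Lab" "x \<in> carrier G" "L' \<in> Lab" "x' \<in> carrier G" "L'' \<in> Lab" "x'' \<in> carrier G"
      by (elim SigmaE) blast
    obtain r where r: "r \<in> words ?T" "r \<noteq> []" "hd r = (t L' i, False)" "x' = word_value G r \<otimes> x"
      using a(4) by (auto simp: Q_def v)
    have x'': "x'' = word_value G [(t L'' i', False), (t L' k, True)] \<otimes> x'" "t L'' i' \<noteq> t L' k"
      using nb[of L' L'' x' x'' i' k] a v by auto
    \<comment> \<open>Leaving through a colour other than that of entry keeps the new letter from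
      cancelling the head of \<open>r\<close>.\<close>
    have ik: "t L' k \<noteq> t L' i" using t_eq_iff[of L' L' k i] v(6) a(6,7,9) by blast
    let ?r = "(t L'' i', False) # (t L' k, True) # r"
    have "?r \<in> words ?T"
      using r(1,3) x''(2) ik tT[OF v(8) a(8)] tT[OF v(6) a(6)] by (simp add: words_Cons_iff del: image_iff)
    moreover have "x'' = word_value G ?r \<otimes> x"
      unfolding x''(1) r(4) using wc[OF r(1)] v a t_closed by (simp add: letter_value_def m_assoc)
    ultimately show "Q v w' i'" unfolding Q_def v by (auto intro!: bexI[of _ ?r])
  next
    fix v i assume a: "v \<in> V"
    have "v \<in> Lab \<times> carrier G" using a V(3) by blast
    then obtain L x where v: "v = (L, x)" "L \<in> Lab" "x \<in> carrier G" by (elim SigmaE) blast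
    show "\<not> Q v v i"
    proof
      assume "Q v v i"
      then obtain w where w: "w \<in> words ?T" "w \<noteq> []" "x = word_value G w \<otimes> x" by (auto simp: Q_def v)
      then have "word_value G w = \<one>" using wc[OF w(1)] v by (metis r_cancel_one')
      then show False using t_free w by (auto simp: free_family_def)
    qed
  qed
qed

end

text \<open>\<open>pick L\<close> is the chosen \<open>g\<^sub>L\<close>. By \<open>Lab_all\<close>
  every possible support is a label, and since \<open>G\<close> is infinite, the support of an
  element can be translated away from \<open>\<one>\<close>.\<close>

locale labelled_group_ring = G?: labelled_group G Lab t u b E + group_ring_setup G K
  for G (structure) and Lab t u b E and K :: "('k, 'm) ring_scheme" (structure) +
  fixes pick :: "'a set \<Rightarrow> 'a"
  assumes field_K: "field K"
    and infinite_G: "infinite (carrier G)"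
    and Lab_all: "finite L \<Longrightarrow> L \<noteq> {} \<Longrightarrow> L \<subseteq> carrier G - {\<one>\<^bsub>G\<^esub>} \<Longrightarrow> L \<in> Lab"
    and pick: "L \<in> Lab \<Longrightarrow> pick L \<in> L"
begin

text \<open>The vertices whose generator contains the summand 1.\<close>

definition marked :: "'a set \<times> 'a \<times> 'a \<Rightarrow> bool" where
  "marked = (\<lambda>(L, g, h). g = pick L)"

definition hpart :: "'a set \<times> 'a \<times> 'a \<Rightarrow> 'a" where
  "hpart = (\<lambda>(L, g, h). h)"

text \<open>The contribution of the \<open>e\<^sub>L(g)\<close>: the coefficient of each vertex is
  spread over the nine products \<open>t\<^sub>L\<^sub>i y\<^sub>L\<^sub>j\<inverse> g
  y\<^sub>L\<^sub>j h\<close>.\<close>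

definition main_part :: "('a set \<times> 'a \<times> 'a \<Rightarrow> 'k) \<Rightarrow> 'a \<Rightarrow> 'k" where
  "main_part f = spread K nbr2 (spread K nbr1 f)"

text \<open>The contribution of the summands 1: a marked generator times \<open>h\<close> gives back
  \<open>h\<close>.\<close>

definition unit_part :: "('a set \<times> 'a \<times> 'a \<Rightarrow> 'k) \<Rightarrow> 'a \<Rightarrow> 'k" where
  "unit_part f = pushforward K hpart (restrict_fun K marked f)"

text \<open>The element of \<rho> with coefficients \<open>f\<close>, a \<open>K\<close>-linear
  combination of right multiples of the generators by group elements.\<close>

definition comb :: "('a set \<times> 'a \<times> 'a \<Rightarrow> 'k) \<Rightarrow> 'a \<Rightarrow> 'k" where
  "comb f = fun_add K (unit_part f) (main_part f)"

section \<open>Linear combinations of multiples of the generators\<close>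

lemma nbr2_carrier: "k < 3 \<Longrightarrow> nbr2 k ` (Lab \<times> carrier G) \<subseteq> carrier G"
  using t_closed by (auto simp: nbr2_def)

lemma hpart_vertices: "hpart ` vertices \<subseteq> carrier G"
  by (auto simp: hpart_def vertices_def)

lemma spread_nbr1: "f \<in> fin_fun K vertices \<Longrightarrow> spread K nbr1 f \<in> fin_fun K (Lab \<times> carrier G)"
  by (rule fin_fun_spread[OF _ vertices_nbr1])

lemma main_part_closed: "f \<in> fin_fun K vertices \<Longrightarrow> main_part f \<in> carrier KG"
  unfolding main_part_def carrier_KG by (rule fin_fun_spread[OF spread_nbr1]) (auto intro: nbr2_carrier[THEN subsetD])

lemma unit_part_closed: "f \<in> fin_fun K vertices \<Longrightarrow> unit_part f \<in> carrier KG"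
  unfolding unit_part_def carrier_KG
  by (rule fin_fun_pushforward[OF fin_fun_restrict hpart_vertices])

lemma comb_closed: "f \<in> fin_fun K vertices \<Longrightarrow> comb f \<in> carrier KG"
  unfolding comb_def by (intro add_KG_closed unit_part_closed main_part_closed)

lemma comb_zero: "comb (\<lambda>_. \<zero>\<^bsub>K\<^esub>) = (\<lambda>_. \<zero>\<^bsub>K\<^esub>)"
  by (simp add: comb_def main_part_def unit_part_def spread_zero restrict_fun_zero
      pushforward_zero fun_add_def)

lemma comb_add:
  assumes f: "f \<in> fin_fun K vertices" and g: "g \<in> fin_fun K vertices"
  shows "comb (fun_add K f g) = fun_add K (comb f) (comb g)"
proof -
  have "main_part (fun_add K f g) = fun_add K (main_part f) (main_part g)"
    unfolding main_part_def
    by (simp only: spread_add[OF fin_fun_UNIV[OF f] fin_fun_UNIV[OF g]]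
        spread_add[OF fin_fun_UNIV[OF spread_nbr1[OF f]] fin_fun_UNIV[OF spread_nbr1[OF g]]])
  moreover have "unit_part (fun_add K f g) = fun_add K (unit_part f) (unit_part g)"
    unfolding unit_part_def restrict_fun_add using f g
    by (intro pushforward_add) (auto intro: fin_fun_UNIV fin_fun_restrict)
  ultimately show ?thesis
    unfolding comb_def using fun_add_swap[of "unit_part f" "carrier G" "unit_part g" "main_part f" "main_part g"]
      main_part_closed unit_part_closed f g by (simp add: carrier_KG)
qed

lemma comb_scale:
  assumes f: "f \<in> fin_fun K vertices" and k: "k \<in> carrier K"
  shows "comb (\<lambda>v. f v \<otimes>\<^bsub>K\<^esub> k) = (\<lambda>x. comb f x \<otimes>\<^bsub>K\<^esub> k)"
proof -
  have "main_part (\<lambda>v. f v \<otimes>\<^bsub>K\<^esub> k) = (\<lambda>x. main_part f x \<otimes>\<^bsub>K\<^esub> k)"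
    unfolding main_part_def spread_scale[OF f k] by (rule spread_scale[OF spread_nbr1[OF f] k])
  moreover have "unit_part (\<lambda>v. f v \<otimes>\<^bsub>K\<^esub> k) = (\<lambda>x. unit_part f x \<otimes>\<^bsub>K\<^esub> k)"
    unfolding unit_part_def restrict_fun_scale[OF k] by (rule pushforward_scale[OF fin_fun_restrict[OF f] k])
  moreover have "unit_part f x \<in> carrier K" "main_part f x \<in> carrier K" for x
    using unit_part_closed[OF f] main_part_closed[OF f] by (simp_all add: carrier_KG fin_fun_def)
  ultimately show ?thesis using k by (simp add: comb_def fun_add_def K.l_distr)
qed

text \<open>The neighbour maps multiply on the left and hence commute with right translation of the
  last component. This makes the image of \<open>comb\<close> stable under right multiplication by
  group elements.\<close>

lemma comb_translate:
  assumes f: "f \<in> fin_fun K vertices" and z: "z \<in> carrier G"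
  defines "m \<equiv> \<lambda>(L, g, h). (L, g, h \<otimes>\<^bsub>G\<^esub> z)"
  shows "comb (pushforward K m f) = pushforward K (\<lambda>x. x \<otimes>\<^bsub>G\<^esub> z) (comb f)"
proof -
  have supp: "gr_support K f \<subseteq> vertices" using f by (simp add: fin_fun_def)
  have n1: "nbr1 k v \<in> Lab \<times> carrier G" if "v \<in> vertices" for k v using vertices_nbr1 that by blast
  have 1: "nbr2 i (nbr1 j (m v)) = nbr2 i (nbr1 j v) \<otimes>\<^bsub>G\<^esub> z" if "v \<in> vertices" "i < 3" for i j v
  proof -
    note v_i = that
    obtain L g h where v: "v = (L, g, h)" "L \<in> Lab" "g \<in> L" "h \<in> carrier G"
      using v_i(1) by (cases v) (auto simp: vertices_def)
    moreover have "g \<in> carrier G" using v Lab by blast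
    ultimately show ?thesis
      using z conjugator_closed[OF v(2)] t_closed[OF v(2) v_i(2)] by (simp add: m_def nbr1_def nbr2_def G.m_assoc)
  qed
  have "main_part (pushforward K m f) = spread K nbr2 (spread K (\<lambda>k v. nbr1 k (m v)) f)"
    unfolding main_part_def by (simp add: spread_pushforward[OF f])
  also have "\<dots> = pushforward K (\<lambda>x. x \<otimes>\<^bsub>G\<^esub> z) (main_part f)"
  proof -
    have s1: "spread K (\<lambda>k v. nbr1 k (m v)) f \<in> fin_fun K UNIV" by (rule fin_fun_spread[OF f]) simp
    have s2: "spread K nbr1 f \<in> fin_fun K UNIV" by (rule fin_fun_spread[OF f]) simp
    have q: "pushforward K (nbr2 i) (spread K (\<lambda>k v. nbr1 k (m v)) f) =
        pushforward K (\<lambda>x. x \<otimes>\<^bsub>G\<^esub> z) (pushforward K (nbr2 i) (spread K nbr1 f))" if "i < 3" for i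
      unfolding pushforward_spread[OF f]
      by (rule spread_cong) (use 1 that supp in blast)
    have p: "pushforward K (nbr2 i) (spread K nbr1 f) \<in> fin_fun K UNIV" for i
      by (rule fin_fun_pushforward[OF s2 subset_UNIV])
    show ?thesis
      unfolding main_part_def spread_def[of K nbr2]
      by (simp add: q pushforward_add p fin_fun_add)
  qed
  finally have 2: "main_part (pushforward K m f) = pushforward K (\<lambda>x. x \<otimes>\<^bsub>G\<^esub> z) (main_part f)" .
  have r: "restrict_fun K marked f \<in> fin_fun K vertices" by (rule fin_fun_restrict[OF f])
  have "restrict_fun K marked (pushforward K m f) = pushforward K m (restrict_fun K marked f)"
    by (rule restrict_fun_pushforward[OF f]) (auto simp: marked_def m_def)
  then have "unit_part (pushforward K m f) = pushforward K (\<lambda>v. hpart (m v)) (restrict_fun K marked f)"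
    unfolding unit_part_def by (simp add: pushforward_comp[OF r])
  also have "\<dots> = pushforward K (\<lambda>v. hpart v \<otimes>\<^bsub>G\<^esub> z) (restrict_fun K marked f)"
    by (simp add: hpart_def m_def case_prod_unfold)
  also have "\<dots> = pushforward K (\<lambda>x. x \<otimes>\<^bsub>G\<^esub> z) (unit_part f)"
    unfolding unit_part_def by (simp add: pushforward_comp[OF r])
  finally show ?thesis
    unfolding comb_def 2 using unit_part_closed[OF f] main_part_closed[OF f]
    by (subst pushforward_add) (auto simp: carrier_KG intro: fin_fun_UNIV)
qed

definition rho :: "('a \<Rightarrow> 'k) set" where
  "rho = comb ` fin_fun K vertices"

interpretation KG: ring KG by (rule ring_KG)

text \<open>Right multiplication by \<open>single K z k\<close> is translation by \<open>z\<close>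
  followed by scaling with \<open>k\<close>, and every ring element is a sum of such
  functions.\<close>

lemma rho_right_ideal: "right_ideal rho KG"
  unfolding KG.right_ideal_iff
proof (intro conjI ballI)
  show "rho \<subseteq> carrier KG" using comb_closed by (auto simp: rho_def)
  show "\<zero>\<^bsub>KG\<^esub> \<in> rho"
    using fin_fun_zero[of vertices] comb_zero unfolding rho_def zero_KG by (metis image_eqI)
  show add: "x \<oplus>\<^bsub>KG\<^esub> y \<in> rho" if "x \<in> rho" "y \<in> rho" for x y
  proof -
    obtain f g where fg: "f \<in> fin_fun K vertices" "g \<in> fin_fun K vertices" "x = comb f" "y = comb g"
      using \<open>x \<in> rho\<close> \<open>y \<in> rho\<close> by (auto simp: rho_def)
    have "x \<oplus>\<^bsub>KG\<^esub> y = comb (fun_add K f g)" unfolding add_KG fg(3,4) comb_add[OF fg(1,2)] ..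
    then show ?thesis unfolding rho_def using fin_fun_add[OF fg(1,2)] by (rule image_eqI)
  qed
  have single: "x \<otimes>\<^bsub>KG\<^esub> single K z k \<in> rho" if "x \<in> rho" "z \<in> carrier G" "k \<in> carrier K" for x z k
  proof -
    obtain f where f: "f \<in> fin_fun K vertices" "x = comb f" using \<open>x \<in> rho\<close> by (auto simp: rho_def)
    have x: "x \<in> carrier KG" using comb_closed f by simp
    define m where "m = (\<lambda>(L :: 'a set, g :: 'a, h). (L, g, h \<otimes>\<^bsub>G\<^esub> z))"
    have mv: "m ` vertices \<subseteq> vertices" using that(2) by (auto simp: m_def vertices_def)
    have f': "pushforward K m f \<in> fin_fun K vertices" by (rule fin_fun_pushforward[OF f(1) mv])
    have "single K z k = single K z \<one>\<^bsub>K\<^esub> \<otimes>\<^bsub>KG\<^esub> single K \<one>\<^bsub>G\<^esub> k"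
      using that by (simp add: mult_KG_single)
    then have "x \<otimes>\<^bsub>KG\<^esub> single K z k = (x \<otimes>\<^bsub>KG\<^esub> single K z \<one>\<^bsub>K\<^esub>) \<otimes>\<^bsub>KG\<^esub> single K \<one>\<^bsub>G\<^esub> k"
      using that x by (simp add: mult_KG_assoc single_KG)
    also have "x \<otimes>\<^bsub>KG\<^esub> single K z \<one>\<^bsub>K\<^esub> = pushforward K (\<lambda>x. x \<otimes>\<^bsub>G\<^esub> z) (comb f)"
      unfolding f(2)[symmetric] by (rule mult_KG_single_right[OF x that(2)])
    also have "\<dots> = comb (pushforward K m f)"
      unfolding m_def by (rule comb_translate[OF f(1) that(2), symmetric])
    also have "\<dots> \<otimes>\<^bsub>KG\<^esub> single K \<one>\<^bsub>G\<^esub> k = comb (\<lambda>v. pushforward K m f v \<otimes>\<^bsub>K\<^esub> k)"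
      unfolding mult_KG_single_one[OF comb_closed[OF f'] that(3)] by (rule comb_scale[OF f' that(3), symmetric])
    finally show ?thesis using fin_fun_scale[OF f' that(3)] by (auto simp: rho_def)
  qed
  show "x \<otimes>\<^bsub>KG\<^esub> r \<in> rho" if x: "x \<in> rho" and r: "r \<in> carrier KG" for x r
    using r
  proof (induction rule: KG_induct)
    case zero
    have "x \<in> carrier KG" using x \<open>rho \<subseteq> carrier KG\<close> by blast
    then show ?case using \<open>\<zero>\<^bsub>KG\<^esub> \<in> rho\<close> by (simp add: mult_KG_zero zero_KG)
  next
    case (add z k a)
    have "x \<in> carrier KG" using x \<open>rho \<subseteq> carrier KG\<close> by blast
    then have "x \<otimes>\<^bsub>KG\<^esub> fun_add K (single K z k) a = (x \<otimes>\<^bsub>KG\<^esub> single K z k) \<oplus>\<^bsub>KG\<^esub> (x \<otimes>\<^bsub>KG\<^esub> a)"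
      using add by (simp add: mult_KG_add_right single_KG add_KG)
    then show ?case using \<open>\<And>x y. x \<in> rho \<Longrightarrow> y \<in> rho \<Longrightarrow> x \<oplus>\<^bsub>KG\<^esub> y \<in> rho\<close> single[OF x] add by simp
  qed
qed

section \<open>Properness and comaximality of the right ideal\<close>

lemma one_neq_zero: "\<one>\<^bsub>K\<^esub> \<noteq> \<zero>\<^bsub>K\<^esub>"
proof -
  interpret field K by (rule field_K)
  show ?thesis by simp
qed

text \<open>Both threefold sums strictly enlarge the support, so \<open>main_part f\<close> has at
  least two points more than \<open>f\<close>. If \<open>comb f\<close> were the unit, each of these
  points would be \<open>\<one>\<close> or the last component of a vertex in the support of
  \<open>f\<close>, which allows at most one more.\<close>

lemma one_notin_rho: "\<one>\<^bsub>KG\<^esub> \<notin> rho"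
proof
  assume "\<one>\<^bsub>KG\<^esub> \<in> rho"
  then obtain f where f: "f \<in> fin_fun K vertices" "\<one>\<^bsub>KG\<^esub> = comb f" by (auto simp: rho_def)
  have "gr_support K f \<noteq> {}"
  proof
    assume "gr_support K f = {}"
    then have "f = (\<lambda>_. \<zero>\<^bsub>K\<^esub>)" by (auto simp: gr_support_def)
    then have "single K \<one>\<^bsub>G\<^esub> \<one>\<^bsub>K\<^esub> = (\<lambda>_. \<zero>\<^bsub>K\<^esub>)" using f(2) comb_zero by (simp add: one_KG)
    then have "single K \<one>\<^bsub>G\<^esub> \<one>\<^bsub>K\<^esub> \<one>\<^bsub>G\<^esub> = \<zero>\<^bsub>K\<^esub>" by simp
    then show False using one_neq_zero by (simp add: single_def)
  qed
  then have 1: "card (gr_support K f) < card (gr_support K (spread K nbr1 f))"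
    by (rule card_support_spread[OF f(1)]) (auto intro: nbr1_leaf simp: nbr1_distinct)
  then have "gr_support K (spread K nbr1 f) \<noteq> {}" by auto
  then have 2: "card (gr_support K (spread K nbr1 f)) < card (gr_support K (main_part f))"
    unfolding main_part_def
    by (rule card_support_spread[OF spread_nbr1[OF f(1)]]) (rule nbr2_distinct nbr2_leaf; assumption)+
  have fin: "finite (gr_support K f)" using f by (simp add: fin_fun_def)
  \<comment> \<open>Off \<open>\<one>\<close>, each nonzero coefficient of the main part is
    cancelled by the unit part.\<close>
  have "gr_support K (main_part f) \<subseteq> insert \<one>\<^bsub>G\<^esub> (gr_support K (unit_part f))"
  proof (rule subsetI, rule ccontr)
    fix x assume x: "x \<in> gr_support K (main_part f)" "x \<notin> insert \<one>\<^bsub>G\<^esub> (gr_support K (unit_part f))"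
    have "single K \<one>\<^bsub>G\<^esub> \<one>\<^bsub>K\<^esub> x = unit_part f x \<oplus>\<^bsub>K\<^esub> main_part f x"
      using fun_cong[OF f(2), of x] by (simp add: one_KG comb_def fun_add_def)
    moreover have "main_part f x \<in> carrier K" using main_part_closed[OF f(1)] by (simp add: carrier_KG fin_fun_def)
    ultimately show False using x by (auto simp: single_def gr_support_def)
  qed
  also have "gr_support K (unit_part f) \<subseteq> hpart ` gr_support K f"
    unfolding unit_part_def using support_pushforward support_restrict_fun by (meson image_mono order_trans)
  finally have "gr_support K (main_part f) \<subseteq> insert \<one>\<^bsub>G\<^esub> (hpart ` gr_support K f)" by blast
  then have "card (gr_support K (main_part f)) \<le> card (insert \<one>\<^bsub>G\<^esub> (hpart ` gr_support K f))"
    using fin by (intro card_mono) auto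
  also have "\<dots> \<le> Suc (card (hpart ` gr_support K f))" by (simp add: card_insert_le_m1 card_insert_if fin)
  also have "\<dots> \<le> Suc (card (gr_support K f))" using card_image_le[OF fin] by simp
  finally show False using 1 2 by simp
qed

text \<open>A translate of a nonzero element of \<open>J\<close> has support away from
  \<open>\<one>\<close>, and multiplying by the inverse of one coefficient normalizes that
  coefficient.\<close>

lemma ideal_normalized_element:
  assumes J: "ideal J KG" "J \<noteq> {\<zero>\<^bsub>KG\<^esub>}"
  obtains a where "a \<in> J" "gr_support K a \<in> Lab" "a (pick (gr_support K a)) = \<one>\<^bsub>K\<^esub>"
proof -
  interpret J: ideal J KG by (rule J(1))
  interpret F: field K by (rule field_K)
  obtain r where r: "r \<in> J" "r \<noteq> \<zero>\<^bsub>KG\<^esub>" using J(2) J.zero_closed by blast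
  have rc: "r \<in> carrier KG" using r J.a_subset by blast
  have rs: "finite (gr_support K r)" "gr_support K r \<subseteq> carrier G" using rc by (simp_all add: carrier_KG fin_fun_def)
  have rn: "gr_support K r \<noteq> {}" using r(2) by (auto simp: zero_KG gr_support_def)
  \<comment> \<open>Left multiplication by \<open>z\<close> moves a point of the support to
    \<open>\<one>\<close> only if \<open>z\<close> is its inverse, which excludes finitely many
    \<open>z\<close>.\<close>
  have "infinite (carrier G - (\<lambda>x. inv\<^bsub>G\<^esub> x) ` gr_support K r)" using infinite_G rs by simp
  then obtain z where z: "z \<in> carrier G" "z \<notin> (\<lambda>x. inv\<^bsub>G\<^esub> x) ` gr_support K r"
    using infinite_imp_nonempty by blast
  define a1 where "a1 = single K z \<one>\<^bsub>K\<^esub> \<otimes>\<^bsub>KG\<^esub> r"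
  have a1: "a1 \<in> J" unfolding a1_def using r z by (intro J.I_l_closed) (auto intro: single_KG)
  have a1c: "a1 \<in> carrier KG" using a1 J.a_subset by blast
  have "a1 = pushforward K (\<lambda>x. z \<otimes>\<^bsub>G\<^esub> x) r" unfolding a1_def by (rule mult_KG_single_left[OF rc z(1)])
  then have a1s: "gr_support K a1 = (\<lambda>x. z \<otimes>\<^bsub>G\<^esub> x) ` gr_support K r"
    using support_pushforward_inj[of r "carrier G" "\<lambda>x. z \<otimes>\<^bsub>G\<^esub> x"] rc z
    by (simp add: carrier_KG inj_on_def)
  have "z \<otimes>\<^bsub>G\<^esub> x \<noteq> \<one>\<^bsub>G\<^esub>" if "x \<in> gr_support K r" for x
    using z that rs(2) G.inv_equality[of z x] by auto
  then have L: "gr_support K a1 \<in> Lab"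
    using rs rn z unfolding a1s by (intro Lab_all) auto
  define c where "c = a1 (pick (gr_support K a1))"
  have c: "c \<in> carrier K" "c \<noteq> \<zero>\<^bsub>K\<^esub>"
    using a1c pick[OF L] by (auto simp: c_def carrier_KG fin_fun_def gr_support_def)
  have ic: "inv\<^bsub>K\<^esub> c \<in> carrier K" "c \<otimes>\<^bsub>K\<^esub> inv\<^bsub>K\<^esub> c = \<one>\<^bsub>K\<^esub>" "inv\<^bsub>K\<^esub> c \<noteq> \<zero>\<^bsub>K\<^esub>"
  proof -
    have "c \<in> Units K" using c F.field_Units by simp
    then show "inv\<^bsub>K\<^esub> c \<in> carrier K" "c \<otimes>\<^bsub>K\<^esub> inv\<^bsub>K\<^esub> c = \<one>\<^bsub>K\<^esub>" by simp_all
    then show "inv\<^bsub>K\<^esub> c \<noteq> \<zero>\<^bsub>K\<^esub>" using c one_neq_zero by auto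
  qed
  define a where "a = a1 \<otimes>\<^bsub>KG\<^esub> single K \<one>\<^bsub>G\<^esub> (inv\<^bsub>K\<^esub> c)"
  have aeq: "a = (\<lambda>x. a1 x \<otimes>\<^bsub>K\<^esub> inv\<^bsub>K\<^esub> c)" unfolding a_def by (rule mult_KG_single_one[OF a1c ic(1)])
  have "a1 x \<in> carrier K" for x using a1c by (simp add: carrier_KG fin_fun_def)
  then have as: "gr_support K a = gr_support K a1"
    using ic F.integral_iff unfolding aeq gr_support_def by simp
  have "a \<in> J" unfolding a_def using a1 ic by (intro J.I_r_closed) (auto intro: single_KG)
  moreover have "a (pick (gr_support K a)) = \<one>\<^bsub>K\<^esub>" unfolding as using ic by (simp add: aeq flip: c_def)
  ultimately show thesis using L as that by simp
qed

text \<open>Put the coefficients of \<open>a\<close> on the vertices \<open>(L, g, \<one>)\<close>.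
  Then \<open>comb f\<close> is \<open>1 + e\<^sub>L(a)\<close>, and \<open>e\<^sub>L(a)\<close>
  lies in \<open>J\<close> as a sum of two-sided multiples of \<open>a\<close>.\<close>

lemma rho_comaximal:
  assumes J: "ideal J KG" "J \<noteq> {\<zero>\<^bsub>KG\<^esub>}"
  shows "\<exists>e\<in>J. \<one>\<^bsub>KG\<^esub> \<oplus>\<^bsub>KG\<^esub> e \<in> rho"
proof -
  interpret J: ideal J KG by (rule J(1))
  obtain a where a: "a \<in> J" "gr_support K a \<in> Lab" "a (pick (gr_support K a)) = \<one>\<^bsub>K\<^esub>"
    using J by (rule ideal_normalized_element)
  define L where "L = gr_support K a"
  have L: "L \<in> Lab" using a by (simp add: L_def)
  have ac: "a \<in> fin_fun K L" "a \<in> carrier KG"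
    using a(1) J.a_subset by (auto simp: carrier_KG fin_fun_def L_def)
  define m where "m = (\<lambda>g :: 'a. (L, g, \<one>\<^bsub>G\<^esub>))"
  define f where "f = pushforward K m a"
  have mL: "m ` L \<subseteq> vertices" using L by (auto simp: m_def vertices_def)
  have f: "f \<in> fin_fun K vertices" unfolding f_def by (rule fin_fun_pushforward[OF ac(1) mL])
  have spread_J: "spread K n g \<in> J" if "\<And>k. k < 3 \<Longrightarrow> pushforward K (n k) g \<in> J"
    for n :: "nat \<Rightarrow> 'v \<Rightarrow> 'a" and g
  proof -
    have "pushforward K (n 0) g \<in> J" "pushforward K (n 1) g \<in> J" "pushforward K (n 2) g \<in> J" using that by simp_all
    then show ?thesis unfolding spread_def by (simp flip: add_KG)
  qed
  have J_pq: "pushforward K (\<lambda>g. p \<otimes>\<^bsub>G\<^esub> g \<otimes>\<^bsub>G\<^esub> q) a \<in> J" if "p \<in> carrier G" "q \<in> carrier G" for p q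
  proof -
    have "pushforward K (\<lambda>g. p \<otimes>\<^bsub>G\<^esub> g \<otimes>\<^bsub>G\<^esub> q) a = pushforward K (\<lambda>x. x \<otimes>\<^bsub>G\<^esub> q) (pushforward K (\<lambda>g. p \<otimes>\<^bsub>G\<^esub> g) a)"
      by (simp add: pushforward_comp[OF ac(1)])
    also have "\<dots> = (single K p \<one>\<^bsub>K\<^esub> \<otimes>\<^bsub>KG\<^esub> a) \<otimes>\<^bsub>KG\<^esub> single K q \<one>\<^bsub>K\<^esub>"
      using ac that by (simp add: mult_KG_single_left mult_KG_single_right mult_KG_closed single_KG flip: mult_KG_single_left)
    also have "\<dots> \<in> J" using a(1) that by (intro J.I_r_closed J.I_l_closed) (auto intro: single_KG)
    finally show ?thesis .
  qed
  have "main_part f \<in> J"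
    unfolding main_part_def f_def spread_pushforward[OF ac(1)]
  proof (rule spread_J)
    fix i :: nat assume i: "i < 3"
    show "pushforward K (nbr2 i) (spread K (\<lambda>k v. nbr1 k (m v)) a) \<in> J"
      unfolding pushforward_spread[OF ac(1)]
    proof (rule spread_J)
      fix j :: nat assume "j < 3"
      let ?p = "t L i \<otimes>\<^bsub>G\<^esub> inv\<^bsub>G\<^esub> (conjugator L j)"
      have c: "t L i \<in> carrier G" "conjugator L j \<in> carrier G" using L i t_closed conjugator_closed by auto
      have "pushforward K (\<lambda>v. nbr2 i (nbr1 j (m v))) a = pushforward K (\<lambda>g. ?p \<otimes>\<^bsub>G\<^esub> g \<otimes>\<^bsub>G\<^esub> conjugator L j) a"
      proof (rule pushforward_cong)
        fix g assume "g \<in> gr_support K a"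
        then have "g \<in> carrier G" using L Lab by (auto simp: L_def)
        then show "nbr2 i (nbr1 j (m g)) = ?p \<otimes>\<^bsub>G\<^esub> g \<otimes>\<^bsub>G\<^esub> conjugator L j"
          using c by (simp add: nbr1_def nbr2_def m_def G.m_assoc)
      qed
      then show "pushforward K (\<lambda>v. nbr2 i (nbr1 j (m v))) a \<in> J" using J_pq c by simp
    qed
  qed
  \<comment> \<open>Of these vertices only that of \<open>pick L\<close> is marked, and its
    coefficient is normalized to 1.\<close>
  moreover have "unit_part f = \<one>\<^bsub>KG\<^esub>"
  proof -
    have "restrict_fun K marked f = pushforward K m (restrict_fun K (\<lambda>g. g = pick L) a)"
      unfolding f_def by (rule restrict_fun_pushforward[OF ac(1)]) (simp add: marked_def m_def)
    also have "restrict_fun K (\<lambda>g. g = pick L) a = single K (pick L) \<one>\<^bsub>K\<^esub>"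
      using a(3) by (auto simp: restrict_fun_def single_def L_def)
    finally show ?thesis
      by (simp add: unit_part_def pushforward_single hpart_def m_def one_KG)
  qed
  moreover have "comb f \<in> rho" using f by (auto simp: rho_def)
  ultimately show ?thesis by (intro bexI[of _ "main_part f"]) (simp_all add: comb_def add_KG)
qed

lemma right_primitive_KG: "right_primitive KG"
  by (rule KG.right_primitive_if_comaximal[OF rho_right_ideal one_notin_rho rho_comaximal])

end

section \<open>Unions of chains and countable locally free groups\<close>

lemma is_subgroup_of_inv:
  assumes "is_subgroup_of H G" "x \<in> carrier H"
  shows "inv\<^bsub>H\<^esub> x = inv\<^bsub>G\<^esub> x"
proof -
  interpret H: group H using assms by (simp add: is_subgroup_of_def)
  interpret G: group G using assms by (simp add: is_subgroup_of_def)
  have "inv\<^bsub>H\<^esub> x \<in> carrier G" "x \<in> carrier G"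
    using assms H.inv_closed[OF assms(2)] unfolding is_subgroup_of_def by blast+
  moreover have "inv\<^bsub>H\<^esub> x \<otimes>\<^bsub>G\<^esub> x = \<one>\<^bsub>G\<^esub>"
    using assms H.inv_closed[OF assms(2)] H.l_inv[OF assms(2)] is_subgroup_of_one[OF assms(1)]
    unfolding is_subgroup_of_def by metis
  ultimately show ?thesis using G.inv_equality by metis
qed

lemma is_subgroup_of_subgroup:
  assumes "is_subgroup_of H G"
  shows "subgroup (carrier H) G"
proof -
  interpret H: group H using assms by (simp add: is_subgroup_of_def)
  interpret G: group G using assms by (simp add: is_subgroup_of_def)
  have m: "x \<otimes>\<^bsub>G\<^esub> y \<in> carrier H" if "x \<in> carrier H" "y \<in> carrier H" for x y
    using assms that H.m_closed[OF that] unfolding is_subgroup_of_def by metis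
  have i: "inv\<^bsub>G\<^esub> x \<in> carrier H" if "x \<in> carrier H" for x
    using H.inv_closed[OF that] is_subgroup_of_inv[OF assms that] by simp
  show ?thesis
    by (rule G.subgroupI) (use assms H.one_closed m i in \<open>auto simp: is_subgroup_of_def\<close>)
qed

lemma is_subgroup_of_word_value:
  assumes HG: "is_subgroup_of H G" and w: "fst ` set w \<subseteq> carrier H"
  shows "word_value H w = word_value G w"
  using w
proof (induction w)
  case Nil
  then show ?case using is_subgroup_of_one[OF HG] by (simp add: word_value_def)
next
  case (Cons l w)
  interpret H: group H using HG by (simp add: is_subgroup_of_def)
  have "letter_value H l = letter_value G l"
    using Cons.prems is_subgroup_of_inv[OF HG] by (auto simp: letter_value_def)
  moreover have "letter_value H l \<in> carrier H" "word_value H w \<in> carrier H"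
    using Cons.prems H.letter_value_closed H.word_value_closed by auto
  ultimately show ?case
    using Cons HG by (simp add: word_value_def is_subgroup_of_def)
qed

lemma not_comm_group_noncommuting:
  assumes "group G" "\<not> comm_group G"
  obtains x y where "x \<in> carrier G" "y \<in> carrier G" "x \<otimes>\<^bsub>G\<^esub> y \<noteq> y \<otimes>\<^bsub>G\<^esub> x"
  using assms group.group_comm_groupI by blast

lemma (in free_chain) right_primitive_group_ring:
  assumes K: "field K"
  shows "right_primitive (group_ring K G)"
proof -
  define Lab where "Lab = {L. finite L \<and> L \<noteq> {} \<and> L \<subseteq> carrier G - {\<one>}}"
  have "Lab \<subseteq> {L. finite L \<and> L \<subseteq> carrier G}" by (auto simp: Lab_def)
  then obtain t :: "'a set \<Rightarrow> nat \<Rightarrow> 'a" where t: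
    "inj_on (\<lambda>(L, i). t L i) (Lab \<times> {..<3})" "free_family G ((\<lambda>(L, i). t L i) ` (Lab \<times> {..<3}))"
    by (rule free_family_labels)
  \<comment> \<open>The properties are bundled in one predicate so that \<open>u\<close>,
    \<open>b\<close> and \<open>E\<close> can be chosen together as functions of
    \<open>L\<close>.\<close>
  define P where "P L u b E \<longleftrightarrow> u \<in> carrier G \<and> b \<in> carrier G \<and> E \<subseteq> carrier G \<and>
    (\<forall>g\<in>L. inv u \<otimes> g \<otimes> u \<in> E \<and> inv u \<otimes> inv g \<otimes> u \<in> E) \<and>
    (\<forall>g\<in>L. \<forall>h\<in>L. g \<noteq> h \<longrightarrow> inv u \<otimes> (inv h \<otimes> g) \<otimes> u \<in> E) \<and>
    (\<forall>m\<in>E. \<forall>m'\<in>E. \<forall>d::int. d \<noteq> 0 \<longrightarrow> m \<otimes> b [^] d \<otimes> m' \<in> E) \<and> (\<forall>d::int. b [^] d \<notin> E)"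
    for L u b E
  have "\<exists>u b E. P L u b E" if L: "L \<in> Lab" for L
  proof -
    have "finite L" "L \<subseteq> carrier G - {\<one>}" using L by (simp_all add: Lab_def)
    then show ?thesis
    proof (rule separating_elements)
      fix u b E
      assume "u \<in> carrier G" "b \<in> carrier G" "E \<subseteq> carrier G"
        "\<And>g. g \<in> L \<Longrightarrow> inv u \<otimes> g \<otimes> u \<in> E" "\<And>g. g \<in> L \<Longrightarrow> inv u \<otimes> inv g \<otimes> u \<in> E"
        "\<And>g h. g \<in> L \<Longrightarrow> h \<in> L \<Longrightarrow> g \<noteq> h \<Longrightarrow> inv u \<otimes> (inv h \<otimes> g) \<otimes> u \<in> E"
        "\<And>m m' d. m \<in> E \<Longrightarrow> m' \<in> E \<Longrightarrow> d \<noteq> (0::int) \<Longrightarrow> m \<otimes> b [^] d \<otimes> m' \<in> E"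
        "\<And>d::int. b [^] d \<notin> E"
      then have "P L u b E" by (simp add: P_def)
      then show ?thesis by blast
    qed
  qed
  then obtain u b E where P: "\<And>L. L \<in> Lab \<Longrightarrow> P L (u L) (b L) (E L)" by metis
  have inf: "infinite (carrier G)"
  proof -
    obtain B where "free_family G B" "infinite B" by (rule large_free_family)
    then show ?thesis using finite_subset by (auto simp: free_family_def)
  qed
  interpret K: field K by (rule K)
  interpret labelled_group_ring G Lab t u b E K "\<lambda>L. SOME g. g \<in> L"
  proof unfold_locales
    fix L assume L: "L \<in> Lab"
    note PL = P[OF L, unfolded P_def]
    show "L \<subseteq> carrier G" using L by (auto simp: Lab_def)
    show "u L \<in> carrier G" "b L \<in> carrier G" "E L \<subseteq> carrier G" using PL by simp_all
    show "inv (u L) \<otimes> g \<otimes> u L \<in> E L" "inv (u L) \<otimes> inv g \<otimes> u L \<in> E L" if "g \<in> L" for g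
      using PL that by simp_all
    show "inv (u L) \<otimes> (inv h \<otimes> g) \<otimes> u L \<in> E L" if "g \<in> L" "h \<in> L" "g \<noteq> h" for g h
      using PL that by simp
    show "m \<otimes> b L [^] d \<otimes> m' \<in> E L" if "m \<in> E L" "m' \<in> E L" "d \<noteq> 0" for m m' and d :: int
      using PL that by simp
    show "b L [^] d \<notin> E L" for d :: int using PL by simp
    show "(SOME g. g \<in> L) \<in> L" using L by (simp add: Lab_def some_in_eq)
  next
    show "L \<in> Lab" if "finite L" "L \<noteq> {}" "L \<subseteq> carrier G - {\<one>}" for L
      using that by (simp add: Lab_def)
  qed (rule t inf K)+
  show ?thesis by (rule right_primitive_KG)
qed

text \<open>Words have the same values in a member of the chain as in the union, so the bases of the
  members carry over to subgroups of the union.\<close>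

lemma right_primitive_chain_union:
  fixes F :: "nat \<Rightarrow> ('g, 'm) monoid_scheme"
  assumes K: "field K" and free: "\<And>i. free_group (F i)" and nc: "\<not> comm_group (F 0)"
    and chain: "\<And>i. is_subgroup_of (F i) (F (Suc i))"
  shows "right_primitive (group_ring K (chain_union F))"
proof -
  let ?U = "chain_union F"
  have sub: "is_subgroup_of (F i) ?U" for i by (rule is_subgroup_of_chain_union[where F = F, OF chain])
  have "\<exists>T. free_basis (F i) T" for i using free by (simp add: free_group_def)
  then obtain T where T: "\<And>i. free_basis (F i) (T i)" by metis
  have U: "group ?U" using sub[of 0] by (simp add: is_subgroup_of_def)
  have carr: "carrier (F i) \<subseteq> carrier ?U" for i using sub[of i] by (simp add: is_subgroup_of_def)
  have "free_chain ?U T (\<lambda>i. carrier (F i))"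
  proof (intro free_chain.intro free_chain_axioms.intro)
    show "group ?U" by (rule U)
    fix i
    have Ti: "T i \<subseteq> carrier (F i)" using T by (simp add: free_basis_def)
    then show "T i \<subseteq> carrier ?U" using carr by blast
    have "word_value (F i) w = word_value ?U w" if "w \<in> words (T i)" for w
      using that Ti by (intro is_subgroup_of_word_value[OF sub]) (auto simp: words_def)
    then show "bij_betw (word_value ?U) (words (T i)) (carrier (F i))"
      using T[of i] bij_betw_cong[of "words (T i)" "word_value (F i)" "word_value ?U" "carrier (F i)"]
      by (simp add: free_basis_def flip: words_def)
    show "subgroup (carrier (F i)) ?U" by (rule is_subgroup_of_subgroup[OF sub])
    show "carrier (F i) \<subseteq> carrier (F (Suc i))" using chain by (simp add: is_subgroup_of_def)
  next
    show "(\<Union>i. carrier (F i)) = carrier ?U" by (simp add: chain_union_def)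
    have "group (F 0)" using free by (simp add: free_group_def)
    then obtain x y where "x \<in> carrier (F 0)" "y \<in> carrier (F 0)" "x \<otimes>\<^bsub>F 0\<^esub> y \<noteq> y \<otimes>\<^bsub>F 0\<^esub> x"
      using nc by (rule not_comm_group_noncommuting)
    then show "\<exists>x\<in>carrier (F 0). \<exists>y\<in>carrier (F 0). x \<otimes>\<^bsub>?U\<^esub> y \<noteq> y \<otimes>\<^bsub>?U\<^esub> x"
      using sub[of 0] by (auto simp: is_subgroup_of_def)
  qed
  then show ?thesis using K by (rule free_chain.right_primitive_group_ring)
qed

text \<open>An enumeration of \<open>G\<close> exhausts it by an ascending chain of finitely
  generated subgroups, which are free by local freeness.\<close>

lemma right_primitive_countable_locally_free:
  fixes G :: "'g monoid"
  assumes K: "field K" and G: "locally_free_group G" "countable (carrier G)" "\<not> comm_group G"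
  shows "right_primitive (group_ring K G)"
proof -
  interpret group G using G by (simp add: locally_free_group_def)
  obtain x y where xy: "x \<in> carrier G" "y \<in> carrier G" "x \<otimes>\<^bsub>G\<^esub> y \<noteq> y \<otimes>\<^bsub>G\<^esub> x"
    using is_group G(3) by (rule not_comm_group_noncommuting)
  obtain e :: "nat \<Rightarrow> 'g" where e: "carrier G = range e"
    using xy G(2) by (metis empty_iff uncountable_def)
  \<comment> \<open>The noncommuting elements \<open>x\<close> and \<open>y\<close> are included
    from the start, so that already \<open>F 0\<close> is not abelian.\<close>
  define A where "A i = {x, y} \<union> e ` {..<i}" for i
  define F where "F i = subgroup_generated G (A i)" for i
  have A: "A i \<subseteq> carrier G" "finite (A i)" for i using xy e by (auto simp: A_def)
  have FG: "carrier (F i) \<subseteq> carrier G" "A i \<subseteq> carrier (F i)" for i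
    using A(1)[of i] carrier_subgroup_generated_subset[of "A i"] generate.incl[of _ "carrier G \<inter> A i"]
    by (auto simp: F_def carrier_subgroup_generated)
  have free: "free_group (F i)" for i
    using G(1) A[of i] by (simp add: locally_free_group_def F_def)
  have mult: "x \<otimes>\<^bsub>F i\<^esub> y = x \<otimes>\<^bsub>G\<^esub> y" for x y i by (simp add: F_def)
  have "\<not> comm_group (F 0)"
  proof
    assume "comm_group (F 0)"
    then interpret F0: comm_group "F 0" .
    show False using F0.m_comm[of x y] FG(2)[of 0] xy by (auto simp: mult A_def)
  qed
  moreover have "is_subgroup_of (F i) (F (Suc i))" for i
  proof -
    have "A i \<subseteq> A (Suc i)" by (auto simp: A_def)
    then have "carrier (F i) \<subseteq> carrier (F (Suc i))"
      unfolding F_def carrier_subgroup_generated by (intro mono_generate) auto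
    then show ?thesis using free by (simp add: is_subgroup_of_def free_group_def mult)
  qed
  ultimately have "right_primitive (group_ring K (chain_union F))"
    using K free by (intro right_primitive_chain_union)
  \<comment> \<open>The records agree literally, because \<open>subgroup_generated\<close> keeps the
    operation and the unit of \<open>G\<close>.\<close>
  moreover have "chain_union F = G"
  proof (rule monoid.equality)
    have "e n \<in> carrier (F (Suc n))" for n using FG(2)[of "Suc n"] by (auto simp: A_def)
    then show "carrier (chain_union F) = carrier G"
      using FG(1) by (auto simp: chain_union_def e)
  qed (auto simp: chain_union_def mult F_def)
  ultimately show ?thesis by simp
qed

theorem corollary4p6:
  fixes K :: "'k ring" and F :: "nat \<Rightarrow> 'g monoid" and G :: "'g monoid"
  assumes "field K"
  shows "((\<forall>i. free_group (F i) \<and> \<not> comm_group (F i)) \<and> (\<forall>i. is_subgroup_of (F i) (F (Suc i)))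
            \<longrightarrow> right_primitive (group_ring K (chain_union F)))
       \<and> (locally_free_group G \<and> countable (carrier G) \<and> \<not> comm_group G
            \<longrightarrow> right_primitive (group_ring K G))"
  using right_primitive_chain_union[OF assms, of F] right_primitive_countable_locally_free[OF assms, of G]
  by (intro conjI impI) simp_all

end
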